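(* Let $E$ and $F$ be compact topological graphs and suppose that $E^0$ is totally disconnected. Let $\gamma^E$ and $\gamma^F$ be the gauge actions on the Toeplitz algebras $\mathcal{T}C^*(E)$ and $\mathcal{T}C^*(F)$, and let $M_E=\iota_{C(E^0)}(C(E^0))$ and $M_F=\iota_{C(F^0)}(C(F^0))$. Suppose that $(\mathcal{T}C^*(E),\gamma^E,M_E)\cong(\mathcal{T}C^*(F),\gamma^F,M_F)$. Then $E$ and $F$ are isomorphic as topological graphs.
   Context: A topological graph is a quadruple $E=(E^0,E^1,r_E,s_E)$ where $E^0,E^1$ are locally compact Hausdorff spaces, $r_E:E^1\to E^0$ is continuous and $s_E:E^1\to E^0$ is a local homeomorphism; it is compact if $E^0$ and $E^1$ are compact. Topological graphs $E$ and $F$ are isomorphic if there are homeomorphisms $\phi^0:E^0\to F^0$ and $\phi^1:E^1\to F^1$ with $r_F\circ\phi^1=\phi^0\circ r_E$ and $s_F\circ\phi^1=\phi^0\circ s_E$. For $E$ compact, the graph correspondence $X(E)$ is the $C^*$-correspondence over $C(E^0)$ which is $C(E^1)$ as a vector space, with $(x\cdot\alpha)(e)=x(e)\alpha(s_E(e))$, $(\alpha\cdot x)(e)=\alpha(r_E(e))x(e)$ and $\langle x,y\rangle_{C(E^0)}(v)=\sum_{s_E(e)=v}\overline{x(e)}y(e)$ (empty sums are $0$). A Toeplitz representation of a $C^*$-correspondence $X$ over $A$ in a $C^*$-algebra $B$ is a pair $(\psi,\pi)$ with $\psi:X\to B$ linear, $\pi:A\to B$ a $*$-homomorphism, $\psi(a\cdot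 x)=\pi(a)\psi(x)$, $\psi(x\cdot a)=\psi(x)\pi(a)$ and $\psi(x)^*\psi(y)=\pi(\langle x,y\rangle_A)$. $\mathcal{T}C^*(E)$ is the $C^*$-algebra generated by the universal Toeplitz representation $(\iota_{X(E)},\iota_{C(E^0)})$ of $X(E)$. The gauge action $\gamma^E:\mathbb{T}\to\operatorname{Aut}(\mathcal{T}C^*(E))$ is determined by $\gamma^E_z(\iota_{C(E^0)}(a))=\iota_{C(E^0)}(a)$ and $\gamma^E_z(\iota_{X(E)}(x))=z\,\iota_{X(E)}(x)$. $(\mathcal{T}C^*(E),\gamma^E,M_E)\cong(\mathcal{T}C^*(F),\gamma^F,M_F)$ means that there is a $*$-isomorphism $\theta:\mathcal{T}C^*(E)\to\mathcal{T}C^*(F)$ with $\theta\circ\gamma^E_z=\gamma^F_z\circ\theta$ for all $z\in\mathbb{T}$ and $\theta(M_E)=M_F$. *)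

theory Defs
  imports "HOL-Analysis.Analysis" "HOL-Algebra.Module"
begin

section \<open>Topological graphs\<close>

text \<open>Spaces are abstract topologies rather than types, so that the vertex space and the edge
  space may be empty.\<close>

record ('v, 'e) topological_graph =
  verts :: "'v topology"
  edges :: "'e topology"
  rng :: "'e \<Rightarrow> 'v"
  src :: "'e \<Rightarrow> 'v"

definition local_homeomorphism :: "'a topology \<Rightarrow> 'b topology \<Rightarrow> ('a \<Rightarrow> 'b) \<Rightarrow> bool" where
  "local_homeomorphism X Y f \<longleftrightarrow>
     (\<forall>x \<in> topspace X. \<exists>U. openin X U \<and> x \<in> U \<and> openin Y (f ` U) \<and>
        homeomorphic_map (subtopology X U) (subtopology Y (f ` U)) f)"

definition topological_graph :: "('v, 'e) topological_graph \<Rightarrow> bool" where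
  "topological_graph E \<longleftrightarrow>
     locally_compact_space (verts E) \<and> Hausdorff_space (verts E) \<and>
     locally_compact_space (edges E) \<and> Hausdorff_space (edges E) \<and>
     continuous_map (edges E) (verts E) (rng E) \<and>
     local_homeomorphism (edges E) (verts E) (src E)"

definition compact_topological_graph :: "('v, 'e) topological_graph \<Rightarrow> bool" where
  "compact_topological_graph E \<longleftrightarrow>
     topological_graph E \<and> compact_space (verts E) \<and> compact_space (edges E)"

definition graph_isomorphic ::
  "('v, 'e) topological_graph \<Rightarrow> ('w, 'f) topological_graph \<Rightarrow> bool" where
  "graph_isomorphic E F \<longleftrightarrow>
     (\<exists>\<phi>0 \<phi>1. homeomorphic_map (verts E) (verts F) \<phi>0 \<and> homeomorphic_map (edges E) (edges F) \<phi>1 \<and>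
        (\<forall>e \<in> topspace (edges E).
           rng F (\<phi>1 e) = \<phi>0 (rng E e) \<and> src F (\<phi>1 e) = \<phi>0 (src E e)))"

definition totally_disconnected_space :: "'a topology \<Rightarrow> bool" where
  "totally_disconnected_space X \<longleftrightarrow> (\<forall>S. connectedin X S \<longrightarrow> (\<exists>a. S \<subseteq> {a}))"


section \<open>\<open>C\<^sup>*\<close>-algebras\<close>

definition complex_ring :: "complex ring" where
  "complex_ring = \<lparr>carrier = UNIV, mult = (*), one = 1, zero = 0, add = (+)\<rparr>"

text \<open>\<open>C\<^sup>*\<close>-algebras need not be unital: the field \<open>one\<close> inherited from the library record is left
  unconstrained and is never used.\<close>

record 'a star_algebra = "(complex, 'a) module" +
  adj :: "'a \<Rightarrow> 'a"
  cnorm :: "'a \<Rightarrow> real"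

text \<open>\<open>Metric_space\<close> asks for nonnegativity and symmetry also off the carrier, hence the guard.\<close>

definition cdist :: "'a star_algebra \<Rightarrow> 'a \<Rightarrow> 'a \<Rightarrow> real" where
  "cdist A x y =
     (if x \<in> carrier A \<and> y \<in> carrier A then cnorm A (x \<ominus>\<^bsub>A\<^esub> y) else 0)"

abbreviation norm_topology :: "'a star_algebra \<Rightarrow> 'a topology" where
  "norm_topology A \<equiv> Metric_space.mtopology (carrier A) (cdist A)"

locale c_star_algebra = Module.module complex_ring A for A :: "'a star_algebra" (structure) +
  assumes mult_closed: "\<lbrakk>x \<in> carrier A; y \<in> carrier A\<rbrakk> \<Longrightarrow> x \<otimes> y \<in> carrier A"
    and mult_assoc: "\<lbrakk>x \<in> carrier A; y \<in> carrier A; z \<in> carrier A\<rbrakk> \<Longrightarrow> x \<otimes> y \<otimes> z = x \<otimes> (y \<otimes> z)"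
    and mult_add_left:
      "\<lbrakk>x \<in> carrier A; y \<in> carrier A; z \<in> carrier A\<rbrakk> \<Longrightarrow> (x \<oplus> y) \<otimes> z = x \<otimes> z \<oplus> y \<otimes> z"
    and mult_add_right:
      "\<lbrakk>x \<in> carrier A; y \<in> carrier A; z \<in> carrier A\<rbrakk> \<Longrightarrow> z \<otimes> (x \<oplus> y) = z \<otimes> x \<oplus> z \<otimes> y"
    and mult_smult_left: "\<lbrakk>x \<in> carrier A; y \<in> carrier A\<rbrakk> \<Longrightarrow> (c \<odot> x) \<otimes> y = c \<odot> (x \<otimes> y)"
    and mult_smult_right: "\<lbrakk>x \<in> carrier A; y \<in> carrier A\<rbrakk> \<Longrightarrow> x \<otimes> (c \<odot> y) = c \<odot> (x \<otimes> y)"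
    and adj_closed: "x \<in> carrier A \<Longrightarrow> adj A x \<in> carrier A"
    and adj_adj: "x \<in> carrier A \<Longrightarrow> adj A (adj A x) = x"
    and adj_add: "\<lbrakk>x \<in> carrier A; y \<in> carrier A\<rbrakk> \<Longrightarrow> adj A (x \<oplus> y) = adj A x \<oplus> adj A y"
    and adj_smult: "x \<in> carrier A \<Longrightarrow> adj A (c \<odot> x) = cnj c \<odot> adj A x"
    and adj_mult: "\<lbrakk>x \<in> carrier A; y \<in> carrier A\<rbrakk> \<Longrightarrow> adj A (x \<otimes> y) = adj A y \<otimes> adj A x"
    and cnorm_nonneg: "x \<in> carrier A \<Longrightarrow> 0 \<le> cnorm A x"
    and cnorm_zero_iff: "x \<in> carrier A \<Longrightarrow> cnorm A x = 0 \<longleftrightarrow> x = \<zero>"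
    and cnorm_add_le: "\<lbrakk>x \<in> carrier A; y \<in> carrier A\<rbrakk> \<Longrightarrow> cnorm A (x \<oplus> y) \<le> cnorm A x + cnorm A y"
    and cnorm_smult: "x \<in> carrier A \<Longrightarrow> cnorm A (c \<odot> x) = cmod c * cnorm A x"
    and cnorm_mult_le: "\<lbrakk>x \<in> carrier A; y \<in> carrier A\<rbrakk> \<Longrightarrow> cnorm A (x \<otimes> y) \<le> cnorm A x * cnorm A y"
    and c_star_identity: "x \<in> carrier A \<Longrightarrow> cnorm A (adj A x \<otimes> x) = (cnorm A x)\<^sup>2"
    and complete: "Metric_space.mcomplete (carrier A) (cdist A)"

definition linear_map ::
  "(complex, 'x, 'm) module_scheme \<Rightarrow> (complex, 'b, 'n) module_scheme \<Rightarrow> ('x \<Rightarrow> 'b) \<Rightarrow> bool" where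
  "linear_map X B h \<longleftrightarrow>
     h \<in> carrier X \<rightarrow> carrier B \<and>
     (\<forall>x \<in> carrier X. \<forall>y \<in> carrier X. h (x \<oplus>\<^bsub>X\<^esub> y) = h x \<oplus>\<^bsub>B\<^esub> h y) \<and>
     (\<forall>c. \<forall>x \<in> carrier X. h (c \<odot>\<^bsub>X\<^esub> x) = c \<odot>\<^bsub>B\<^esub> h x)"

definition star_hom :: "'a star_algebra \<Rightarrow> 'b star_algebra \<Rightarrow> ('a \<Rightarrow> 'b) \<Rightarrow> bool" where
  "star_hom A B h \<longleftrightarrow>
     linear_map A B h \<and>
     (\<forall>x \<in> carrier A. \<forall>y \<in> carrier A. h (x \<otimes>\<^bsub>A\<^esub> y) = h x \<otimes>\<^bsub>B\<^esub> h y) \<and>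
     (\<forall>x \<in> carrier A. h (adj A x) = adj B (h x))"

definition star_iso :: "'a star_algebra \<Rightarrow> 'b star_algebra \<Rightarrow> ('a \<Rightarrow> 'b) \<Rightarrow> bool" where
  "star_iso A B h \<longleftrightarrow> star_hom A B h \<and> bij_betw h (carrier A) (carrier B)"

definition c_star_subalgebra :: "'a set \<Rightarrow> 'a star_algebra \<Rightarrow> bool" where
  "c_star_subalgebra S A \<longleftrightarrow>
     S \<subseteq> carrier A \<and> \<zero>\<^bsub>A\<^esub> \<in> S \<and>
     (\<forall>x \<in> S. \<forall>y \<in> S. x \<oplus>\<^bsub>A\<^esub> y \<in> S) \<and>
     (\<forall>x \<in> S. \<forall>y \<in> S. x \<otimes>\<^bsub>A\<^esub> y \<in> S) \<and>
     (\<forall>c. \<forall>x \<in> S. c \<odot>\<^bsub>A\<^esub> x \<in> S) \<and>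
     (\<forall>x \<in> S. adj A x \<in> S) \<and>
     closedin (norm_topology A) S"

definition generated_c_star_subalgebra :: "'a star_algebra \<Rightarrow> 'a set \<Rightarrow> 'a set" where
  "generated_c_star_subalgebra A G = \<Inter>{S. c_star_subalgebra S A \<and> G \<subseteq> S}"


section \<open>Correspondences and Toeplitz algebras\<close>

text \<open>As with any \<open>module\<close> record, the inherited ring fields \<open>mult\<close> and \<open>one\<close> play no role.
  The inner product is linear in the second variable.\<close>

record ('a, 'x) correspondence = "(complex, 'x) module" +
  ract :: "'x \<Rightarrow> 'a \<Rightarrow> 'x"
  lact :: "'a \<Rightarrow> 'x \<Rightarrow> 'x"
  inprod :: "'x \<Rightarrow> 'x \<Rightarrow> 'a"

definition toeplitz_rep ::
  "'a star_algebra \<Rightarrow> ('a, 'x) correspondence \<Rightarrow> 'b star_algebra \<Rightarrow>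
     ('x \<Rightarrow> 'b) \<Rightarrow> ('a \<Rightarrow> 'b) \<Rightarrow> bool" where
  "toeplitz_rep A X B \<psi> \<pi> \<longleftrightarrow>
     linear_map X B \<psi> \<and> star_hom A B \<pi> \<and>
     (\<forall>a \<in> carrier A. \<forall>x \<in> carrier X. \<psi> (lact X a x) = \<pi> a \<otimes>\<^bsub>B\<^esub> \<psi> x) \<and>
     (\<forall>a \<in> carrier A. \<forall>x \<in> carrier X. \<psi> (ract X x a) = \<psi> x \<otimes>\<^bsub>B\<^esub> \<pi> a) \<and>
     (\<forall>x \<in> carrier X. \<forall>y \<in> carrier X. adj B (\<psi> x) \<otimes>\<^bsub>B\<^esub> \<psi> y = \<pi> (inprod X x y))"

text \<open>A definition in HOL cannot quantify over \<open>C\<^sup>*\<close>-algebras on arbitrary types. The universal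
  property is therefore required for \<open>C\<^sup>*\<close>-algebras whose elements are formal expressions in the
  generators. Every \<open>C\<^sup>*\<close>-algebra generated by a Toeplitz representation has an isomorphic copy of
  this kind, so this is no restriction: see \<open>universal_toeplitz_rep_extends\<close> below, which is the
  universal property for \<open>C\<^sup>*\<close>-algebras on any type.\<close>

datatype 'g cexpr =
    Gen 'g | Zero | Add "'g cexpr" "'g cexpr" | Mult "'g cexpr" "'g cexpr"
  | Scale complex "'g cexpr" | Adj "'g cexpr" | Lim "nat \<Rightarrow> 'g cexpr"

definition universal_toeplitz_rep ::
  "'a star_algebra \<Rightarrow> ('a, 'x) correspondence \<Rightarrow> 't star_algebra \<Rightarrow>
     ('x \<Rightarrow> 't) \<Rightarrow> ('a \<Rightarrow> 't) \<Rightarrow> bool" where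
  "universal_toeplitz_rep A X T \<iota>X \<iota>A \<longleftrightarrow>
     c_star_algebra T \<and> toeplitz_rep A X T \<iota>X \<iota>A \<and>
     generated_c_star_subalgebra T (\<iota>X ` carrier X \<union> \<iota>A ` carrier A) = carrier T \<and>
     (\<forall>(B :: ('x + 'a) cexpr star_algebra) \<psi> \<pi>.
        c_star_algebra B \<and> toeplitz_rep A X B \<psi> \<pi> \<longrightarrow>
        (\<exists>h. star_hom T B h \<and>
             (\<forall>x \<in> carrier X. h (\<iota>X x) = \<psi> x) \<and> (\<forall>a \<in> carrier A. h (\<iota>A a) = \<pi> a)))"

definition gauge_action ::
  "'a star_algebra \<Rightarrow> ('a, 'x) correspondence \<Rightarrow> 't star_algebra \<Rightarrow>
     ('x \<Rightarrow> 't) \<Rightarrow> ('a \<Rightarrow> 't) \<Rightarrow> (complex \<Rightarrow> 't \<Rightarrow> 't) \<Rightarrow> bool" where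
  "gauge_action A X T \<iota>X \<iota>A \<gamma> \<longleftrightarrow>
     (\<forall>z \<in> sphere 0 1. star_iso T T (\<gamma> z)) \<and>
     (\<forall>z \<in> sphere 0 1. \<forall>w \<in> sphere 0 1. \<forall>t \<in> carrier T. \<gamma> (z * w) t = \<gamma> z (\<gamma> w t)) \<and>
     (\<forall>z \<in> sphere 0 1. \<forall>a \<in> carrier A. \<gamma> z (\<iota>A a) = \<iota>A a) \<and>
     (\<forall>z \<in> sphere 0 1. \<forall>x \<in> carrier X. \<gamma> z (\<iota>X x) = z \<odot>\<^bsub>T\<^esub> \<iota>X x)"

definition triple_isomorphic ::
  "'s star_algebra \<times> (complex \<Rightarrow> 's \<Rightarrow> 's) \<times> 's set \<Rightarrow>
   't star_algebra \<times> (complex \<Rightarrow> 't \<Rightarrow> 't) \<times> 't set \<Rightarrow> bool" where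
  "triple_isomorphic = (\<lambda>(S, \<gamma>, M) (T, \<delta>, N).
     \<exists>\<theta>. star_iso S T \<theta> \<and>
         (\<forall>z \<in> sphere 0 1. \<forall>s \<in> carrier S. \<theta> (\<gamma> z s) = \<delta> z (\<theta> s)) \<and> \<theta> ` M = N)"


section \<open>The graph correspondence\<close>

text \<open>Continuous functions on \<open>X\<close> are represented by functions on the whole type that vanish
  outside the space. For compact \<open>X\<close> the supremum below is the sup norm over the space, and it is
  \<open>0\<close> if the space is empty. In the inner product below the fibres of the source map are finite
  when the edge space is compact, and empty over points outside the vertex space.\<close>

definition cfun :: "'v topology \<Rightarrow> ('v \<Rightarrow> complex) set" where
  "cfun X = {f. continuous_map X euclidean f \<and> (\<forall>v. v \<notin> topspace X \<longrightarrow> f v = 0)}"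

definition cfun_algebra :: "'v topology \<Rightarrow> ('v \<Rightarrow> complex) star_algebra" where
  "cfun_algebra X =
     \<lparr>carrier = cfun X,
      mult = (\<lambda>f g v. f v * g v),
      one = indicator (topspace X),
      zero = (\<lambda>v. 0),
      add = (\<lambda>f g v. f v + g v),
      smult = (\<lambda>c f v. c * f v),
      adj = (\<lambda>f v. cnj (f v)),
      cnorm = (\<lambda>f. SUP v. cmod (f v))\<rparr>"

definition graph_correspondence ::
  "('v, 'e) topological_graph \<Rightarrow> ('v \<Rightarrow> complex, 'e \<Rightarrow> complex) correspondence" where
  "graph_correspondence E =
     \<lparr>carrier = cfun (edges E),
      mult = (\<lambda>x y e. x e * y e),
      one = indicator (topspace (edges E)),
      zero = (\<lambda>e. 0),
      add = (\<lambda>x y e. x e + y e),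
      smult = (\<lambda>c x e. c * x e),
      ract = (\<lambda>x \<alpha> e. x e * \<alpha> (src E e)),
      lact = (\<lambda>\<alpha> x e. \<alpha> (rng E e) * x e),
      inprod = (\<lambda>x y v. \<Sum>e \<in> {e \<in> topspace (edges E). src E e = v}. cnj (x e) * y e)\<rparr>"

abbreviation is_toeplitz_algebra ::
  "('v, 'e) topological_graph \<Rightarrow> 't star_algebra \<Rightarrow>
     (('e \<Rightarrow> complex) \<Rightarrow> 't) \<Rightarrow> (('v \<Rightarrow> complex) \<Rightarrow> 't) \<Rightarrow> bool" where
  "is_toeplitz_algebra E \<equiv>
     universal_toeplitz_rep (cfun_algebra (verts E)) (graph_correspondence E)"

abbreviation is_gauge_action ::
  "('v, 'e) topological_graph \<Rightarrow> 't star_algebra \<Rightarrow>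
     (('e \<Rightarrow> complex) \<Rightarrow> 't) \<Rightarrow> (('v \<Rightarrow> complex) \<Rightarrow> 't) \<Rightarrow> (complex \<Rightarrow> 't \<Rightarrow> 't) \<Rightarrow> bool" where
  "is_gauge_action E \<equiv>
     gauge_action (cfun_algebra (verts E)) (graph_correspondence E)"


section \<open>The universal property for \<open>C\<^sup>*\<close>-algebras on any type\<close>

lemma cring_complex_ring: "cring complex_ring"
proof (rule cringI)
  show "abelian_group complex_ring"
  proof (rule abelian_groupI)
    fix x assume "x \<in> carrier complex_ring"
    show "\<exists>y\<in>carrier complex_ring. y \<oplus>\<^bsub>complex_ring\<^esub> x = \<zero>\<^bsub>complex_ring\<^esub>"
      by (intro bexI[of _ "- x"]) (auto simp: complex_ring_def)
  qed (auto simp: complex_ring_def)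
  show "comm_monoid complex_ring"
    by (rule comm_monoidI) (auto simp: complex_ring_def)
qed (auto simp: complex_ring_def algebra_simps)

context c_star_algebra
begin

lemma cnorm_zero: "cnorm A \<zero> = 0"
  using cnorm_zero_iff by auto

lemma smult_carrier: "x \<in> carrier A \<Longrightarrow> c \<odot> x \<in> carrier A"
  by (rule smult_closed) (auto simp: complex_ring_def)

lemma smult_minus_one: "x \<in> carrier A \<Longrightarrow> (- 1) \<odot> x = \<ominus> x"
proof -
  assume x: "x \<in> carrier A"
  have one: "1 \<odot> x = x" using smult_one[OF x] by (simp add: complex_ring_def)
  have "(1 + (- 1)) \<odot> x = 1 \<odot> x \<oplus> (-1) \<odot> x"
    using smult_l_distr[of 1 "-1" x] x by (simp add: complex_ring_def)
  moreover have "0 \<odot> x = \<zero>"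
    using cnorm_smult[OF x, of 0] cnorm_zero_iff[OF smult_carrier[OF x]] by simp
  ultimately have "x \<oplus> (-1) \<odot> x = \<zero>" using one by simp
  then show ?thesis
    using x smult_carrier by (metis a_comm minus_equality)
qed

lemma Metric_space_cdist: "Metric_space (carrier A) (cdist A)"
proof
  fix x y z
  show "0 \<le> cdist A x y"
    by (simp add: cdist_def cnorm_nonneg)
  have "x \<ominus> y = (- 1) \<odot> (y \<ominus> x)" if "x \<in> carrier A" "y \<in> carrier A"
    using that by (simp add: smult_minus_one minus_add minus_eq a_comm)
  then show "cdist A x y = cdist A y x"
    using cnorm_smult[of "y \<ominus> x" "-1"] by (simp add: cdist_def)
  assume xy: "x \<in> carrier A" "y \<in> carrier A"
  have eq: "x \<ominus> y = \<zero> \<longleftrightarrow> x = y"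
    using xy by (metis a_inv_closed minus_eq minus_equality minus_minus r_neg)
  from xy show "cdist A x y = 0 \<longleftrightarrow> x = y"
    using cnorm_zero_iff[of "x \<ominus> y"] eq by (auto simp: cdist_def)
  assume z: "z \<in> carrier A"
  have "x \<ominus> z = (x \<ominus> y) \<oplus> (y \<ominus> z)"
    using xy z by (simp add: minus_eq a_assoc r_neg1)
  then show "cdist A x z \<le> cdist A x y + cdist A y z"
    unfolding cdist_def using xy z cnorm_add_le[of "x \<ominus> y" "y \<ominus> z"] by simp
qed

end

text \<open>Transport of a subalgebra \<open>S\<close> of \<open>A\<close> along an injection \<open>j\<close> on \<open>S\<close> with inverse \<open>k\<close>.\<close>

definition transport :: "'b star_algebra \<Rightarrow> 'b set \<Rightarrow> ('b \<Rightarrow> 'c) \<Rightarrow> ('c \<Rightarrow> 'b) \<Rightarrow> 'c star_algebra" where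
  "transport A S j k =
     \<lparr>carrier = j ` S,
      mult = (\<lambda>x y. j (k x \<otimes>\<^bsub>A\<^esub> k y)),
      one = j \<one>\<^bsub>A\<^esub>,
      zero = j \<zero>\<^bsub>A\<^esub>,
      add = (\<lambda>x y. j (k x \<oplus>\<^bsub>A\<^esub> k y)),
      smult = (\<lambda>c x. j (c \<odot>\<^bsub>A\<^esub> k x)),
      adj = (\<lambda>x. j (adj A (k x))),
      cnorm = (\<lambda>x. cnorm A (k x))\<rparr>"

lemma c_star_algebra_transport:
  assumes A: "c_star_algebra A" and S: "c_star_subalgebra S A"
    and kj: "\<And>s. s \<in> S \<Longrightarrow> k (j s) = s"
  shows "c_star_algebra (transport A S j k)"
proof -
  interpret c_star_algebra A by fact
  interpret Metric_space "carrier A" "cdist A" by (rule Metric_space_cdist)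
  let ?B = "transport A S j k"
  have sub: "S \<subseteq> carrier A" and cl: "closedin mtopology S"
    and z: "\<zero>\<^bsub>A\<^esub> \<in> S" and add: "\<And>x y. x \<in> S \<Longrightarrow> y \<in> S \<Longrightarrow> x \<oplus>\<^bsub>A\<^esub> y \<in> S"
    and mul: "\<And>x y. x \<in> S \<Longrightarrow> y \<in> S \<Longrightarrow> x \<otimes>\<^bsub>A\<^esub> y \<in> S"
    and sc: "\<And>c x. x \<in> S \<Longrightarrow> c \<odot>\<^bsub>A\<^esub> x \<in> S" and ad: "\<And>x. x \<in> S \<Longrightarrow> adj A x \<in> S"
    using S by (auto simp: c_star_subalgebra_def)
  have inS: "x \<in> carrier A" if "x \<in> S" for x using sub that by auto
  have neg: "\<ominus>\<^bsub>A\<^esub> x \<in> S" if "x \<in> S" for x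
    using sc[OF that, of "-1"] smult_minus_one[OF inS[OF that]] by simp
  note cl_simps = z add mul sc ad neg inS kj
  have ab: "abelian_group ?B"
  proof (rule abelian_groupI)
    fix x assume "x \<in> carrier ?B"
    then obtain s where s: "s \<in> S" "x = j s" by (auto simp: transport_def)
    then show "\<exists>y\<in>carrier ?B. y \<oplus>\<^bsub>?B\<^esub> x = \<zero>\<^bsub>?B\<^esub>"
      by (intro bexI[of _ "j (\<ominus>\<^bsub>A\<^esub> s)"]) (auto simp: transport_def cl_simps l_neg)
  next
    fix x y assume "x \<in> carrier ?B" "y \<in> carrier ?B"
    then show "x \<oplus>\<^bsub>?B\<^esub> y = y \<oplus>\<^bsub>?B\<^esub> x"
      by (auto simp: transport_def cl_simps M.a_comm)
  qed (auto simp: transport_def cl_simps a_assoc)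
  interpret B: abelian_group ?B by (rule ab)
  have minus: "j s \<ominus>\<^bsub>?B\<^esub> j t = j (s \<ominus>\<^bsub>A\<^esub> t)" if "s \<in> S" "t \<in> S" for s t
  proof -
    have "\<ominus>\<^bsub>?B\<^esub> j t = j (\<ominus>\<^bsub>A\<^esub> t)"
      by (rule B.minus_equality) (use that in \<open>auto simp: transport_def cl_simps l_neg\<close>)
    then show ?thesis
      using that unfolding a_minus_def by (simp add: transport_def cl_simps)
  qed
  have dist: "cdist ?B (j s) (j t) = cdist A s t" if "s \<in> S" "t \<in> S" for s t
  proof -
    have "s \<ominus>\<^bsub>A\<^esub> t \<in> S" using that by (simp add: a_minus_def cl_simps)
    then show ?thesis
      using that minus[OF that] by (simp add: cdist_def inS) (simp add: transport_def kj)
  qed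
  have carB: "carrier ?B = j ` S" by (simp add: transport_def)
  have metB: "Metric_space (j ` S) (cdist ?B)"
  proof
    fix x y z
    show "0 \<le> cdist ?B x y"
      using nonneg dist by (cases "x \<in> j ` S \<and> y \<in> j ` S") (auto simp: cdist_def carB)
    show "cdist ?B x y = cdist ?B y x"
    proof (cases "x \<in> j ` S \<and> y \<in> j ` S")
      case True
      then show ?thesis using dist commute by auto
    next
      case False
      then show ?thesis by (auto simp: cdist_def carB)
    qed
    assume x: "x \<in> j ` S" and y: "y \<in> j ` S"
    then show "cdist ?B x y = 0 \<longleftrightarrow> x = y"
      using dist zero inS kj by (metis imageE)
    assume "z \<in> j ` S"
    then show "cdist ?B x z \<le> cdist ?B x y + cdist ?B y z"
      using x y dist triangle inS by auto
  qed
  interpret MB: Metric_space "j ` S" "cdist ?B" by (rule metB)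
  have compl: "MB.mcomplete"
    unfolding MB.mcomplete_def
  proof (intro allI impI)
    fix \<sigma> assume \<sigma>: "MB.MCauchy \<sigma>"
    have "\<forall>n. \<exists>s. s \<in> S \<and> \<sigma> n = j s"
      using \<sigma> unfolding MB.MCauchy_def by (meson image_iff range_subsetD)
    then obtain \<tau> where \<tau>: "\<And>n. \<tau> n \<in> S" "\<And>n. \<sigma> n = j (\<tau> n)" by metis
    have "MCauchy \<tau>"
      using \<sigma> unfolding MCauchy_def MB.MCauchy_def
      by (simp add: \<tau> dist inS image_subset_iff)
    then obtain l where l: "limitin mtopology \<tau> l sequentially"
      using complete by (auto simp: mcomplete_def)
    have "l \<in> S"
      using cl l \<tau> unfolding metric_closedin_iff_sequentially_closed by blast
    then have "limitin MB.mtopology \<sigma> (j l) sequentially"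
      using l unfolding limit_metric_sequentially MB.limit_metric_sequentially
      by (simp add: \<tau> dist inS)
    then show "\<exists>x. limitin MB.mtopology \<sigma> x sequentially" ..
  qed
  have one: "1 \<odot>\<^bsub>A\<^esub> x = x" if "x \<in> carrier A" for x
    using smult_one[OF that] by (simp add: complex_ring_def)
  have addc: "(c + d) \<odot>\<^bsub>A\<^esub> x = c \<odot>\<^bsub>A\<^esub> x \<oplus>\<^bsub>A\<^esub> d \<odot>\<^bsub>A\<^esub> x" if "x \<in> carrier A" for c d x
    using smult_l_distr[OF _ _ that, of c d] by (simp add: complex_ring_def)
  have mulc: "(c * d) \<odot>\<^bsub>A\<^esub> x = c \<odot>\<^bsub>A\<^esub> (d \<odot>\<^bsub>A\<^esub> x)" if "x \<in> carrier A" for c d x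
    using smult_assoc1[OF _ _ that, of c d] by (simp add: complex_ring_def)
  have distc: "c \<odot>\<^bsub>A\<^esub> (x \<oplus>\<^bsub>A\<^esub> y) = c \<odot>\<^bsub>A\<^esub> x \<oplus>\<^bsub>A\<^esub> c \<odot>\<^bsub>A\<^esub> y" if "x \<in> carrier A" "y \<in> carrier A" for c x y
    using smult_r_distr[OF _ that, of c] by (simp add: complex_ring_def)
  show ?thesis
  proof (intro c_star_algebra.intro c_star_algebra_axioms.intro)
    show "Module.module complex_ring ?B"
      by (intro moduleI cring_complex_ring ab)
        (auto simp: transport_def cl_simps complex_ring_def one addc mulc distc)
    show "Metric_space.mcomplete (carrier ?B) (cdist ?B)"
      using compl by (simp add: carB)
    fix x assume "x \<in> carrier ?B"
    then obtain s where s: "s \<in> S" "x = j s" by (auto simp: transport_def)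
    show "cnorm ?B x = 0 \<longleftrightarrow> x = \<zero>\<^bsub>?B\<^esub>"
      using s cnorm_zero_iff[OF inS[OF s(1)]] kj[OF s(1)] kj[OF z]
      by (auto simp: transport_def)
  qed (auto simp: transport_def cl_simps mult_assoc mult_add_left mult_add_right mult_smult_left
      mult_smult_right adj_adj adj_add adj_smult adj_mult cnorm_nonneg cnorm_add_le cnorm_smult
      cnorm_mult_le c_star_identity)
qed

primrec cexpr_val :: "'b star_algebra \<Rightarrow> ('g \<Rightarrow> 'b) \<Rightarrow> 'g cexpr \<Rightarrow> 'b" where
  "cexpr_val B g (Gen u) = g u"
| "cexpr_val B g Zero = \<zero>\<^bsub>B\<^esub>"
| "cexpr_val B g (Add s t) = cexpr_val B g s \<oplus>\<^bsub>B\<^esub> cexpr_val B g t"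
| "cexpr_val B g (Mult s t) = cexpr_val B g s \<otimes>\<^bsub>B\<^esub> cexpr_val B g t"
| "cexpr_val B g (Scale c t) = c \<odot>\<^bsub>B\<^esub> cexpr_val B g t"
| "cexpr_val B g (Adj t) = adj B (cexpr_val B g t)"
| "cexpr_val B g (Lim f) = (THE l. limitin (norm_topology B) (\<lambda>n. cexpr_val B g (f n)) l sequentially)"

lemma c_star_subalgebra_cexpr_val:
  assumes "c_star_algebra B"
  shows "c_star_subalgebra (carrier B \<inter> range (cexpr_val B g)) B"
proof -
  interpret c_star_algebra B by fact
  interpret Metric_space "carrier B" "cdist B" by (rule Metric_space_cdist)
  let ?R = "range (cexpr_val B g)"
  have "closedin mtopology (carrier B \<inter> ?R)"
    unfolding metric_closedin_iff_sequentially_closed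
  proof (intro conjI allI impI)
    fix \<sigma> l assume *: "range \<sigma> \<subseteq> carrier B \<inter> ?R \<and> limitin mtopology \<sigma> l sequentially"
    then have "\<forall>n. \<exists>t. \<sigma> n = cexpr_val B g t" by (meson Int_iff UNIV_I image_iff subset_iff)
    then obtain f where f: "\<sigma> = (\<lambda>n. cexpr_val B g (f n))" by metis
    have lim: "limitin mtopology (\<lambda>n. cexpr_val B g (f n)) l sequentially" using * f by simp
    then have "cexpr_val B g (Lim f) = l"
      unfolding cexpr_val.simps
      by (rule the_equality) (rule limitin_metric_unique[OF _ lim sequentially_bot])
    moreover have "l \<in> carrier B" using * limitin_mspace by blast
    ultimately show "l \<in> carrier B \<inter> ?R" by blast
  qed auto
  moreover have "\<zero>\<^bsub>B\<^esub> \<in> ?R"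
    by (rule range_eqI[of _ _ Zero]) simp
  moreover have "x \<oplus>\<^bsub>B\<^esub> y \<in> ?R \<and> x \<otimes>\<^bsub>B\<^esub> y \<in> ?R \<and> c \<odot>\<^bsub>B\<^esub> x \<in> ?R \<and> adj B x \<in> ?R"
    if xy: "x \<in> ?R" "y \<in> ?R" for x y c
  proof -
    from xy obtain s t where "x = cexpr_val B g s" "y = cexpr_val B g t" by blast
    then show ?thesis
      by (auto intro: range_eqI[of _ _ "Add s t"] range_eqI[of _ _ "Mult s t"]
          range_eqI[of _ _ "Scale c s"] range_eqI[of _ _ "Adj s"])
  qed
  ultimately show ?thesis
    unfolding c_star_subalgebra_def using mult_closed adj_closed smult_carrier by auto
qed

theorem universal_toeplitz_rep_extends:
  assumes univ: "universal_toeplitz_rep A X T \<iota>X \<iota>A"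
    and B: "c_star_algebra B" and rep: "toeplitz_rep A X B \<psi> \<pi>"
  shows "\<exists>h. star_hom T B h \<and>
    (\<forall>x \<in> carrier X. h (\<iota>X x) = \<psi> x) \<and> (\<forall>a \<in> carrier A. h (\<iota>A a) = \<pi> a)"
proof -
  define g where "g = case_sum \<psi> \<pi>"
  define S where "S = carrier B \<inter> range (cexpr_val B g)"
  define j where "j = inv_into UNIV (cexpr_val B g)"
  define k where "k = cexpr_val B g"
  let ?C = "transport B S j k"
  have S: "c_star_subalgebra S B"
    unfolding S_def by (rule c_star_subalgebra_cexpr_val[OF B])
  have kj: "k (j s) = s" if "s \<in> S" for s
    using that by (auto simp: S_def k_def j_def f_inv_into_f)
  have C: "c_star_algebra ?C"
    by (rule c_star_algebra_transport[OF B S]) (rule kj)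
  have gen: "\<psi> x \<in> range (cexpr_val B g)" "\<pi> a \<in> range (cexpr_val B g)" for x a
    using rangeI[of "cexpr_val B g" "Gen (Inl x)"] rangeI[of "cexpr_val B g" "Gen (Inr a)"]
    by (simp_all add: g_def)
  have "\<psi> \<in> carrier X \<rightarrow> carrier B" "\<pi> \<in> carrier A \<rightarrow> carrier B"
    using rep by (simp_all add: toeplitz_rep_def star_hom_def linear_map_def)
  then have in_S: "x \<in> carrier X \<Longrightarrow> \<psi> x \<in> S" and in_S': "a \<in> carrier A \<Longrightarrow> \<pi> a \<in> S" for x a
    unfolding S_def using gen by (simp_all add: Pi_iff)
  have adj_S: "adj B s \<in> S" if "s \<in> S" for s
    using S that by (simp add: c_star_subalgebra_def)
  have sel: "carrier ?C = j ` S" "x \<oplus>\<^bsub>?C\<^esub> y = j (k x \<oplus>\<^bsub>B\<^esub> k y)"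
    "x \<otimes>\<^bsub>?C\<^esub> y = j (k x \<otimes>\<^bsub>B\<^esub> k y)" "c \<odot>\<^bsub>?C\<^esub> x = j (c \<odot>\<^bsub>B\<^esub> k x)"
    "adj ?C x = j (adj B (k x))" for x y c
    by (simp_all add: transport_def)
  have "toeplitz_rep A X ?C (j \<circ> \<psi>) (j \<circ> \<pi>)"
    using rep
    by (simp add: toeplitz_rep_def star_hom_def linear_map_def sel Pi_iff kj in_S in_S' adj_S)
  then obtain h where h: "star_hom T ?C h"
      "\<And>x. x \<in> carrier X \<Longrightarrow> h (\<iota>X x) = j (\<psi> x)" "\<And>a. a \<in> carrier A \<Longrightarrow> h (\<iota>A a) = j (\<pi> a)"
    using univ C unfolding universal_toeplitz_rep_def o_def by blast
  have hS: "\<exists>s \<in> S. h t = j s" if "t \<in> carrier T" for t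
    using h(1) that by (auto simp: star_hom_def linear_map_def sel Pi_iff)
  have "star_hom T B (k \<circ> h)"
    unfolding star_hom_def linear_map_def
  proof (intro conjI ballI allI)
    show "k \<circ> h \<in> carrier T \<rightarrow> carrier B"
      using hS kj by (fastforce simp: S_def)
  next
    fix x y assume x: "x \<in> carrier T" and y: "y \<in> carrier T"
    have kS: "k (h x) \<in> S" "k (h y) \<in> S" using hS[OF x] hS[OF y] kj by auto
    then have "k (h x) \<oplus>\<^bsub>B\<^esub> k (h y) \<in> S" "k (h x) \<otimes>\<^bsub>B\<^esub> k (h y) \<in> S" 
      using S by (auto simp: c_star_subalgebra_def)
    then show "(k \<circ> h) (x \<oplus>\<^bsub>T\<^esub> y) = (k \<circ> h) x \<oplus>\<^bsub>B\<^esub> (k \<circ> h) y"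
      "(k \<circ> h) (x \<otimes>\<^bsub>T\<^esub> y) = (k \<circ> h) x \<otimes>\<^bsub>B\<^esub> (k \<circ> h) y"
      using h(1) x y kj by (auto simp: star_hom_def linear_map_def sel)
  next
    fix x c assume x: "x \<in> carrier T"
    have "k (h x) \<in> S" using hS[OF x] kj by auto
    then have "c \<odot>\<^bsub>B\<^esub> k (h x) \<in> S"
      using S by (auto simp: c_star_subalgebra_def)
    then show "(k \<circ> h) (c \<odot>\<^bsub>T\<^esub> x) = c \<odot>\<^bsub>B\<^esub> (k \<circ> h) x"
      using h(1) x kj by (auto simp: star_hom_def linear_map_def sel)
  next
    fix x assume x: "x \<in> carrier T"
    have "k (h x) \<in> S" using hS[OF x] kj by auto
    then have "adj B (k (h x)) \<in> S"
      using S by (auto simp: c_star_subalgebra_def)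
    then show "(k \<circ> h) (adj T x) = adj B ((k \<circ> h) x)"
      using h(1) x kj by (auto simp: star_hom_def linear_map_def sel)
  qed
  then show ?thesis
    using h(2,3) in_S in_S' kj by (intro exI[of _ "k \<circ> h"]) auto
qed

end

(* The Toeplitz algebra of F acts on the Hilbert space spanned by the paths of F. The components
   of psi(x) applied to the vacuum vectors, along the edges of F, recover x. Applied to the
   images of the generators of E under the isomorphism, which have degree one for the gauge
   action, this yields a linear map from C(E1) to C(F1) that is isometric for the square norm of
   each fibre of the source maps and intertwines the left actions of the vertex algebras
   (identified by Gelfand duality). Where the image of a bump function at an edge e does not
   vanish, the germ of r s^-1 is the one at e, so Bessel's inequality bounds the number of edges
   of E with a given source and germ by that of F. By symmetry the numbers agree, and matching
   edges with equal germs gives an isomorphism over a neighbourhood of every vertex. Since the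
   vertex space is totally disconnected, finitely many of these over disjoint clopen sets glue. *)

theory Submission
  imports Defs
begin

section \<open>Square summable functions\<close>

text \<open>The image of a degree one generator need not be a generator: a product of two generators
  with the adjoint of a third also has degree one. So no isomorphism of correspondences is given
  directly, only the compression to the vacuum level. It keeps norms because a homogeneous element
  sends a vacuum vector to paths of a single length, so that no part of the norm hides in other
  components, and because the inner products of generators lie in the vertex algebra, which the
  isomorphism respects. The orthonormal basis of paths forgets the topology. Continuity is recovered
  by approximating the images of the vacuum vectors, uniformly in the vertex, by sections built from
  finitely many continuous functions. Comparing only the ranges at one vertex would be too weak,
  since edges may agree there and diverge nearby; equality of germs persists along local sections.
  The matching is still not canonical, as edges with equal germs may be permuted, so local
  isomorphisms have no reason to agree on overlaps. Total disconnectedness lets their domains be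
  made disjoint.\<close>

typedef 'p ell2 = "{f :: 'p \<Rightarrow> complex. (\<lambda>p. (cmod (f p))\<^sup>2) summable_on UNIV}"
  morphisms coord Abs_ell2
  by (intro exI[of _ "\<lambda>_. 0"]) simp

lemma ell2_eqI: "(\<And>p. coord x p = coord y p) \<Longrightarrow> x = y"
  by (metis coord_inject ext)

lemma coord_summable: "(\<lambda>p. (cmod (coord x p))\<^sup>2) summable_on UNIV"
  using coord[of x] by simp

lemma coord_mult_summable: "(\<lambda>p. cnj (coord x p) * coord y p) summable_on UNIV"
proof -
  have "(\<lambda>p. (cmod (coord x p))\<^sup>2 + (cmod (coord y p))\<^sup>2) summable_on UNIV"
    by (intro summable_on_add coord_summable)
  then have "(\<lambda>p. norm (cnj (coord x p) * coord y p)) summable_on UNIV"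
  proof (rule summable_on_comparison_test)
    fix p
    show "norm (cnj (coord x p) * coord y p) \<le> (cmod (coord x p))\<^sup>2 + (cmod (coord y p))\<^sup>2"
      using sum_squares_bound[of "cmod (coord x p)" "cmod (coord y p)"]
        mult_nonneg_nonneg[OF norm_ge_zero[of "coord x p"] norm_ge_zero[of "coord y p"]]
      unfolding norm_mult complex_mod_cnj by linarith
  qed simp
  then show ?thesis by (rule abs_summable_summable)
qed

lemma square_summableI:
  fixes f :: "'p \<Rightarrow> complex"
  assumes "\<And>F. finite F \<Longrightarrow> (\<Sum>p\<in>F. (cmod (f p))\<^sup>2) \<le> C"
  shows "(\<lambda>p. (cmod (f p))\<^sup>2) summable_on UNIV"
  by (rule nonneg_bdd_above_summable_on) (auto intro!: bdd_aboveI2[where M = C] assms)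

lemma coord_Abs_ell2:
  assumes "\<And>F. finite F \<Longrightarrow> (\<Sum>p\<in>F. (cmod (f p))\<^sup>2) \<le> C"
  shows "coord (Abs_ell2 f) = f"
  by (rule Abs_ell2_inverse) (use square_summableI[of f, OF assms] in simp)

instantiation ell2 :: (type) real_inner
begin

text \<open>The real part of the complex inner product. It induces the same norm and determines the
  complex product, whose imaginary part is a real product with one argument multiplied by a power of
  i.\<close>

definition inner_ell2 :: "'a ell2 \<Rightarrow> 'a ell2 \<Rightarrow> real" where
  "inner_ell2 x y = Re (infsum (\<lambda>p. cnj (coord x p) * coord y p) UNIV)"
definition norm_ell2 :: "'a ell2 \<Rightarrow> real" where "norm_ell2 x = sqrt (inner x x)"
definition zero_ell2 :: "'a ell2" where "zero_ell2 = Abs_ell2 (\<lambda>_. 0)"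
definition plus_ell2 :: "'a ell2 \<Rightarrow> 'a ell2 \<Rightarrow> 'a ell2" where
  "plus_ell2 x y = Abs_ell2 (\<lambda>p. coord x p + coord y p)"
definition minus_ell2 :: "'a ell2 \<Rightarrow> 'a ell2 \<Rightarrow> 'a ell2" where
  "minus_ell2 x y = Abs_ell2 (\<lambda>p. coord x p - coord y p)"
definition uminus_ell2 :: "'a ell2 \<Rightarrow> 'a ell2" where
  "uminus_ell2 x = Abs_ell2 (\<lambda>p. - coord x p)"
definition scaleR_ell2 :: "real \<Rightarrow> 'a ell2 \<Rightarrow> 'a ell2" where
  "scaleR_ell2 r x = Abs_ell2 (\<lambda>p. r *\<^sub>R coord x p)"
definition dist_ell2 :: "'a ell2 \<Rightarrow> 'a ell2 \<Rightarrow> real" where "dist_ell2 x y = norm (x - y)"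
definition sgn_ell2 :: "'a ell2 \<Rightarrow> 'a ell2" where "sgn_ell2 x = scaleR (inverse (norm x)) x"
definition uniformity_ell2 :: "('a ell2 \<times> 'a ell2) filter" where
  "uniformity_ell2 = (INF e\<in>{0<..}. principal {(x, y). dist x y < e})"
definition open_ell2 :: "'a ell2 set \<Rightarrow> bool" where
  "open_ell2 U \<longleftrightarrow> (\<forall>x\<in>U. \<forall>\<^sub>F (x', y) in uniformity. x' = x \<longrightarrow> y \<in> U)"

lemma coord_zero: "coord (0 :: 'a ell2) = (\<lambda>_. 0)"
  unfolding zero_ell2_def by (rule coord_Abs_ell2[of _ 0]) simp

text \<open>The single estimate |a + b|^2 \<le> 2|a|^2 + 2|b|^2 settles summability for sum,
  difference, negation and real multiples at once, by specialising \<open>r\<close> and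
  \<open>s\<close>.\<close>

lemma coord_lincomb:
  fixes x y :: "'a ell2"
  shows "coord (Abs_ell2 (\<lambda>p. r *\<^sub>R coord x p + s *\<^sub>R coord y p))
      = (\<lambda>p. r *\<^sub>R coord x p + s *\<^sub>R coord y p)"
proof (rule Abs_ell2_inverse)
  have "(\<lambda>p. (cmod (r *\<^sub>R coord x p + s *\<^sub>R coord y p))\<^sup>2) summable_on UNIV"
  proof (rule summable_on_comparison_test)
    show "(\<lambda>p. 2 * r\<^sup>2 * (cmod (coord x p))\<^sup>2 + 2 * s\<^sup>2 * (cmod (coord y p))\<^sup>2) summable_on UNIV"
      by (intro summable_on_add summable_on_cmult_right coord_summable)
    fix p
    have "(cmod (r *\<^sub>R coord x p + s *\<^sub>R coord y p))\<^sup>2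
        \<le> (\<bar>r\<bar> * cmod (coord x p) + \<bar>s\<bar> * cmod (coord y p))\<^sup>2"
      by (rule power_mono) (use norm_triangle_ineq[of "r *\<^sub>R coord x p"
          "s *\<^sub>R coord y p"] in simp_all)
    also have "\<dots> \<le> 2 * (\<bar>r\<bar> * cmod (coord x p))\<^sup>2 + 2 * (\<bar>s\<bar> * cmod (coord y p))\<^sup>2"
      using sum_squares_bound[of "\<bar>r\<bar> * cmod (coord x p)" "\<bar>s\<bar> * cmod (coord y p)"]
      by (simp add: power2_sum)
    finally show "(cmod (r *\<^sub>R coord x p + s *\<^sub>R coord y p))\<^sup>2
        \<le> 2 * r\<^sup>2 * (cmod (coord x p))\<^sup>2 + 2 * s\<^sup>2 * (cmod (coord y p))\<^sup>2"
      by (simp add: power_mult_distrib)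
  qed simp
  then show "(\<lambda>p. r *\<^sub>R coord x p + s *\<^sub>R coord y p) \<in> {f. (\<lambda>p. (cmod (f p))\<^sup>2) summable_on UNIV}"
    by simp
qed

lemma coord_add: "coord (x + y :: 'a ell2) = (\<lambda>p. coord x p + coord y p)"
  using coord_lincomb[of 1 x 1 y] by (simp add: plus_ell2_def)
lemma coord_diff: "coord (x - y :: 'a ell2) = (\<lambda>p. coord x p - coord y p)"
  using coord_lincomb[of 1 x "-1" y] by (simp add: minus_ell2_def)
lemma coord_uminus: "coord (- x :: 'a ell2) = (\<lambda>p. - coord x p)"
  using coord_lincomb[of "-1" x 0 x] by (simp add: uminus_ell2_def)
lemma coord_scaleR: "coord (r *\<^sub>R x :: 'a ell2) = (\<lambda>p. r *\<^sub>R coord x p)"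
  using coord_lincomb[of r x 0 x] by (simp add: scaleR_ell2_def)

lemmas coord_simps = coord_zero coord_add coord_diff coord_uminus coord_scaleR

lemma inner_self_ell2: "inner x x = infsum (\<lambda>p. (cmod (coord x p))\<^sup>2) UNIV" for x :: "'a ell2"
proof -
  have "(\<lambda>p. cnj (coord x p) * coord x p) = (\<lambda>p. complex_of_real ((cmod (coord x p))\<^sup>2))"
    by (rule ext) (metis complex_norm_square mult.commute)
  moreover have "infsum (\<lambda>p. complex_of_real ((cmod (coord x p))\<^sup>2)) UNIV
      = complex_of_real (infsum (\<lambda>p. (cmod (coord x p))\<^sup>2) UNIV)"
    by (rule infsumI[OF has_sum_of_real[OF has_sum_infsum[OF coord_summable]]])
  ultimately show ?thesis by (simp add: inner_ell2_def)
qed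

instance
proof
  fix x y z :: "'a ell2" and r s :: real
  show "x + y + z = x + (y + z)" "x + y = y + x" "0 + x = x" "- x + x = 0" "x - y = x + - y"
    "r *\<^sub>R (x + y) = r *\<^sub>R x + r *\<^sub>R y" "(r + s) *\<^sub>R x = r *\<^sub>R x + s *\<^sub>R x"
    "r *\<^sub>R s *\<^sub>R x = (r * s) *\<^sub>R x" "1 *\<^sub>R x = x"
    by (auto intro!: ell2_eqI simp: coord_simps algebra_simps scaleR_add_right scaleR_add_left)
  show "dist x y = norm (x - y)" by (rule dist_ell2_def)
  show "sgn x = inverse (norm x) *\<^sub>R x" by (rule sgn_ell2_def)
  show "uniformity = (INF e\<in>{0<..}. principal {(x, y :: 'a ell2). dist x y < e})"
    by (rule uniformity_ell2_def)
  show "open U \<longleftrightarrow> (\<forall>x\<in>U. \<forall>\<^sub>F (x', y) in uniformity. x' = x \<longrightarrow> y \<in> U)" for U :: "'a ell2 set"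
    by (rule open_ell2_def)
  have "infsum (\<lambda>p. cnj (cnj (coord x p) * coord y p)) UNIV
      = cnj (infsum (\<lambda>p. cnj (coord x p) * coord y p) UNIV)"
    by (rule infsum_cnj)
  then show "inner x y = inner y x"
    by (simp add: inner_ell2_def mult.commute)
  show "inner (x + y) z = inner x z + inner y z"
    by (simp add: inner_ell2_def coord_add distrib_right infsum_add coord_mult_summable)
  have "infsum (\<lambda>p. r *\<^sub>R (cnj (coord x p) * coord y p)) UNIV
      = r *\<^sub>R infsum (\<lambda>p. cnj (coord x p) * coord y p) UNIV"
    by (rule infsum_scaleR_right)
  then show "inner (r *\<^sub>R x) y = r * inner x y"
    by (simp add: inner_ell2_def coord_scaleR)
  show "0 \<le> inner x x"
    by (simp add: inner_self_ell2 infsum_nonneg)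
  show "inner x x = 0 \<longleftrightarrow> x = 0"
  proof
    assume *: "inner x x = 0"
    have "(cmod (coord x p))\<^sup>2 = 0" for p
      by (rule nonneg_infsum_le_0D[OF _ coord_summable[of x]]) (use * in \<open>simp_all add:
          inner_self_ell2\<close>)
    then show "x = 0" by (intro ell2_eqI) (simp add: coord_zero)
  qed (simp add: inner_self_ell2 coord_zero)
  show "norm x = sqrt (inner x x)" by (rule norm_ell2_def)
qed

end

lemma norm_ell2_sq: "(norm x)\<^sup>2 = infsum (\<lambda>p. (cmod (coord x p))\<^sup>2) UNIV" for x :: "'p ell2"
  by (simp add: power2_norm_eq_inner inner_self_ell2)

lemma sum_coord_le_norm: "finite F \<Longrightarrow> (\<Sum>p\<in>F. (cmod (coord x p))\<^sup>2) \<le> (norm x)\<^sup>2"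
  unfolding norm_ell2_sq by (rule finite_sum_le_infsum) (auto simp: coord_summable)

lemma norm_ell2_leI:
  assumes "\<And>F. finite F \<Longrightarrow> (\<Sum>p\<in>F. (cmod (coord x p))\<^sup>2) \<le> C\<^sup>2" "0 \<le> C"
  shows "norm x \<le> C"
proof (rule power2_le_imp_le)
  show "(norm x)\<^sup>2 \<le> C\<^sup>2"
    unfolding norm_ell2_sq by (rule infsum_le_finite_sums[OF coord_summable]) (auto intro: assms)
qed fact

lemma coord_le_norm: "cmod (coord x p) \<le> norm x"
  by (rule power2_le_imp_le) (use sum_coord_le_norm[of "{p}" x] in simp_all)

instance ell2 :: (type) complete_space
proof
  fix X :: "nat \<Rightarrow> 'a ell2"
  assume X: "Cauchy X"
  have cau: "Cauchy (\<lambda>n. coord (X n) p)" for p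
  proof (rule metric_CauchyI)
    fix e :: real assume "0 < e"
    then obtain M where "\<And>m n. m \<ge> M \<Longrightarrow> n \<ge> M \<Longrightarrow> dist (X m) (X n) < e"
      using X metric_CauchyD by blast
    moreover have "dist (coord (X m) p) (coord (X n) p) \<le> dist (X m) (X n)" for m n
      using coord_le_norm[of "X m - X n" p] by (simp add: dist_norm coord_simps)
    ultimately show "\<exists>M. \<forall>m\<ge>M. \<forall>n\<ge>M. dist (coord (X m) p) (coord (X n) p) < e"
      by (meson le_less_trans)
  qed
  define f where "f p = lim (\<lambda>n. coord (X n) p)" for p
  have f: "(\<lambda>n. coord (X n) p) \<longlonglongrightarrow> f p" for p
    unfolding f_def using Cauchy_convergent[OF cau] by (simp add: convergent_LIMSEQ_iff)
  have tail: "(\<Sum>p\<in>F. (cmod (f p - coord (X n) p))\<^sup>2) \<le> e\<^sup>2"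
    if M: "\<And>m n. m \<ge> M \<Longrightarrow> n \<ge> M \<Longrightarrow> dist (X m) (X n) < e" and "n \<ge> M" and F: "finite F" for e M n F
  proof (rule LIMSEQ_le_const2)
    show "(\<lambda>m. \<Sum>p\<in>F. (cmod (coord (X m) p - coord (X n) p))\<^sup>2) \<longlonglongrightarrow> (\<Sum>p\<in>F. (cmod (f p - coord (X n)
        p))\<^sup>2)"
      by (intro tendsto_intros f)
    have "(\<Sum>p\<in>F. (cmod (coord (X m) p - coord (X n) p))\<^sup>2) \<le> e\<^sup>2" if "m \<ge> M" for m
    proof -
      have "(\<Sum>p\<in>F. (cmod (coord (X m - X n) p))\<^sup>2) \<le> (norm (X m - X n))\<^sup>2"
        by (rule sum_coord_le_norm[OF F])
      also have "\<dots> \<le> e\<^sup>2"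
        using M[OF that \<open>n \<ge> M\<close>] by (intro power_mono) (simp_all add: dist_norm)
      finally show ?thesis by (simp add: coord_simps)
    qed
    then show "\<exists>N. \<forall>m\<ge>N. (\<Sum>p\<in>F. (cmod (coord (X m) p - coord (X n) p))\<^sup>2) \<le> e\<^sup>2" by blast
  qed
  obtain M1 where M1: "\<And>m n. m \<ge> M1 \<Longrightarrow> n \<ge> M1 \<Longrightarrow> dist (X m) (X n) < 1"
    using metric_CauchyD[OF X, of 1] by auto
  \<comment> \<open>The pointwise limit \<open>f\<close> is not yet known to be square summable. Its
    difference to \<open>X M1\<close> is, by \<open>tail\<close> with bound 1, so the limit is
    written as \<open>X M1 + g\<close>.\<close>
  define g where "g = Abs_ell2 (\<lambda>p. f p - coord (X M1) p)"
  have g: "coord g = (\<lambda>p. f p - coord (X M1) p)"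
    unfolding g_def by (rule coord_Abs_ell2[of _ "1\<^sup>2"]) (rule tail[OF M1], auto)
  have "X \<longlonglongrightarrow> X M1 + g"
  proof (rule metric_LIMSEQ_I)
    fix e :: real assume "0 < e"
    then obtain M where M: "\<And>m n. m \<ge> M \<Longrightarrow> n \<ge> M \<Longrightarrow> dist (X m) (X n) < e / 2"
      using metric_CauchyD[OF X, of "e/2"] by auto
    have "dist (X n) (X M1 + g) < e" if "n \<ge> M" for n
    proof -
      have "norm (X M1 + g - X n) \<le> e / 2"
        by (rule norm_ell2_leI)
          (use tail[OF M that] \<open>0 < e\<close> in \<open>simp_all add: coord_simps g\<close>)
      then show ?thesis using \<open>0 < e\<close> by (simp add: dist_norm norm_minus_commute)
    qed
    then show "\<exists>no. \<forall>n\<ge>no. dist (X n) (X M1 + g) < e" by blast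
  qed
  then show "convergent X" by (auto simp: convergent_def)
qed

instance ell2 :: (type) banach ..

definition basis_vec :: "'p \<Rightarrow> 'p ell2" where
  "basis_vec q = Abs_ell2 (\<lambda>p. if p = q then 1 else 0)"

lemma coord_basis_vec: "coord (basis_vec q) = (\<lambda>p. if p = q then 1 else 0)"
  unfolding basis_vec_def
proof (rule coord_Abs_ell2[of _ 1])
  fix F :: "'a set" assume "finite F"
  have "(\<Sum>p\<in>F. (cmod (if p = q then 1 else 0))\<^sup>2) = (\<Sum>p\<in>F. if p = q then 1 else 0)"
    by (rule sum.cong) auto
  then show "(\<Sum>p\<in>F. (cmod (if p = q then 1 else 0))\<^sup>2) \<le> 1"
    using \<open>finite F\<close> by simp
qed

lemma inner_basis_vec: "inner (basis_vec q) x = Re (coord x q)"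
proof -
  have "infsum (\<lambda>p. cnj (coord (basis_vec q) p) * coord x p) UNIV = infsum (\<lambda>p. coord x p) {q}"
    by (rule infsum_cong_neutral) (auto simp: coord_basis_vec)
  then show ?thesis by (simp add: inner_ell2_def)
qed

lemma norm_basis_vec: "norm (basis_vec q) = 1"
  using inner_basis_vec[of q "basis_vec q"] by (simp add: norm_eq_sqrt_inner coord_basis_vec)

section \<open>Diagonal operators\<close>

type_synonym 'p oper = "'p ell2 \<Rightarrow>\<^sub>L 'p ell2"

definition bounded_fun :: "('p \<Rightarrow> complex) \<Rightarrow> bool" where
  "bounded_fun a \<longleftrightarrow> (\<exists>C. \<forall>p. cmod (a p) \<le> C)"

text \<open>Meaningful only if \<open>g\<close> is linear and bounded in the square norm.\<close>

definition ell2_op :: "(('p \<Rightarrow> complex) \<Rightarrow> ('p \<Rightarrow> complex)) \<Rightarrow> 'p oper" where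
  "ell2_op g = Blinfun (\<lambda>x. Abs_ell2 (g (coord x)))"

text \<open>The bound \<open>bd\<close> on finite partial sums does two things: it makes
  \<open>g (coord x)\<close> square summable, so that \<open>Abs_ell2\<close> is meaningful, and it
  bounds the resulting operator by \<open>C\<close>.\<close>

lemma coord_ell2_op:
  assumes add: "\<And>\<xi> \<eta> p. g (\<lambda>q. \<xi> q + \<eta> q) p = g \<xi> p + g \<eta> p"
    and scale: "\<And>r \<xi> p. g (\<lambda>q. r *\<^sub>R \<xi> q) p = r *\<^sub>R g \<xi> p"
    and bd: "\<And>x F. finite F \<Longrightarrow> (\<Sum>p\<in>F. (cmod (g (coord x) p))\<^sup>2) \<le> C\<^sup>2 * (norm x)\<^sup>2"
    and C: "0 \<le> C"
  shows "coord (blinfun_apply (ell2_op g) x) = g (coord x)"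
proof -
  have c: "coord (Abs_ell2 (g (coord x))) = g (coord x)" for x
    by (rule coord_Abs_ell2) (rule bd)
  have "bounded_linear (\<lambda>x. Abs_ell2 (g (coord x)))"
  proof (rule bounded_linear_intro; (rule ell2_eqI)?)
    fix x y r p
    show "coord (Abs_ell2 (g (coord (x + y)))) p
        = coord (Abs_ell2 (g (coord x)) + Abs_ell2 (g (coord y))) p"
      using add[of "coord x" "coord y" p] unfolding c coord_add[of "Abs_ell2 _"]
      by (simp only: coord_add)
    show "coord (Abs_ell2 (g (coord (r *\<^sub>R x)))) p = coord (r *\<^sub>R Abs_ell2 (g (coord x))) p"
      using scale[of r "coord x" p] unfolding c coord_scaleR[of _ "Abs_ell2 _"]
      by (simp only: coord_scaleR)
    show "norm (Abs_ell2 (g (coord x))) \<le> norm x * C"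
    proof (rule norm_ell2_leI)
      fix F :: "'a set" assume "finite F"
      from bd[OF this, of x]
      show "(\<Sum>p\<in>F. (cmod (coord (Abs_ell2 (g (coord x))) p))\<^sup>2) \<le> (norm x * C)\<^sup>2"
        unfolding c by (simp only: power_mult_distrib mult.commute)
    qed (use C in simp)
  qed
  then show ?thesis by (simp add: ell2_op_def bounded_linear_Blinfun_apply c)
qed

definition diag :: "('p \<Rightarrow> complex) \<Rightarrow> 'p oper" where
  "diag a = ell2_op (\<lambda>\<xi> p. a p * \<xi> p)"

lemma coord_diag:
  assumes "bounded_fun a"
  shows "coord (blinfun_apply (diag a) x) = (\<lambda>p. a p * coord x p)"
proof -
  obtain C where le: "\<And>p. cmod (a p) \<le> C" using assms by (auto simp: bounded_fun_def)
  have C: "0 \<le> C" using le norm_ge_zero order_trans by blast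
  have bd: "(\<Sum>p\<in>F. (cmod (a p * coord x p))\<^sup>2) \<le> C\<^sup>2 * (norm x)\<^sup>2" if "finite F" for x F
  proof -
    have "(\<Sum>p\<in>F. (cmod (a p * coord x p))\<^sup>2) \<le> (\<Sum>p\<in>F. C\<^sup>2 * (cmod (coord x p))\<^sup>2)"
      by (intro sum_mono) (simp add: norm_mult power_mult_distrib mult_right_mono power_mono le)
    also have "\<dots> \<le> C\<^sup>2 * (norm x)\<^sup>2"
      by (simp add: sum_distrib_left[symmetric] mult_left_mono sum_coord_le_norm[OF that])
    finally show ?thesis .
  qed
  show ?thesis
    unfolding diag_def
    by (intro coord_ell2_op[where g = "\<lambda>\<xi> p. a p * \<xi> p" and C = C] bd C) (auto simp: algebra_simps)
qed

lemma bounded_fun_const [simp]: "bounded_fun (\<lambda>_. c)"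
  by (auto simp: bounded_fun_def)

lemma bounded_fun_add: "bounded_fun a \<Longrightarrow> bounded_fun b \<Longrightarrow> bounded_fun (\<lambda>p. a p + b p)"
  unfolding bounded_fun_def by (meson add_mono norm_triangle_le)

lemma bounded_fun_mult: "bounded_fun a \<Longrightarrow> bounded_fun b \<Longrightarrow> bounded_fun (\<lambda>p. a p * b p)"
  unfolding bounded_fun_def norm_mult by (meson mult_mono norm_ge_zero order_trans)

lemma bounded_fun_cnj: "bounded_fun a \<Longrightarrow> bounded_fun (\<lambda>p. cnj (a p))"
  unfolding bounded_fun_def by simp

lemma diag_mult: "bounded_fun a \<Longrightarrow> bounded_fun b \<Longrightarrow> diag (\<lambda>p. a p * b p) = diag a o\<^sub>L diag b"
  by (intro blinfun_eqI ell2_eqI) (simp add: coord_diag bounded_fun_mult)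

lemma diag_add: "bounded_fun a \<Longrightarrow> bounded_fun b \<Longrightarrow> diag (\<lambda>p. a p + b p) = diag a + diag b"
  by (intro blinfun_eqI ell2_eqI)
    (simp add: coord_diag bounded_fun_add blinfun.add_left coord_simps algebra_simps)

lemma inner_diag: "bounded_fun a \<Longrightarrow> inner (diag a x) y = inner x (diag (\<lambda>p. cnj (a p)) y)"
  by (simp add: inner_ell2_def coord_diag bounded_fun_cnj mult_ac)

text \<open>The vector space structure of the type is real; complex scalars act as constant diagonal
  operators.\<close>

abbreviation scal :: "complex \<Rightarrow> 'p oper" where
  "scal c \<equiv> diag (\<lambda>_. c)"

lemma coord_scal: "coord (blinfun_apply (scal c) x) = (\<lambda>p. c * coord x p)"
  by (simp add: coord_diag)

lemma norm_scal: "norm (blinfun_apply (scal c) x) = cmod c * norm x"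
proof -
  have "(norm (scal c x))\<^sup>2 = (cmod c * norm x)\<^sup>2"
    by (simp add: norm_ell2_sq coord_scal norm_mult power_mult_distrib infsum_cmult_right')
  then show ?thesis by simp
qed

lemma scal_one: "scal 1 = id_blinfun"
  by (intro blinfun_eqI ell2_eqI) (simp add: coord_scal)

lemma scal_of_real: "scal (of_real r) x = r *\<^sub>R x"
  by (intro ell2_eqI) (simp add: coord_scal coord_simps scaleR_conv_of_real)

lemma scal_add: "scal (c + d) = scal c + scal d"
  using diag_add[of "\<lambda>_. c" "\<lambda>_. d"] by simp

lemma scal_mult: "scal (c * d) = scal c o\<^sub>L scal d"
  using diag_mult[of "\<lambda>_. c" "\<lambda>_. d"] by simp

section \<open>The C*-algebra of adjointable operators\<close>

definition complex_linear_op :: "'p oper \<Rightarrow> bool" where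
  "complex_linear_op a \<longleftrightarrow> (\<forall>c x. a (scal c x) = scal c (a x))"

text \<open>Stated for the real inner product. For complex linear operators this is the usual
  adjoint, since the imaginary part of the complex product of x and y is the real product of ix and
  y.\<close>

definition is_adjoint :: "'p oper \<Rightarrow> 'p oper \<Rightarrow> bool" where
  "is_adjoint a b \<longleftrightarrow> (\<forall>x y. inner (a x) y = inner x (b y))"

definition adjoint_op :: "'p oper \<Rightarrow> 'p oper" where
  "adjoint_op a = (THE b. is_adjoint a b)"

lemma is_adjoint_unique: "is_adjoint a b \<Longrightarrow> is_adjoint a c \<Longrightarrow> b = c"
  unfolding is_adjoint_def by (intro blinfun_eqI) (metis vector_eq_rdot inner_commute)

lemma adjoint_opI: "is_adjoint a b \<Longrightarrow> adjoint_op a = b"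
  unfolding adjoint_op_def using is_adjoint_unique by blast

lemma is_adjoint_sym: "is_adjoint a b \<Longrightarrow> is_adjoint b a"
  unfolding is_adjoint_def by (metis inner_commute)

lemma is_adjoint_comp: "is_adjoint a b \<Longrightarrow> is_adjoint c d \<Longrightarrow> is_adjoint (a o\<^sub>L c) (d o\<^sub>L b)"
  unfolding is_adjoint_def by simp

lemma is_adjoint_add: "is_adjoint a b \<Longrightarrow> is_adjoint c d \<Longrightarrow> is_adjoint (a + c) (b + d)"
  unfolding is_adjoint_def by (simp add: blinfun.add_left inner_add_left inner_add_right)

lemma is_adjoint_diff: "is_adjoint a b \<Longrightarrow> is_adjoint c d \<Longrightarrow> is_adjoint (a - c) (b - d)"
  unfolding is_adjoint_def by (simp add: blinfun.diff_left inner_diff_left inner_diff_right)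

lemma is_adjoint_diag: "bounded_fun a \<Longrightarrow> is_adjoint (diag a) (diag (\<lambda>p. cnj (a p)))"
  unfolding is_adjoint_def by (simp add: inner_diag)

lemma complex_linear_adjoint:
  assumes "complex_linear_op a" "is_adjoint a b"
  shows "complex_linear_op b"
  unfolding complex_linear_op_def
proof (intro allI)
  fix c x
  have "inner y (b (scal c x)) = inner y (scal c (b x))" for y
  proof -
    have "inner y (b (scal c x)) = inner (scal (cnj c) (a y)) x"
      using assms(2) by (simp add: is_adjoint_def inner_diag)
    also have "\<dots> = inner (a (scal (cnj c) y)) x" using assms(1) by (simp add: complex_linear_op_def)
    also have "\<dots> = inner y (scal c (b x))" using assms(2) by (simp add: is_adjoint_def inner_diag)
    finally show ?thesis .
  qed
  then show "b (scal c x) = scal c (b x)" using vector_eq_ldot by blast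
qed

lemma norm_adjoint_le:
  assumes "is_adjoint a b" shows "norm b \<le> norm a"
proof (rule norm_blinfun_bound)
  fix x
  have "norm (b x) * norm (b x) = inner (a (b x)) x"
    using assms by (simp add: is_adjoint_def power2_norm_eq_inner flip: power2_eq_square)
  also have "\<dots> \<le> norm (a (b x)) * norm x" by (rule norm_cauchy_schwarz)
  also have "\<dots> \<le> (norm a * norm (b x)) * norm x" by (intro mult_right_mono norm_blinfun) simp
  finally have "norm (b x) * norm (b x) \<le> norm (b x) * (norm a * norm x)" by (simp add: mult_ac)
  then show "norm (b x) \<le> norm a * norm x"
    by (cases "b x = 0") (auto simp: mult_le_cancel_left)
qed simp

lemma norm_adjoint: "is_adjoint a b \<Longrightarrow> norm b = norm a"
  by (meson antisym is_adjoint_sym norm_adjoint_le)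

text \<open>Existence of the adjoint is part of membership, so it has to be carried through every
  operation, and through norm limits in \<open>closed_adjointable\<close>.\<close>

definition adjointable :: "'p oper \<Rightarrow> bool" where
  "adjointable a \<longleftrightarrow> complex_linear_op a \<and> (\<exists>b. is_adjoint a b)"

lemma adjointableD:
  assumes "adjointable a"
  shows "a (scal c x) = scal c (a x)" "is_adjoint a (adjoint_op a)" "adjointable (adjoint_op a)"
    "adjoint_op (adjoint_op a) = a" "norm (adjoint_op a) = norm a"
proof -
  obtain b where b: "complex_linear_op a"
      "is_adjoint a b" using assms by (auto simp: adjointable_def)
  then have ab: "adjoint_op a = b" using adjoint_opI by blast
  show "a (scal c x) = scal c (a x)" using b by (simp add: complex_linear_op_def)
  show "is_adjoint a (adjoint_op a)" "norm (adjoint_op a) = norm a" using b ab norm_adjoint by auto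
  show "adjointable (adjoint_op a)" "adjoint_op (adjoint_op a) = a"
    using b ab is_adjoint_sym complex_linear_adjoint adjoint_opI unfolding adjointable_def by blast+
qed

lemma adjointable_diag: "bounded_fun a \<Longrightarrow> adjointable (diag a)"
  unfolding adjointable_def complex_linear_op_def using is_adjoint_diag
  by (auto intro!: ell2_eqI simp: coord_diag)

lemma adjointable_comp: "adjointable a \<Longrightarrow> adjointable b \<Longrightarrow> adjointable (a o\<^sub>L b)"
  unfolding adjointable_def complex_linear_op_def using is_adjoint_comp by fastforce

lemma adjointable_add: "adjointable a \<Longrightarrow> adjointable b \<Longrightarrow> adjointable (a + b)"
  unfolding adjointable_def complex_linear_op_def
  using is_adjoint_add by (fastforce simp: blinfun.add_left blinfun.add_right)

lemma adjointable_zero: "adjointable 0"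
  unfolding adjointable_def complex_linear_op_def is_adjoint_def by (auto intro!: exI[of _ 0])

lemma adjoint_op_comp: "adjointable a \<Longrightarrow> adjointable b \<Longrightarrow>
    adjoint_op (a o\<^sub>L b) = adjoint_op b o\<^sub>L adjoint_op a"
  by (intro adjoint_opI is_adjoint_comp adjointableD)

lemma adjoint_op_add: "adjointable a \<Longrightarrow> adjointable b \<Longrightarrow>
    adjoint_op (a + b) = adjoint_op a + adjoint_op b"
  by (intro adjoint_opI is_adjoint_add adjointableD)

lemma adjoint_op_diag: "bounded_fun a \<Longrightarrow> adjoint_op (diag a) = diag (\<lambda>p. cnj (a p))"
  by (intro adjoint_opI is_adjoint_diag)

lemma scal_comm: "adjointable a \<Longrightarrow> a o\<^sub>L scal c = scal c o\<^sub>L a"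
  by (intro blinfun_eqI) (simp add: adjointableD)

lemma comp_assoc_op: "(a o\<^sub>L b) o\<^sub>L c = a o\<^sub>L (b o\<^sub>L c)"
  by (intro blinfun_eqI) simp

lemma norm_adjoint_comp: "adjointable a \<Longrightarrow> norm (adjoint_op a o\<^sub>L a) = (norm a)\<^sup>2"
proof (rule antisym)
  assume a: "adjointable a"
  show "norm (adjoint_op a o\<^sub>L a) \<le> (norm a)\<^sup>2"
    using norm_blinfun_compose[of "adjoint_op a" a] a by (simp add: adjointableD power2_eq_square)
  have "norm a \<le> sqrt (norm (adjoint_op a o\<^sub>L a))"
  proof (rule norm_blinfun_bound)
    fix x
    have "(norm (a x))\<^sup>2 = inner x ((adjoint_op a o\<^sub>L a) x)"
      using adjointableD(2)[OF a] by (simp add: power2_norm_eq_inner is_adjoint_def)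
    also have "\<dots> \<le> norm x * (norm (adjoint_op a o\<^sub>L a) * norm x)"
      by (rule order_trans[OF norm_cauchy_schwarz mult_left_mono[OF norm_blinfun]]) simp
    also have "\<dots> = (sqrt (norm (adjoint_op a o\<^sub>L a)) * norm x)\<^sup>2"
      by (simp add: power_mult_distrib power2_eq_square)
    finally show "norm (a x) \<le> sqrt (norm (adjoint_op a o\<^sub>L a)) * norm x"
      by (rule power2_le_imp_le) simp
  qed simp
  then show "(norm a)\<^sup>2 \<le> norm (adjoint_op a o\<^sub>L a)"
    using power_mono[of "norm a" _ 2] by fastforce
qed

text \<open>For nonzero \<open>c\<close> the lower bound is the upper bound applied to the inverse
  scalar.\<close>

lemma norm_scal_comp:
  fixes a :: "'p oper"
  shows "norm (scal c o\<^sub>L a) = cmod c * norm a"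
proof -
  have le: "norm (scal c o\<^sub>L a) \<le> cmod c * norm a" for c and a :: "'p oper"
    by (rule norm_blinfun_bound) (auto simp: norm_scal mult.assoc intro: mult_left_mono
        norm_blinfun)
  show ?thesis
  proof (cases "c = 0")
    case True
    then show ?thesis using le[of 0 a] by simp
  next
    case False
    have "scal (inverse c) o\<^sub>L (scal c o\<^sub>L a) = a"
      using False by (intro blinfun_eqI ell2_eqI) (simp add: coord_scal)
    then have "norm a \<le> cmod (inverse c) * norm (scal c o\<^sub>L a)"
      using le[of "inverse c" "scal c o\<^sub>L a"] by simp
    then have "cmod c * norm a \<le> cmod c * (cmod (inverse c) * norm (scal c o\<^sub>L a))"
      by (rule mult_left_mono) simp
    also have "\<dots> = norm (scal c o\<^sub>L a)" using False by (simp add: norm_inverse)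
    finally show ?thesis using le[of c a] by simp
  qed
qed

definition op_algebra :: "'p oper star_algebra" where
  "op_algebra =
     \<lparr>carrier = Collect adjointable, mult = (o\<^sub>L), one = id_blinfun, zero = 0, add = (+),
      smult = (\<lambda>c a. scal c o\<^sub>L a), adj = adjoint_op, cnorm = norm\<rparr>"

lemma op_algebra_simps [simp]:
  "carrier op_algebra = Collect adjointable" "x \<otimes>\<^bsub>op_algebra\<^esub> y = x o\<^sub>L y"
  "\<zero>\<^bsub>op_algebra\<^esub> = 0" "x \<oplus>\<^bsub>op_algebra\<^esub> y = x + y" "c \<odot>\<^bsub>op_algebra\<^esub> x = scal c o\<^sub>L x"
  "adj op_algebra x = adjoint_op x" "cnorm op_algebra x = norm x"
  by (simp_all add: op_algebra_def)

lemmas comp_add_left = bounded_bilinear.add_left[OF bounded_bilinear_blinfun_compose]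
lemmas comp_add_right = bounded_bilinear.add_right[OF bounded_bilinear_blinfun_compose]

lemma adjointable_uminus: "adjointable a \<Longrightarrow> adjointable (- a)"
proof -
  assume "adjointable a"
  then have "adjointable (scal (-1) o\<^sub>L a)" by (simp add: adjointable_comp adjointable_diag)
  moreover have "scal (-1) o\<^sub>L a = - a"
    by (intro blinfun_eqI ell2_eqI) (simp add: coord_scal coord_simps blinfun.minus_left)
  ultimately show ?thesis by simp
qed

lemma adjointable_diff: "adjointable a \<Longrightarrow> adjointable b \<Longrightarrow> adjointable (a - b)"
  using adjointable_add[OF _ adjointable_uminus, of a b] by simp

lemma adjoint_op_diff: "adjointable a \<Longrightarrow> adjointable b \<Longrightarrow>
    adjoint_op (a - b) = adjoint_op a - adjoint_op b"
  by (intro adjoint_opI is_adjoint_diff adjointableD)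

text \<open>Taking adjoints is isometric, so the adjoints of a convergent sequence are Cauchy, and
  their limit is an adjoint of the limit.\<close>

lemma closed_adjointable:
  assumes A: "\<And>n. adjointable (A n)" and lim: "A \<longlonglongrightarrow> a"
  shows "adjointable a"
proof -
  have "Cauchy A" using lim LIMSEQ_imp_Cauchy by blast
  moreover have "dist (adjoint_op (A m)) (adjoint_op (A n)) = dist (A m) (A n)" for m n
    using A by (simp add: dist_norm adjointableD(5) adjointable_diff flip: adjoint_op_diff)
  ultimately have "Cauchy (\<lambda>n. adjoint_op (A n))" by (simp add: Cauchy_def)
  then obtain b where b: "(\<lambda>n. adjoint_op (A n)) \<longlonglongrightarrow> b"
    using convergentD[OF Cauchy_convergent] by metis
  have ev: "(\<lambda>n. A n x) \<longlonglongrightarrow> a x" "(\<lambda>n. adjoint_op (A n) x) \<longlonglongrightarrow> b x" for x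
    using lim b by (auto intro!: tendsto_intros)
  have "a (scal c x) = scal c (a x)" for c x
  proof (rule LIMSEQ_unique[OF ev(1)])
    show "(\<lambda>n. A n (scal c x)) \<longlonglongrightarrow> scal c (a x)"
      using A by (simp add: adjointableD) (intro tendsto_intros ev)
  qed
  moreover have "inner (a x) y = inner x (b y)" for x y
  proof (rule LIMSEQ_unique)
    show "(\<lambda>n. inner (A n x) y) \<longlonglongrightarrow> inner (a x) y" by (intro tendsto_intros ev)
    have "inner (A n x) y = inner x (adjoint_op (A n) y)" for n
      using adjointableD(2)[OF A] by (simp add: is_adjoint_def)
    then show "(\<lambda>n. inner (A n x) y) \<longlonglongrightarrow> inner x (b y)" by (auto intro!: tendsto_intros ev)
  qed
  ultimately show ?thesis
    unfolding adjointable_def complex_linear_op_def is_adjoint_def by blast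
qed

lemma c_star_algebra_op_algebra: "c_star_algebra (op_algebra :: 'p oper star_algebra)"
proof -
  let ?A = "op_algebra :: 'p oper star_algebra"
  have ab: "abelian_group ?A"
  proof (rule abelian_groupI)
    fix x assume "x \<in> carrier ?A"
    then show "\<exists>y\<in>carrier ?A. y \<oplus>\<^bsub>?A\<^esub> x = \<zero>\<^bsub>?A\<^esub>"
      by (intro bexI[of _ "- x"]) (auto simp: adjointable_uminus)
  qed (auto simp: adjointable_add adjointable_zero)
  interpret A: abelian_group ?A by (rule ab)
  have minus: "x \<ominus>\<^bsub>?A\<^esub> y = x - y" if "adjointable x" "adjointable y" for x y
  proof -
    have "\<ominus>\<^bsub>?A\<^esub> y = - y"
      by (rule A.minus_equality) (use that in \<open>auto simp: adjointable_uminus\<close>)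
    then show ?thesis by (simp add: a_minus_def)
  qed
  have dist: "cdist ?A x y = dist x y" if "adjointable x" "adjointable y" for x y
    using that by (simp add: cdist_def minus dist_norm)
  have met: "Metric_space (carrier ?A) (cdist ?A)"
  proof
    fix x y z :: "'p oper"
    show "0 \<le> cdist ?A x y" "cdist ?A x y = cdist ?A y x"
      by (auto simp: cdist_def minus norm_minus_commute)
    assume "x \<in> carrier ?A" "y \<in> carrier ?A"
    then show "cdist ?A x y = 0 \<longleftrightarrow> x = y" by (simp add: dist)
    assume "z \<in> carrier ?A"
    then show "cdist ?A x z \<le> cdist ?A x y + cdist ?A y z"
      using \<open>x \<in> carrier ?A\<close> \<open>y \<in> carrier ?A\<close> by (simp add: dist dist_triangle)
  qed
  interpret M: Metric_space "carrier ?A" "cdist ?A" by (rule met)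
  have compl: "M.mcomplete"
    unfolding M.mcomplete_def
  proof (intro allI impI)
    fix \<sigma> assume \<sigma>: "M.MCauchy \<sigma>"
    then have car: "\<And>n. adjointable (\<sigma> n)" unfolding M.MCauchy_def by auto
    have "Cauchy \<sigma>"
      using \<sigma> unfolding M.MCauchy_def Cauchy_def by (simp add: dist car)
    then obtain a where a: "\<sigma> \<longlonglongrightarrow> a" using convergentD[OF Cauchy_convergent] by metis
    have "adjointable a" by (rule closed_adjointable[OF car a])
    then have "limitin M.mtopology \<sigma> a sequentially"
      using a unfolding M.limit_metric_sequentially lim_sequentially by (simp add: dist car)
    then show "\<exists>x. limitin M.mtopology \<sigma> x sequentially" ..
  qed
  show ?thesis
  proof (intro c_star_algebra.intro c_star_algebra_axioms.intro)
    show "Module.module complex_ring ?A"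
    proof (intro moduleI cring_complex_ring ab)
      show "\<one>\<^bsub>complex_ring\<^esub> \<odot>\<^bsub>?A\<^esub> x = x" for x
        by (intro blinfun_eqI) (simp add: complex_ring_def scal_one)
    qed (simp_all add: complex_ring_def scal_add scal_mult comp_assoc_op comp_add_left
        comp_add_right
        adjointable_comp adjointable_diag)
    show "M.mcomplete" by (rule compl)
    fix x y :: "'p oper" and c assume x: "x \<in> carrier ?A"
    show "adj ?A (c \<odot>\<^bsub>?A\<^esub> x) = cnj c \<odot>\<^bsub>?A\<^esub> adj ?A x"
      using x scal_comm[of "adjoint_op x" "cnj c"]
      by (simp add: adjoint_op_comp adjointable_diag adjoint_op_diag adjointableD)
    show "x \<otimes>\<^bsub>?A\<^esub> (c \<odot>\<^bsub>?A\<^esub> y) = c \<odot>\<^bsub>?A\<^esub> (x \<otimes>\<^bsub>?A\<^esub> y)"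
      using x scal_comm[of x c] by (simp flip: comp_assoc_op)
  qed (simp_all add: adjointableD norm_scal_comp norm_adjoint_comp adjointable_comp comp_assoc_op
      adjoint_op_add adjoint_op_comp norm_triangle_ineq norm_blinfun_compose comp_add_left
          comp_add_right)
qed

section \<open>Homomorphisms into operator algebras are contractive\<close>

context c_star_algebra
begin

lemma smult_add_right:
  "x \<in> carrier A \<Longrightarrow> y \<in> carrier A \<Longrightarrow> c \<odot> (x \<oplus> y) = c \<odot> x \<oplus> c \<odot> y"
  using smult_r_distr[of c x y] by (simp add: complex_ring_def)

lemma smult_smult: "x \<in> carrier A \<Longrightarrow> c \<odot> (d \<odot> x) = (c * d) \<odot> x"
  using smult_assoc1[of c d x] by (simp add: complex_ring_def)

lemma minus_closed_A: "x \<in> carrier A \<Longrightarrow> y \<in> carrier A \<Longrightarrow> x \<ominus> y \<in> carrier A"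
  by (simp add: minus_eq)

lemma smult_uminus: "x \<in> carrier A \<Longrightarrow> c \<odot> (\<ominus> x) = \<ominus> (c \<odot> x)"
  by (simp add: smult_carrier smult_smult flip: smult_minus_one)

lemma mult_uminus_right: "x \<in> carrier A \<Longrightarrow> y \<in> carrier A \<Longrightarrow> x \<otimes> (\<ominus> y) = \<ominus> (x \<otimes> y)"
  by (simp add: mult_closed mult_smult_right flip: smult_minus_one)

lemma mult_uminus_left: "x \<in> carrier A \<Longrightarrow> y \<in> carrier A \<Longrightarrow> (\<ominus> x) \<otimes> y = \<ominus> (x \<otimes> y)"
  by (simp add: mult_closed mult_smult_left flip: smult_minus_one)

lemma cnorm_adj: assumes "x \<in> carrier A" shows "cnorm A (adj A x) = cnorm A x"
proof -
  have le: "cnorm A x \<le> cnorm A (adj A x)" if x: "x \<in> carrier A" for x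
  proof (cases "cnorm A x = 0")
    case True
    then show ?thesis using cnorm_nonneg adj_closed x by simp
  next
    case False
    have "cnorm A x * cnorm A x \<le> cnorm A (adj A x) * cnorm A x"
      using c_star_identity[OF x] cnorm_mult_le[OF adj_closed[OF x] x]
      by (simp add: power2_eq_square)
    then show ?thesis using False cnorm_nonneg[OF x] by simp
  qed
  from le[OF assms] le[OF adj_closed[OF assms]] show ?thesis
    using adj_adj[OF assms] by simp
qed

text \<open>The fixed point is \<open>1 - \<surd>(1 - y)\<close>, which exists without passing to a unitization.\<close>

lemma exists_sqrt_defect:
  assumes y: "y \<in> carrier A" "adj A y = y" and q: "cnorm A y < 1"
  shows "\<exists>v \<in> carrier A. adj A v = v \<and> v = (1/2) \<odot> (y \<oplus> v \<otimes> v)"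
proof -
  interpret Metric_space "carrier A" "cdist A" by (rule Metric_space_cdist)
  define q where "q = cnorm A y"
  have q0: "0 \<le> q" "q < 1" using assms cnorm_nonneg by (auto simp: q_def)
  define f where "f v = (1/2) \<odot> (y \<oplus> v \<otimes> v)" for v
  \<comment> \<open>On the ball of radius \<open>q\<close> the map \<open>f\<close> has norm at most
    (q + q * q)/2 \<le> q, because \<open>q\<close> is below 1, and Lipschitz constant (q + q)/2 =
    q. So \<open>f\<close> is a contraction of this ball into itself.\<close>
  define B where "B = {v \<in> carrier A. cnorm A v \<le> q}"
  have B: "v \<in> carrier A" "cnorm A v \<le> q" if "v \<in> B" for v using that by (auto simp: B_def)
  have fcar: "f v \<in> carrier A" if "v \<in> carrier A" for v
    using that y by (simp add: f_def smult_carrier mult_closed)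
  have fB: "f v \<in> B" if v: "v \<in> B" for v
  proof -
    have "cnorm A (f v) = (1/2) * cnorm A (y \<oplus> v \<otimes> v)"
      using B(1)[OF v] y cnorm_smult[of "y \<oplus> v \<otimes> v" "1/2"] by (simp add: f_def mult_closed)
    also have "\<dots> \<le> (1/2) * (cnorm A y + cnorm A v * cnorm A v)"
      using cnorm_add_le[of y "v \<otimes> v"] cnorm_mult_le[of v v] B(1)[OF v] y by (simp add: mult_closed)
    also have "cnorm A v * cnorm A v \<le> q * 1"
      using B[OF v] q0 cnorm_nonneg[of v] by (intro mult_mono) auto
    finally show ?thesis using fcar B(1)[OF v] by (simp add: B_def q_def)
  qed
  have contr: "cdist A (f u) (f w) \<le> q * cdist A u w" if u: "u \<in> B" and w: "w \<in> B" for u w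
  proof -
    note uw = B(1)[OF u] B(1)[OF w]
    have "f u \<ominus> f w = (1/2) \<odot> ((y \<oplus> u \<otimes> u) \<ominus> (y \<oplus> w \<otimes> w))"
      using uw y by (simp add: f_def minus_eq smult_add_right mult_closed smult_uminus
          smult_carrier)
    also have "(y \<oplus> u \<otimes> u) \<ominus> (y \<oplus> w \<otimes> w) = u \<otimes> u \<ominus> w \<otimes> w"
    proof -
      have "(y \<oplus> u \<otimes> u) \<ominus> (y \<oplus> w \<otimes> w) = (u \<otimes> u \<oplus> y) \<oplus> (\<ominus> y \<oplus> \<ominus> (w \<otimes> w))"
        using uw y by (simp add: minus_eq minus_add mult_closed a_comm)
      also have "\<dots> = u \<otimes> u \<oplus> (y \<oplus> (\<ominus> y \<oplus> \<ominus> (w \<otimes> w)))"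
        using uw y by (simp add: a_assoc mult_closed)
      also have "\<dots> = u \<otimes> u \<ominus> w \<otimes> w"
        using uw y by (simp add: r_neg2 minus_eq mult_closed)
      finally show ?thesis .
    qed
    \<comment> \<open>Difference of squares without commutativity; each summand keeps one factor of
      norm at most \<open>q\<close>.\<close>
    also have "u \<otimes> u \<ominus> w \<otimes> w = u \<otimes> (u \<ominus> w) \<oplus> (u \<ominus> w) \<otimes> w"
    proof -
      have "u \<otimes> (u \<ominus> w) \<oplus> (u \<ominus> w) \<otimes> w = (u \<otimes> u \<oplus> \<ominus> (u \<otimes> w)) \<oplus> (u \<otimes> w \<oplus> \<ominus> (w \<otimes> w))"
        using uw by (simp add: minus_eq mult_add_left mult_add_right mult_uminus_left
            mult_uminus_right)
      also have "\<dots> = u \<otimes> u \<oplus> (\<ominus> (u \<otimes> w) \<oplus> (u \<otimes> w \<oplus> \<ominus> (w \<otimes> w)))"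
        using uw by (simp add: a_assoc mult_closed)
      also have "\<dots> = u \<otimes> u \<ominus> w \<otimes> w"
        using uw by (simp add: r_neg1 minus_eq mult_closed)
      finally show ?thesis by simp
    qed
    finally have eq: "f u \<ominus> f w = (1/2) \<odot> (u \<otimes> (u \<ominus> w) \<oplus> (u \<ominus> w) \<otimes> w)" .
    let ?d = "cnorm A (u \<ominus> w)"
    have d: "u \<ominus> w \<in> carrier A" "0 \<le> ?d" using uw by (simp_all add: minus_closed_A cnorm_nonneg)
    have "cnorm A (f u \<ominus> f w) = (1/2) * cnorm A (u \<otimes> (u \<ominus> w) \<oplus> (u \<ominus> w) \<otimes> w)"
      unfolding eq using uw d cnorm_smult[of "u \<otimes> (u \<ominus> w) \<oplus> (u \<ominus> w) \<otimes> w" "1/2"]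
      by (simp add: mult_closed)
    also have "\<dots> \<le> (1/2) * (cnorm A u * ?d + ?d * cnorm A w)"
      using cnorm_add_le[of "u \<otimes> (u \<ominus> w)" "(u \<ominus> w) \<otimes> w"] cnorm_mult_le[of u "u \<ominus> w"]
        cnorm_mult_le[of "u \<ominus> w" w] uw d by (simp add: mult_closed)
    also have "\<dots> \<le> (1/2) * (q * ?d + ?d * q)"
      using B(2)[OF u] B(2)[OF w] d by (intro mult_left_mono add_mono mult_mono) (auto simp: q0)
    finally show ?thesis using uw fcar by (simp add: cdist_def algebra_simps)
  qed
  define V where "V n = (f ^^ n) \<zero>" for n
  have V0: "V 0 = \<zero>" and VS: "V (Suc n) = f (V n)" for n by (simp_all add: V_def)
  have VB: "V n \<in> B" for n
    by (induction n) (use q0 in \<open>auto simp: V0 VS fB\<close>, simp add: B_def cnorm_zero)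
  \<comment> \<open>With \<open>k\<close> arbitrary, the induction starts from the radius of the
    ball, which is at most 1, and each application of \<open>f\<close> gains a factor
    \<open>q\<close>. This bounds all later iterates at once, without summing a geometric
    series.\<close>
  have close: "cdist A (V (m + k)) (V m) \<le> q ^ m" for m k
  proof (induction m)
    case 0
    have "\<ominus> \<zero> = \<zero>" by (rule minus_equality) simp_all
    note minus_zero = this
    have "cdist A (V k) \<zero> = cnorm A (V k)"
      using B(1)[OF VB[of k]] by (simp add: cdist_def minus_eq minus_zero)
    then show ?case using B(2)[OF VB[of k]] q0 by (simp add: V0)
  next
    case (Suc m)
    have "cdist A (V (Suc m + k)) (V (Suc m)) \<le> q * cdist A (V (m + k)) (V m)"
      using contr[OF VB VB] by (simp add: VS)
    also have "\<dots> \<le> q * q ^ m" using Suc.IH q0 by (intro mult_left_mono)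
    finally show ?case by simp
  qed
  have "MCauchy V"
    unfolding MCauchy_def
  proof (intro conjI allI impI)
    show "range V \<subseteq> carrier A" using B(1)[OF VB] by auto
    fix e :: real assume "0 < e"
    then obtain N where N: "q ^ N < e / 2"
      using real_arch_pow_inv[of "e/2" q] q0 by auto
    have "cdist A (V n) (V n') < e" if "N \<le> n" "N \<le> n'" for n n'
    proof -
      have "cdist A (V n) (V n') \<le> cdist A (V n) (V N) + cdist A (V N) (V n')"
        using B(1)[OF VB] by (intro triangle)
      moreover have "cdist A (V n) (V N) \<le> q ^ N" "cdist A (V N) (V n') \<le> q ^ N"
        using close[of N "n - N"] close[of N "n' - N"] that by (simp_all add: commute)
      ultimately show ?thesis using N by linarith
    qed
    then show "\<exists>N. \<forall>n n'. N \<le> n \<longrightarrow> N \<le> n' \<longrightarrow> cdist A (V n) (V n') < e" by blast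
  qed
  then obtain v where v: "limitin mtopology V v sequentially"
    using complete by (auto simp: mcomplete_def)
  have vc: "v \<in> carrier A" using v limitin_mspace by blast
  have lim: "\<exists>n. cdist A (V n) v < e \<and> cdist A (V (Suc n)) v < e" if "0 < e" for e
    using v that unfolding limit_metric_sequentially by (meson le_SucI le_refl)
  have "cnorm A v \<le> q + e" if e: "0 < e" for e
  proof -
    obtain n where n: "cdist A (V n) v < e" using lim[OF e] by blast
    have "v = V n \<oplus> (v \<ominus> V n)" using vc B(1)[OF VB[of n]]
      by (simp add: minus_eq a_comm[of v] r_neg2)
    then have "cnorm A v \<le> cnorm A (V n) + cnorm A (v \<ominus> V n)"
      using cnorm_add_le[of "V n" "v \<ominus> V n"] vc B(1)[OF VB[of n]] by (simp add: minus_closed_A)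
    moreover have "cnorm A (v \<ominus> V n) = cdist A (V n) v"
      using vc B(1)[OF VB[of n]] by (subst commute) (simp add: cdist_def)
    ultimately show ?thesis using n B(2)[OF VB[of n]] by linarith
  qed
  then have vB: "v \<in> B" using vc by (simp add: B_def field_le_epsilon)
  have fv: "f v = v"
  proof -
    have "cdist A (f v) v \<le> 0 + e" if e: "0 < e" for e
    proof -
      obtain n where n: "cdist A (V n) v < e / 2" "cdist A (V (Suc n)) v < e / 2"
        using lim[of "e/2"] e by auto
      have "cdist A (f v) v \<le> cdist A (f v) (V (Suc n)) + cdist A (V (Suc n)) v"
        using vc fcar B(1)[OF VB] by (intro triangle)
      moreover have "cdist A (f v) (V (Suc n)) \<le> q * cdist A v (V n)"
        unfolding VS by (rule contr[OF vB VB])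
      moreover have "q * cdist A v (V n) \<le> 1 * cdist A v (V n)"
        using q0 by (intro mult_right_mono) auto
      ultimately show ?thesis using n by (simp add: commute)
    qed
    then have "cdist A (f v) v \<le> 0" by (rule field_le_epsilon)
    then show ?thesis using zero[OF fcar[OF vc] vc] nonneg[of "f v" v] by simp
  qed
  moreover have "adj A v = v"
  proof -
    \<comment> \<open>\<open>adj A v\<close> is a second fixed point in the ball, and a contraction
      has only one.\<close>
    have aB: "adj A v \<in> B" using vB by (simp add: B_def cnorm_adj adj_closed)
    have "f (adj A v) = adj A (f v)"
      using vc y by (simp add: f_def adj_smult adj_add adj_mult mult_closed)
    then have "cdist A (adj A v) v \<le> q * cdist A (adj A v) v"
      using contr[OF aB vB] fv by simp
    then have "(1 - q) * cdist A (adj A v) v \<le> 0" by (simp add: algebra_simps)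
    then have "cdist A (adj A v) v = 0"
      using q0 nonneg[of "adj A v" v] by (simp add: mult_le_0_iff)
    then show ?thesis using zero vc adj_closed by blast
  qed
  ultimately show ?thesis using vc by (intro bexI[of _ v]) (auto simp: f_def)
qed

text \<open>If x has norm below 1, apply \<open>exists_sqrt_defect\<close> to x*x: the resulting
  self-adjoint v satisfies x*x = 2v - vv, which formally says 1 - x*x = (1 - v)(1 - v). Under
  \<open>h\<close> this becomes |h(x)a|^2 = |a|^2 - |a - h(v)a|^2 for every vector a, so
  \<open>h x\<close> has norm at most 1.\<close>

lemma star_hom_contractive:
  fixes h :: "'a \<Rightarrow> 'p oper"
  assumes h: "star_hom A op_algebra h" and x: "x \<in> carrier A"
  shows "norm (h x) \<le> cnorm A x"
proof -
  have hc: "adjointable (h x)" if "x \<in> carrier A" for x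
    using h that by (auto simp: star_hom_def linear_map_def)
  have h_add: "h (x \<oplus> y) = h x + h y" and h_mult: "h (x \<otimes> y) = h x o\<^sub>L h y"
    if "x \<in> carrier A" "y \<in> carrier A" for x y
    using h that by (simp_all add: star_hom_def linear_map_def)
  have h_smult: "h (c \<odot> x) = scal c o\<^sub>L h x" and h_adj: "h (adj A x) = adjoint_op (h x)"
    if "x \<in> carrier A" for x c
    using h that by (simp_all add: star_hom_def linear_map_def)
  have unit: "norm (h x) \<le> 1" if x: "x \<in> carrier A" and lt: "cnorm A x < 1" for x
  proof -
    have "cnorm A (adj A x \<otimes> x) < 1"
      using c_star_identity[OF x] lt cnorm_nonneg[OF x] by (simp add: power_less_one_iff)
    moreover have "adj A (adj A x \<otimes> x) = adj A x \<otimes> x"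
      using x by (simp add: adj_mult adj_closed adj_adj)
    ultimately obtain v where v: "v \<in> carrier A" "adj A v = v" "v = (1/2) \<odot> (adj A x \<otimes> x \<oplus> v \<otimes> v)"
      using exists_sqrt_defect[of "adj A x \<otimes> x"] x by (auto simp: mult_closed adj_closed)
    have "h v = h ((1/2) \<odot> (adj A x \<otimes> x \<oplus> v \<otimes> v))" using v(3) by simp
    also have "\<dots> = scal (1/2) o\<^sub>L ((adjoint_op (h x) o\<^sub>L h x) + (h v o\<^sub>L h v))"
      using x v(1) by (simp add: h_smult h_add h_mult h_adj mult_closed adj_closed)
    finally have hv: "h v = scal (1/2) o\<^sub>L ((adjoint_op (h x) o\<^sub>L h x) + (h v o\<^sub>L h v))" .
    have sa: "adjoint_op (h v) = h v" using h_adj[OF v(1)] v(2) by simp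
    have ip: "inner (h v a) b = inner a (h v b)" for a b
      using adjointableD(2)[OF hc[OF v(1)]] by (simp add: sa is_adjoint_def)
    have ipx: "inner a (adjoint_op (h x) (h x a)) = (norm (h x a))\<^sup>2" for a
      using adjointableD(2)[OF hc[OF x]] by (simp add: is_adjoint_def power2_norm_eq_inner)
    show ?thesis
    proof (rule norm_blinfun_bound)
      fix a
      have half: "h v a = (1/2) *\<^sub>R (adjoint_op (h x) (h x a) + h v (h v a))"
      proof -
        have "h v a = (scal (1/2) o\<^sub>L ((adjoint_op (h x) o\<^sub>L h x) + (h v o\<^sub>L h v))) a"
          by (subst hv) simp
        also have "\<dots> = scal (of_real (1/2)) (adjoint_op (h x) (h x a) + h v (h v a))"
          by (simp add: blinfun.add_left)
        finally show ?thesis by (simp only: scal_of_real)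
      qed
      have 1: "2 * inner a (h v a) = (norm (h x a))\<^sup>2 + inner a (h v (h v a))"
        by (subst half) (simp add: inner_add_right ipx)
      have "0 \<le> (norm (a - h v a))\<^sup>2" by simp
      also have "\<dots> = (norm a)\<^sup>2 - 2 * inner a (h v a) + inner a (h v (h v a))"
        by (simp add: power2_norm_eq_inner inner_diff_left inner_diff_right inner_commute[of "h v
            a" a] ip)
      finally have "(norm (h x a))\<^sup>2 \<le> (norm a)\<^sup>2" unfolding 1 by simp
      then have "norm (h x a) \<le> norm a" by (rule power2_le_imp_le) simp
      then show "norm (h x a) \<le> 1 * norm a" by simp
    qed simp
  qed
  show ?thesis
  proof (rule field_le_epsilon)
    fix e :: real assume e: "0 < e"
    \<comment> \<open>\<open>unit\<close> asks for norm strictly below 1; the summand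
      \<open>e\<close> ensures this and keeps \<open>r\<close> positive when \<open>x\<close> has
      norm 0.\<close>
    define r where "r = cnorm A x + e"
    have r: "0 < r" using e cnorm_nonneg[OF x] by (simp add: r_def)
    have "cnorm A (of_real (1/r) \<odot> x) < 1"
      using r e x unfolding cnorm_smult[OF x] norm_of_real by (simp add: r_def)
    from unit[OF smult_carrier[OF x] this] have "norm (scal (of_real (1/r)) o\<^sub>L h x) \<le> 1"
      using x by (simp add: h_smult)
    then show "norm (h x) \<le> cnorm A x + e"
      using r unfolding norm_scal_comp norm_of_real by (simp add: r_def[symmetric])
  qed
qed

end

section \<open>Compact topological graphs\<close>

lemma continuous_map_locally:
  assumes "\<And>x. x \<in> topspace X \<Longrightarrow> \<exists>U. openin X U \<and> x \<in> U \<and> continuous_map (subtopology X U) Y f"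
  shows "continuous_map X Y f"
  unfolding continuous_map
proof (intro conjI allI impI)
  show "f ` topspace X \<subseteq> topspace Y"
  proof
    fix y assume "y \<in> f ` topspace X"
    then obtain x where x: "x \<in> topspace X" "y = f x" by blast
    then obtain U where "x \<in> U" "continuous_map (subtopology X U) Y f" using assms by blast
    then show "y \<in> topspace Y" using x continuous_map_image_subset_topspace by fastforce
  qed
  fix W assume W: "openin Y W"
  show "openin X {x \<in> topspace X. f x \<in> W}"
  proof (subst openin_subopen, intro ballI)
    fix x assume x: "x \<in> {x \<in> topspace X. f x \<in> W}"
    then obtain U where U: "openin X U" "x \<in> U" "continuous_map (subtopology X U) Y f"
      using assms by blast
    have "openin (subtopology X U) {z \<in> topspace (subtopology X U). f z \<in> W}"
      by (rule openin_continuous_map_preimage[OF U(3) W])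
    then have "openin X {z \<in> topspace (subtopology X U). f z \<in> W}"
      using U(1) openin_trans_full by blast
    then show "\<exists>T. openin X T \<and> x \<in> T \<and> T \<subseteq> {x \<in> topspace X. f x \<in> W}"
      using x U(2) by (intro exI[of _ "{z \<in> topspace (subtopology X U). f z \<in> W}"]) auto
  qed
qed

lemma cfunI: "continuous_map X euclidean f \<Longrightarrow> (\<And>v. v \<notin> topspace X \<Longrightarrow> f v = 0) \<Longrightarrow> f \<in> cfun X"
  by (simp add: cfun_def)

lemma cfunD: "f \<in> cfun X \<Longrightarrow> continuous_map X euclidean f"
  "f \<in> cfun X \<Longrightarrow> v \<notin> topspace X \<Longrightarrow> f v = 0"
  by (simp_all add: cfun_def)

lemma continuous_map_complex_mult:
  fixes f g :: "'a \<Rightarrow> complex"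
  shows "continuous_map X euclidean f \<Longrightarrow> continuous_map X euclidean g \<Longrightarrow>
    continuous_map X euclidean (\<lambda>x. f x * g x)"
  by (simp add: continuous_map_atin tendsto_mult)

lemma continuous_map_cnj:
  "continuous_map X euclidean f \<Longrightarrow> continuous_map X euclidean (\<lambda>x. cnj (f x))"
  by (simp add: continuous_map_atin tendsto_cnj)

lemma cfun_bounded:
  assumes "compact_space X" "f \<in> cfun X"
  shows "bounded_fun f"
proof -
  have "compactin euclidean (f ` topspace X)"
    using assms image_compactin cfunD(1) unfolding compact_space_def by blast
  then have "bounded (f ` topspace X)" by (simp add: compact_imp_bounded)
  then obtain C where C: "\<And>v. v \<in> topspace X \<Longrightarrow> cmod (f v) \<le> C"
    unfolding bounded_iff by blast
  have "cmod (f v) \<le> max C 0" for v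
    using C[of v] cfunD(2)[OF assms(2), of v] by (cases "v \<in> topspace X") auto
  then show ?thesis unfolding bounded_fun_def by blast
qed

lemma cfun_bump:
  assumes X: "compact_space X" "Hausdorff_space X" and U: "openin X U" "p \<in> U"
  obtains f where "f \<in> cfun X" "f p = 1" "\<And>q. q \<notin> U \<Longrightarrow> f q = 0"
proof -
  have p: "p \<in> topspace X" using U openin_subset by blast
  have "normal_space X" using X compact_Hausdorff_or_regular_imp_normal_space by blast
  moreover have "closedin X (topspace X - U)" using U by blast
  moreover have "closedin X {p}" using closedin_Hausdorff_singleton X p by metis
  moreover have "disjnt (topspace X - U) {p}" using U by (auto simp: disjnt_iff)
  ultimately obtain g :: "'a \<Rightarrow> real" where g: "continuous_map X (top_of_set {0..1}) g"
      "g ` (topspace X - U) \<subseteq> {0}" "g ` {p} \<subseteq> {1}"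
    using Urysohn_lemma[of X "topspace X - U" "{p}" 0 1] by force
  have cg: "continuous_map X euclidean g" using g(1) continuous_map_into_fulltopology by blast
  define f where "f q = (if q \<in> topspace X then complex_of_real (g q) else 0)" for q
  show thesis
  proof
    have "continuous_map X euclidean (\<lambda>q. complex_of_real (g q))"
      using cg by (simp add: continuous_map_atin tendsto_of_real)
    then have "continuous_map X euclidean f"
      by (rule continuous_map_eq) (simp add: f_def)
    then show "f \<in> cfun X" by (rule cfunI) (simp add: f_def)
    show "f p = 1" using g(3) p by (simp add: f_def)
    show "f q = 0" if "q \<notin> U" for q using g(2) that by (auto simp: f_def)
  qed
qed

section \<open>Fibres and local sections of the source map\<close>

definition fibre :: "('v, 'e) topological_graph \<Rightarrow> 'v \<Rightarrow> 'e set" where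
  "fibre E v = {e \<in> topspace (edges E). src E e = v}"

text \<open>The map \<open>t e\<close> is the continuous local section of the source map through the edge \<open>e\<close>.\<close>

definition local_sections ::
  "('v, 'e) topological_graph \<Rightarrow> 'v \<Rightarrow> 'v set \<Rightarrow> ('e \<Rightarrow> 'v \<Rightarrow> 'e) \<Rightarrow> bool" where
  "local_sections E v0 V t \<longleftrightarrow> openin (verts E) V \<and> v0 \<in> V \<and>
     (\<forall>e \<in> fibre E v0. continuous_map (subtopology (verts E) V) (edges E) (t e) \<and> t e v0 = e) \<and>
     (\<forall>v \<in> V. bij_betw (\<lambda>e. t e v) (fibre E v0) (fibre E v))"

locale compact_graph =
  fixes E :: "('v, 'e) topological_graph"
  assumes compact_graph: "compact_topological_graph E"
begin

abbreviation "Vs \<equiv> topspace (verts E)"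
abbreviation "Es \<equiv> topspace (edges E)"
abbreviation "CV \<equiv> cfun (verts E)"
abbreviation "CE \<equiv> cfun (edges E)"

lemma verts_space: "compact_space (verts E)" "Hausdorff_space (verts E)"
  and edges_space: "compact_space (edges E)" "Hausdorff_space (edges E)"
  and continuous_rng: "continuous_map (edges E) (verts E) (rng E)"
  and local_homeo_src: "local_homeomorphism (edges E) (verts E) (src E)"
  using compact_graph by (simp_all add: compact_topological_graph_def topological_graph_def)

lemma src_chart:
  assumes "e \<in> Es"
  obtains U g where "openin (edges E) U" "e \<in> U" "openin (verts E) (src E ` U)"
    "homeomorphic_maps (subtopology (edges E) U) (subtopology (verts E) (src E ` U)) (src E) g"
  using local_homeo_src assms unfolding local_homeomorphism_def homeomorphic_map_maps by metis

lemma continuous_src: "continuous_map (edges E) (verts E) (src E)"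
proof (rule continuous_map_locally)
  fix e assume "e \<in> Es"
  then obtain U g where U: "openin (edges E) U" "e \<in> U"
    "homeomorphic_maps (subtopology (edges E) U) (subtopology (verts E) (src E ` U)) (src E) g"
    by (rule src_chart)
  then show "\<exists>U. openin (edges E) U \<and> e \<in> U \<and>
      continuous_map (subtopology (edges E) U) (verts E) (src E)"
    unfolding homeomorphic_maps_def using continuous_map_into_fulltopology by blast
qed

lemma src_in_verts: "e \<in> Es \<Longrightarrow> src E e \<in> Vs"
  using continuous_src continuous_map_image_subset_topspace by fastforce

lemma rng_in_verts: "e \<in> Es \<Longrightarrow> rng E e \<in> Vs"
  using continuous_rng continuous_map_image_subset_topspace by fastforce

lemma openin_src_image:
  assumes Z: "openin (edges E) Z" shows "openin (verts E) (src E ` Z)"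
proof (subst openin_subopen, intro ballI)
  fix v assume "v \<in> src E ` Z"
  then obtain e where e: "e \<in> Z" "v = src E e" by blast
  have "e \<in> Es" using e Z openin_subset by blast
  then obtain U g where U: "openin (edges E) U" "e \<in> U" "openin (verts E) (src E ` U)"
    "homeomorphic_maps (subtopology (edges E) U) (subtopology (verts E) (src E ` U)) (src E) g"
    by (rule src_chart)
  have "open_map (subtopology (edges E) U) (subtopology (verts E) (src E ` U)) (src E)"
    using U(4) homeomorphic_imp_open_map homeomorphic_map_maps by blast
  moreover have "openin (subtopology (edges E) U) (U \<inter> Z)"
    using Z by (rule openin_subtopology_Int2)
  ultimately have "openin (subtopology (verts E) (src E ` U)) (src E ` (U \<inter> Z))"
    by (simp add: open_map_def)
  then have "openin (verts E) (src E ` (U \<inter> Z))" using U(3) openin_trans_full by blast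
  then show "\<exists>T. openin (verts E) T \<and> v \<in> T \<and> T \<subseteq> src E ` Z"
    using e U(2) by (intro exI[of _ "src E ` (U \<inter> Z)"]) auto
qed

text \<open>The fibre is closed in a compact space and is covered by open sets on which the source
  map is injective. Finitely many of these suffice, and each meets the fibre in at most one
  edge.\<close>

lemma finite_fibre: "finite (fibre E v)"
proof (cases "v \<in> Vs")
  case False
  then have "fibre E v = {}" using src_in_verts by (auto simp: fibre_def)
  then show ?thesis by simp
next
  case True
  have "closedin (edges E) (fibre E v)"
    using closedin_continuous_map_preimage[OF continuous_src, of "{v}"]
      closedin_Hausdorff_singleton[OF verts_space(2) True] by (simp add: fibre_def)
  then have comp: "compactin (edges E) (fibre E v)"
    using edges_space closedin_compact_space by blast
  define \<U> where "\<U> = {U. openin (edges E) U \<and> inj_on (src E) U}"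
  have "fibre E v \<subseteq> \<Union>\<U>"
  proof
    fix e assume "e \<in> fibre E v"
    then have "e \<in> Es" by (simp add: fibre_def)
    then obtain U g where U: "openin (edges E) U" "e \<in> U"
      "homeomorphic_maps (subtopology (edges E) U) (subtopology (verts E) (src E ` U)) (src E) g"
      by (rule src_chart)
    have "inj_on (src E) U"
      using U(3) openin_subset[OF U(1)] unfolding homeomorphic_maps_def
      by (intro inj_on_inverseI[of _ g]) auto
    then show "e \<in> \<Union>\<U>" using U by (auto simp: \<U>_def)
  qed
  moreover have "\<And>U. U \<in> \<U> \<Longrightarrow> openin (edges E) U" by (simp add: \<U>_def)
  ultimately obtain \<F> where F: "finite \<F>" "\<F> \<subseteq> \<U>" "fibre E v \<subseteq> \<Union>\<F>"
    using compactinD[OF comp, of \<U>] by blast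
  have "finite (U \<inter> fibre E v)" if "U \<in> \<F>" for U
  proof -
    have "inj_on (src E) U" using that F by (auto simp: \<U>_def)
    then have "inj_on (src E) (U \<inter> fibre E v)" by (rule inj_on_subset) auto
    moreover have "src E ` (U \<inter> fibre E v) \<subseteq> {v}" by (auto simp: fibre_def)
    ultimately show ?thesis by (meson finite.emptyI finite_imageD finite_insert finite_subset)
  qed
  then have "finite (\<Union>U\<in>\<F>. U \<inter> fibre E v)" using F by blast
  moreover have "fibre E v \<subseteq> (\<Union>U\<in>\<F>. U \<inter> fibre E v)" using F by blast
  ultimately show ?thesis using finite_subset by blast
qed

text \<open>A local homeomorphism from a compact space to a Hausdorff space evenly covers a
  neighbourhood of each point: disjoint charts around the finitely many edges over \<open>v0\<close>
  supply the sections, and compactness excludes further edges over nearby vertices.\<close>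

lemma ex_local_sections:
  assumes v0: "v0 \<in> Vs"
  obtains V t where "local_sections E v0 V t"
proof -
  let ?F = "fibre E v0"
  have Fsub: "e \<in> Es" "src E e = v0" if "e \<in> ?F" for e
    using that by (auto simp: fibre_def)
  have "\<forall>e \<in> ?F. \<exists>U g. openin (edges E) U \<and> e \<in> U \<and> openin (verts E) (src E ` U) \<and>
    homeomorphic_maps (subtopology (edges E) U) (subtopology (verts E) (src E ` U)) (src E) g"
    using src_chart Fsub(1) by metis
  then obtain U g where U: "\<And>e. e \<in> ?F \<Longrightarrow> openin (edges E) (U e)" "\<And>e. e \<in> ?F \<Longrightarrow> e \<in> U e"
      "\<And>e. e \<in> ?F \<Longrightarrow> openin (verts E) (src E ` U e)"
    and hom: "\<And>e. e \<in> ?F \<Longrightarrow>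
      homeomorphic_maps (subtopology (edges E) (U e)) (subtopology (verts E) (src E ` U e)) (src
          E) (g e)"
    by metis
  have "\<forall>e \<in> ?F. \<forall>e' \<in> ?F. \<exists>A B. e \<noteq> e' \<longrightarrow> openin (edges E) A \<and> openin (edges E) B \<and> e \<in> A \<and>
      e' \<in> B \<and> disjnt A B"
    using edges_space(2) Fsub(1) unfolding Hausdorff_space_def by metis
  then obtain A B where AB: "\<And>e e'. \<lbrakk>e \<in> ?F; e' \<in> ?F; e \<noteq> e'\<rbrakk> \<Longrightarrow>
      openin (edges E) (A e e') \<and> openin (edges E) (B e e') \<and> e \<in> A e e' \<and> e' \<in> B e e' \<and>
          disjnt (A e e') (B e e')"
    by metis
  \<comment> \<open>The separating sets for (e, e') and for (e', e) are chosen independently, so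
    both are imposed to make the shrunk charts disjoint. The factor \<open>Es\<close> serves the
    fibre with one edge, where the intersection over the empty family is everything.\<close>
  define W where "W e = U e \<inter> (Es \<inter> \<Inter>((\<lambda>e'. A e e' \<inter> B e' e) ` (?F - {e})))" for e
  have Wo: "openin (edges E) (W e)" if e: "e \<in> ?F" for e
    unfolding W_def
  proof (rule openin_Int[OF U(1)[OF e]])
    show "openin (edges E) (Es \<inter> \<Inter>((\<lambda>e'. A e e' \<inter> B e' e) ` (?F - {e})))"
    proof (cases "?F - {e} = {}")
      case False
      have "openin (edges E) (\<Inter>((\<lambda>e'. A e e' \<inter> B e' e) ` (?F - {e})))"
      proof (rule openin_Inter)
        show "finite ((\<lambda>e'. A e e' \<inter> B e' e) ` (?F - {e}))" using finite_fibre by simp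
        show "(\<lambda>e'. A e e' \<inter> B e' e) ` (?F - {e}) \<noteq> {}" using False by simp
        show "openin (edges E) X" if "X \<in> (\<lambda>e'. A e e' \<inter> B e' e) ` (?F - {e})" for X
        proof -
          from that obtain e' where e': "e' \<in> ?F" "e' \<noteq> e" "X = A e e' \<inter> B e' e" by blast
          have "openin (edges E) (A e e')" using AB[OF e e'(1)] e'(2) by blast
          moreover have "openin (edges E) (B e' e)" using AB[OF e'(1) e] e'(2) by blast
          ultimately show ?thesis unfolding e'(3) by (rule openin_Int)
        qed
      qed
      then show ?thesis by blast
    next
      case True
      then show ?thesis by (simp only: image_empty Inter_empty inf_top_right openin_topspace)
    qed
  qed
  have We: "e \<in> W e" if e: "e \<in> ?F" for e
    using U(2)[OF e] Fsub(1)[OF e] AB[OF e] AB[OF _ e] unfolding W_def by blast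
  have Wd: "W e \<inter> W e' = {}" if "e \<in> ?F" "e' \<in> ?F" "e \<noteq> e'" for e e'
  proof -
    have "W e \<subseteq> A e e'" "W e' \<subseteq> B e e'" using that by (auto simp: W_def)
    then show ?thesis using AB[OF that] by (auto simp: disjnt_iff)
  qed
  have WU: "W e \<subseteq> U e" for e by (auto simp: W_def)
  \<comment> \<open>Sources of edges outside all charts form a closed set, by compactness, and are
    removed. Over the rest each chart has exactly one edge and there are no other edges.\<close>
  define V where "V = (Vs \<inter> \<Inter>((\<lambda>e. src E ` W e) ` ?F)) -
    src E ` (Es - \<Union>(W ` ?F))"
  have V1: "openin (verts E) (Vs \<inter> \<Inter>((\<lambda>e. src E ` W e) ` ?F))"
  proof (cases "?F = {}")
    case False
    have "openin (verts E) (\<Inter>((\<lambda>e. src E ` W e) ` ?F))"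
      using False finite_fibre openin_src_image[OF Wo] by (intro openin_Inter) auto
    then show ?thesis by blast
  next
    case True
    then show ?thesis by (simp only: image_empty Inter_empty inf_top_right openin_topspace)
  qed
  have "closedin (edges E) (Es - \<Union>(W ` ?F))"
    using Wo by (intro closedin_diff closedin_topspace openin_Union) auto
  then have "compactin (verts E) (src E ` (Es - \<Union>(W ` ?F)))"
    using image_compactin continuous_src closedin_compact_space edges_space(1) by metis
  then have V2: "closedin (verts E) (src E ` (Es - \<Union>(W ` ?F)))"
    by (rule compactin_imp_closedin[OF verts_space(2)])
  have Vo: "openin (verts E) V"
    unfolding V_def by (rule openin_diff[OF V1 V2])
  have "v0 \<in> src E ` W e" if "e \<in> ?F" for e using We[OF that] Fsub(2)[OF that] by blast
  moreover have "v0 \<notin> src E ` (Es - \<Union>(W ` ?F))"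
    using We by (auto simp: fibre_def)
  ultimately have v0V: "v0 \<in> V" using v0 by (simp add: V_def)
  have gW: "g e v \<in> W e" "src E (g e v) = v" if e: "e \<in> ?F" and v: "v \<in> V" for e v
  proof -
    have "v \<in> src E ` W e" using e v by (auto simp: V_def)
    then obtain x where x: "x \<in> W e" "v = src E x" by blast
    have "x \<in> topspace (subtopology (edges E) (U e))"
      using x WU openin_subset[OF U(1)[OF e]] by auto
    then have "g e v = x" using hom[OF e] x(2) by (simp add: homeomorphic_maps_def)
    then show "g e v \<in> W e" "src E (g e v) = v" using x by auto
  qed
  have ginv: "g e (src E x) = x" if e: "e \<in> ?F" and x: "x \<in> W e" for e x
  proof -
    have "x \<in> topspace (subtopology (edges E) (U e))"
      using x WU openin_subset[OF U(1)[OF e]] by auto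
    then show ?thesis using hom[OF e] by (simp add: homeomorphic_maps_def)
  qed
  have bij: "bij_betw (\<lambda>e. g e v) ?F (fibre E v)" if v: "v \<in> V" for v
    unfolding bij_betw_def
  proof
    show "inj_on (\<lambda>e. g e v) ?F"
    proof (rule inj_onI, rule ccontr)
      fix e e' assume *: "e \<in> ?F" "e' \<in> ?F" "g e v = g e' v" "e \<noteq> e'"
      have "g e v \<in> W e \<inter> W e'" using gW(1)[OF *(1) v] gW(1)[OF *(2) v] *(3) by simp
      then show False using Wd[OF *(1,2,4)] by simp
    qed
    show "(\<lambda>e. g e v) ` ?F = fibre E v"
    proof
      show "(\<lambda>e. g e v) ` ?F \<subseteq> fibre E v"
        using gW[OF _ v] openin_subset[OF Wo] by (auto simp: fibre_def)
      show "fibre E v \<subseteq> (\<lambda>e. g e v) ` ?F"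
      proof
        fix x assume x: "x \<in> fibre E v"
        then have "x \<in> \<Union>(W ` ?F)" using v by (auto simp: V_def fibre_def)
        then obtain e where e: "e \<in> ?F" "x \<in> W e" by blast
        then have "g e v = x" using ginv x by (auto simp: fibre_def)
        then show "x \<in> (\<lambda>e. g e v) ` ?F" using e by blast
      qed
    qed
  qed
  have cont: "continuous_map (subtopology (verts E) V) (edges E) (g e)" if e: "e \<in> ?F" for e
  proof -
    have "continuous_map (subtopology (verts E) (src E ` U e)) (edges E) (g e)"
      using hom[OF e] continuous_map_into_fulltopology unfolding homeomorphic_maps_def by blast
    moreover have "V \<subseteq> src E ` W e" using e by (auto simp: V_def)
    then have "V \<subseteq> src E ` U e" using WU[of e] by blast
    ultimately show ?thesis by (rule continuous_map_from_subtopology_mono)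
  qed
  have "g e v0 = e" if "e \<in> ?F" for e
    using ginv[OF that We[OF that]] Fsub(2)[OF that] by simp
  then show thesis
    using that[of V g] Vo v0V cont bij unfolding local_sections_def by blast
qed

text \<open>The fibre of summation moves with \<open>v\<close>. Reindexing along local sections
  turns the sum near \<open>v0\<close> into one over the fixed finite fibre of \<open>v0\<close>,
  with continuous summands.\<close>

lemma inprod_cfun:
  assumes x: "x \<in> CE" and y: "y \<in> CE"
  shows "(\<lambda>v. \<Sum>e\<in>fibre E v. cnj (x e) * y e) \<in> CV"
proof (rule cfunI)
  show "continuous_map (verts E) euclidean (\<lambda>v. \<Sum>e\<in>fibre E v. cnj (x e) * y e)"
  proof (rule continuous_map_locally)
    fix v0 assume "v0 \<in> Vs"
    then obtain V t where ls: "local_sections E v0 V t" by (rule ex_local_sections)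
    then have ct: "continuous_map (subtopology (verts E) V) (edges E) (t e)"
        if "e \<in> fibre E v0" for e
      using that by (simp add: local_sections_def)
    have "continuous_map (subtopology (verts E) V) euclidean (\<lambda>v. x (t e v))"
      "continuous_map (subtopology (verts E) V) euclidean (\<lambda>v. y (t e v))" if "e \<in> fibre E v0" for e
      using continuous_map_compose[OF ct[OF that] cfunD(1)[OF x]]
        continuous_map_compose[OF ct[OF that] cfunD(1)[OF y]]
      by (simp_all add: o_def)
    then have "continuous_map (subtopology (verts E) V) euclidean (\<lambda>v. \<Sum>e\<in>fibre E v0. cnj (x (t e
        v)) * y (t e v))"
      by (intro continuous_map_sum finite_fibre continuous_map_complex_mult continuous_map_cnj)
    then have "continuous_map (subtopology (verts E) V) euclidean (\<lambda>v. \<Sum>e\<in>fibre E v. cnj (x e) * y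
        e)"
    proof (rule continuous_map_eq)
      fix v assume "v \<in> topspace (subtopology (verts E) V)"
      then have "bij_betw (\<lambda>e. t e v) (fibre E v0) (fibre E v)"
        using ls by (simp add: local_sections_def)
      then show "(\<Sum>e\<in>fibre E v0. cnj (x (t e v)) * y (t e v)) = (\<Sum>e\<in>fibre E v. cnj (x e) * y e)"
        by (rule sum.reindex_bij_betw)
    qed
    then show "\<exists>U. openin (verts E) U \<and> v0 \<in> U \<and>
      continuous_map (subtopology (verts E) U) euclidean (\<lambda>v. \<Sum>e\<in>fibre E v. cnj (x e) * y e)"
      using ls by (auto simp: local_sections_def)
  qed
  fix v assume "v \<notin> Vs"
  then have "fibre E v = {}" using src_in_verts by (auto simp: fibre_def)
  then show "(\<Sum>e\<in>fibre E v. cnj (x e) * y e) = 0" by simp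
qed

end

section \<open>The Fock representation\<close>

text \<open>The pair \<open>(v, [e\<^sub>1, \<dots>, e\<^sub>n])\<close> stands for the path \<open>e\<^sub>1 \<dots> e\<^sub>n\<close> with source \<open>v\<close>. Pairs that
  are not paths span an additional invariant summand, which does no harm.\<close>

type_synonym ('v, 'e) path = "'v \<times> 'e list"

text \<open>The range of the path: the head of the list is the edge traversed last. An edge may be
  put in front when its source is the tip.\<close>

definition tip :: "('v, 'e) topological_graph \<Rightarrow> ('v, 'e) path \<Rightarrow> 'v" where
  "tip E p = (case snd p of [] \<Rightarrow> fst p | e # es \<Rightarrow> rng E e)"

definition path_cons :: "('v, 'e) path \<times> 'e \<Rightarrow> ('v, 'e) path" where
  "path_cons = (\<lambda>(p, e). (fst p, e # snd p))"

lemma inj_path_cons: "inj path_cons"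
  by (auto simp: inj_def path_cons_def prod_eq_iff)

definition vertex_op ::
  "('v, 'e) topological_graph \<Rightarrow> ('v \<Rightarrow> complex) \<Rightarrow> ('v, 'e) path oper" where
  "vertex_op E a = diag (\<lambda>p. a (tip E p))"

definition create ::
  "('v, 'e) topological_graph \<Rightarrow> ('e \<Rightarrow> complex) \<Rightarrow> (('v, 'e) path \<Rightarrow> complex) \<Rightarrow> ('v, 'e) path \<Rightarrow>
      complex" where
  "create E x \<xi> p = (case snd p of [] \<Rightarrow> 0
     | e # es \<Rightarrow> if e \<in> fibre E (tip E (fst p, es)) then x e * \<xi> (fst p, es) else 0)"

definition annihilate ::
  "('v, 'e) topological_graph \<Rightarrow> ('e \<Rightarrow> complex) \<Rightarrow> (('v, 'e) path \<Rightarrow> complex) \<Rightarrow> ('v, 'e) path \<Rightarrow>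
      complex" where
  "annihilate E x \<eta> p = (\<Sum>e\<in>fibre E (tip E p). cnj (x e) * \<eta> (path_cons (p, e)))"

abbreviation create_op where "create_op E x \<equiv> ell2_op (create E x)"
abbreviation annihilate_op where "annihilate_op E x \<equiv> ell2_op (annihilate E x)"

lemma create_path_cons: "e \<in> fibre E (tip E p) \<Longrightarrow> create E x \<xi> (path_cons (p, e)) = x e * \<xi> p"
  by (simp add: create_def path_cons_def)

lemma create_nonzero:
  assumes "create E x \<xi> p \<noteq> 0"
  shows "p \<in> path_cons ` (SIGMA q:UNIV. fibre E (tip E q))"
proof (cases "snd p")
  case (Cons e es)
  then have "e \<in> fibre E (tip E (fst p, es))" using assms
    by (auto simp: create_def split: if_splits)
  then show ?thesis
    using Cons by (intro image_eqI[of _ _ "((fst p, es), e)"]) (auto simp: path_cons_def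
        prod_eq_iff)
qed (use assms in \<open>simp add: create_def\<close>)

lemma cfun_cnj: "a \<in> cfun X \<Longrightarrow> (\<lambda>v. cnj (a v)) \<in> cfun X"
  by (simp add: cfun_def continuous_map_cnj)

lemma cfun_add: "a \<in> cfun X \<Longrightarrow> b \<in> cfun X \<Longrightarrow> (\<lambda>v. a v + b v :: complex) \<in> cfun X"
  by (simp add: cfun_def continuous_map_add)

lemma cfun_mult: "a \<in> cfun X \<Longrightarrow> b \<in> cfun X \<Longrightarrow> (\<lambda>v. a v * b v) \<in> cfun X"
  by (simp add: cfun_def continuous_map_complex_mult)

lemma cfun_scale: "a \<in> cfun X \<Longrightarrow> (\<lambda>v. c * a v) \<in> cfun X"
  by (simp add: cfun_def continuous_map_complex_mult)

lemma cfun_algebra_simps [simp]: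
  "carrier (cfun_algebra X) = cfun X" "a \<oplus>\<^bsub>cfun_algebra X\<^esub> b = (\<lambda>v. a v + b v)"
  "a \<otimes>\<^bsub>cfun_algebra X\<^esub> b = (\<lambda>v. a v * b v)" "c \<odot>\<^bsub>cfun_algebra X\<^esub> a = (\<lambda>v. c * a v)"
  "adj (cfun_algebra X) a = (\<lambda>v. cnj (a v))"
  by (simp_all add: cfun_algebra_def)

lemma graph_correspondence_simps [simp]:
  "carrier (graph_correspondence G) = cfun (edges G)"
  "x \<oplus>\<^bsub>graph_correspondence G\<^esub> y = (\<lambda>e. x e + y e)"
  "c \<odot>\<^bsub>graph_correspondence G\<^esub> x = (\<lambda>e. c * x e)"
  "ract (graph_correspondence G) x a = (\<lambda>e. x e * a (src G e))"
  "lact (graph_correspondence G) a x = (\<lambda>e. a (rng G e) * x e)"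
  "inprod (graph_correspondence G) x y = (\<lambda>v. \<Sum>e\<in>fibre G v. cnj (x e) * y e)"
  by (simp_all add: graph_correspondence_def fibre_def)

context compact_graph
begin

text \<open>The sums are the values of the inner product of \<open>x\<close> with itself, a
  continuous function on a compact space. \<open>C\<close> is the bound for the creation and
  annihilation operators of \<open>x\<close>.\<close>

lemma square_sum_bound:
  assumes x: "x \<in> CE"
  obtains C where "0 \<le> C" "\<And>v. (\<Sum>e\<in>fibre E v. (cmod (x e))\<^sup>2) \<le> C\<^sup>2"
proof -
  obtain K where K: "\<And>v. cmod (\<Sum>e\<in>fibre E v. cnj (x e) * x e) \<le> K"
    using cfun_bounded[OF verts_space(1) inprod_cfun[OF x x]] by (auto simp: bounded_fun_def)
  have K0: "0 \<le> K" using K norm_ge_zero order_trans by blast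
  have "(\<Sum>e\<in>fibre E v. (cmod (x e))\<^sup>2) \<le> (sqrt K)\<^sup>2" for v
  proof -
    have "(\<Sum>e\<in>fibre E v. cnj (x e) * x e) = complex_of_real (\<Sum>e\<in>fibre E v. (cmod (x e))\<^sup>2)"
      unfolding of_real_sum by (rule sum.cong) (simp_all only: complex_norm_square mult.commute)
    then have "cmod (\<Sum>e\<in>fibre E v. cnj (x e) * x e) = (\<Sum>e\<in>fibre E v. (cmod (x e))\<^sup>2)"
      by (simp only: norm_of_real) (simp add: sum_nonneg)
    then show ?thesis using K[of v] K0 by simp
  qed
  then show thesis using that[of "sqrt K"] K0 by simp
qed

lemma create_bound:
  assumes C: "\<And>v. (\<Sum>e\<in>fibre E v. (cmod (x e))\<^sup>2) \<le> C\<^sup>2" and F: "finite F"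
  shows "(\<Sum>p\<in>F. (cmod (create E x (coord \<xi>) p))\<^sup>2) \<le> C\<^sup>2 * (norm \<xi>)\<^sup>2"
proof -
  let ?f = "\<lambda>p. (cmod (create E x (coord \<xi>) p))\<^sup>2"
  \<comment> \<open>The paths of \<open>F\<close> with their leftmost edge removed. Empty paths are
    kept unchanged by \<open>tl\<close>, but \<open>create\<close> vanishes on them.\<close>
  define Q where "Q = (\<lambda>p. (fst p, tl (snd p))) ` F"
  define S where "S = (SIGMA q:Q. fibre E (tip E q))"
  have fin: "finite Q" "finite S" using F finite_fibre by (auto simp: Q_def S_def)
  have "(\<Sum>p\<in>F. ?f p) \<le> (\<Sum>p\<in>path_cons ` S. ?f p)"
  proof -
    have "(\<Sum>p\<in>F. ?f p) = (\<Sum>p\<in>F \<inter> path_cons ` S. ?f p)"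
    proof (rule sum.mono_neutral_right[OF F])
      show "\<forall>p\<in>F - F \<inter> path_cons ` S. ?f p = 0"
      proof (rule ballI, rule ccontr)
        fix p assume p: "p \<in> F - F \<inter> path_cons ` S" and nz: "?f p \<noteq> 0"
        then have "create E x (coord \<xi>) p \<noteq> 0" by auto
        then obtain q e where qe: "p = path_cons (q, e)" "e \<in> fibre E (tip E q)"
          using create_nonzero by blast
        then have "q \<in> Q" using p unfolding Q_def
          by (intro image_eqI[of _ _ p]) (auto simp: path_cons_def)
        then show False using p qe by (auto simp: S_def)
      qed
    qed auto
    also have "\<dots> \<le> (\<Sum>p\<in>path_cons ` S. ?f p)"
      using fin by (intro sum_mono2) auto
    finally show ?thesis .
  qed
  also have "\<dots> = (\<Sum>qe\<in>S. ?f (path_cons qe))"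
    using inj_path_cons by (intro sum.reindex[unfolded o_def]) (auto intro: inj_on_subset)
  also have "\<dots> = (\<Sum>q\<in>Q. \<Sum>e\<in>fibre E (tip E q). ?f (path_cons (q, e)))"
    unfolding S_def using fin finite_fibre by (subst sum.Sigma) auto
  also have "\<dots> = (\<Sum>q\<in>Q. \<Sum>e\<in>fibre E (tip E q). (cmod (coord \<xi> q))\<^sup>2 * (cmod (x e))\<^sup>2)"
    by (intro sum.cong refl) (simp add: create_path_cons norm_mult power_mult_distrib mult.commute)
  also have "\<dots> = (\<Sum>q\<in>Q. (cmod (coord \<xi> q))\<^sup>2 * (\<Sum>e\<in>fibre E (tip E q). (cmod (x e))\<^sup>2))"
    by (simp add: sum_distrib_left)
  also have "\<dots> \<le> (\<Sum>q\<in>Q. (cmod (coord \<xi> q))\<^sup>2 * C\<^sup>2)"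
    by (intro sum_mono mult_left_mono C) simp
  also have "\<dots> = C\<^sup>2 * (\<Sum>q\<in>Q. (cmod (coord \<xi> q))\<^sup>2)"
    by (simp add: sum_distrib_left mult.commute)
  also have "\<dots> \<le> C\<^sup>2 * (norm \<xi>)\<^sup>2"
    by (intro mult_left_mono sum_coord_le_norm fin) simp
  finally show ?thesis .
qed

text \<open>Cauchy-Schwarz on each fibre; distinct pairs of path and new edge give distinct longer
  paths, so the remaining double sum is part of the square norm of \<open>\<eta>\<close>.\<close>

lemma annihilate_bound:
  assumes C: "\<And>v. (\<Sum>e\<in>fibre E v. (cmod (x e))\<^sup>2) \<le> C\<^sup>2" and F: "finite F"
  shows "(\<Sum>p\<in>F. (cmod (annihilate E x (coord \<eta>) p))\<^sup>2) \<le> C\<^sup>2 * (norm \<eta>)\<^sup>2"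
proof -
  let ?S = "SIGMA p:F. fibre E (tip E p)"
  have "(cmod (annihilate E x (coord \<eta>) p))\<^sup>2
      \<le> C\<^sup>2 * (\<Sum>e\<in>fibre E (tip E p). (cmod (coord \<eta> (path_cons (p, e))))\<^sup>2)" for p
  proof -
    have "cmod (annihilate E x (coord \<eta>) p)
        \<le> (\<Sum>e\<in>fibre E (tip E p). cmod (x e) * cmod (coord \<eta> (path_cons (p, e))))"
      unfolding annihilate_def by (rule order_trans[OF norm_sum]) (simp add: norm_mult)
    then have "(cmod (annihilate E x (coord \<eta>) p))\<^sup>2
        \<le> (\<Sum>e\<in>fibre E (tip E p). cmod (x e) * cmod (coord \<eta> (path_cons (p, e))))\<^sup>2"
      by (rule power_mono) simp
    also have "\<dots> \<le> (\<Sum>e\<in>fibre E (tip E p). (cmod (x e))\<^sup>2) * (\<Sum>e\<in>fibre E (tip E p). (cmod (coord \<eta>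
        (path_cons (p, e))))\<^sup>2)"
      by (rule Cauchy_Schwarz_ineq_sum)
    also have "\<dots> \<le> C\<^sup>2 * (\<Sum>e\<in>fibre E (tip E p). (cmod (coord \<eta> (path_cons (p, e))))\<^sup>2)"
      by (intro mult_right_mono C sum_nonneg) simp
    finally show ?thesis .
  qed
  then have "(\<Sum>p\<in>F. (cmod (annihilate E x (coord \<eta>) p))\<^sup>2)
      \<le> (\<Sum>p\<in>F. C\<^sup>2 * (\<Sum>e\<in>fibre E (tip E p). (cmod (coord \<eta> (path_cons (p, e))))\<^sup>2))"
    by (rule sum_mono)
  also have "\<dots> = C\<^sup>2 * (\<Sum>pe\<in>?S. (cmod (coord \<eta> (path_cons pe)))\<^sup>2)"
    using F finite_fibre
      sum.Sigma[of F "\<lambda>p. fibre E (tip E p)" "\<lambda>p e. (cmod (coord \<eta> (path_cons (p, e))))\<^sup>2"]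
    by (simp add: case_prod_unfold flip: sum_distrib_left)
  also have "(\<Sum>pe\<in>?S. (cmod (coord \<eta> (path_cons pe)))\<^sup>2)
      = (\<Sum>p\<in>path_cons ` ?S. (cmod (coord \<eta> p))\<^sup>2)"
    using inj_path_cons by (intro sum.reindex[symmetric, unfolded o_def]) (auto intro:
        inj_on_subset)
  also have "C\<^sup>2 * \<dots> \<le> C\<^sup>2 * (norm \<eta>)\<^sup>2"
    using F finite_fibre by (intro mult_left_mono sum_coord_le_norm) auto
  finally show ?thesis .
qed

lemma coord_create:
  assumes x: "x \<in> CE"
  shows "coord (create_op E x \<xi>) = create E x (coord \<xi>)"
proof -
  obtain C where C: "0 \<le> C" "\<And>v. (\<Sum>e\<in>fibre E v. (cmod (x e))\<^sup>2) \<le> C\<^sup>2"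
    using square_sum_bound[OF x] by blast
  show ?thesis
  proof (rule coord_ell2_op[where C = C])
    show "(\<Sum>p\<in>F. (cmod (create E x (coord \<xi>) p))\<^sup>2) \<le> C\<^sup>2 * (norm \<xi>)\<^sup>2"
      if "finite F" for \<xi> F using create_bound[OF C(2) that] .
  qed (auto simp: create_def algebra_simps C(1) split: list.split)
qed

lemma coord_annihilate:
  assumes x: "x \<in> CE"
  shows "coord (annihilate_op E x \<xi>) = annihilate E x (coord \<xi>)"
proof -
  obtain C where C: "0 \<le> C" "\<And>v. (\<Sum>e\<in>fibre E v. (cmod (x e))\<^sup>2) \<le> C\<^sup>2"
    using square_sum_bound[OF x] by blast
  show ?thesis
  proof (rule coord_ell2_op[where C = C])
    show "(\<Sum>p\<in>F. (cmod (annihilate E x (coord \<xi>) p))\<^sup>2) \<le> C\<^sup>2 * (norm \<xi>)\<^sup>2"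
      if "finite F" for \<xi> F using annihilate_bound[OF C(2) that] .
  qed (auto simp: annihilate_def algebra_simps C(1) sum.distrib scaleR_sum_right)
qed

text \<open>A created vector lives on the image of \<open>path_cons\<close>, where a path splits
  uniquely into its leftmost edge and the rest. The inner product thus becomes an iterated sum,
  whose inner sum over a fibre is \<open>annihilate\<close>.\<close>

lemma is_adjoint_create:
  assumes x: "x \<in> CE"
  shows "is_adjoint (create_op E x) (annihilate_op E x)"
  unfolding is_adjoint_def
proof (intro allI)
  fix \<xi> \<eta> :: "('v, 'e) path ell2"
  let ?S = "SIGMA q:UNIV. fibre E (tip E q)"
  let ?f = "\<lambda>p. cnj (create E x (coord \<xi>) p) * coord \<eta> p"
  have sm: "?f summable_on UNIV"
    using coord_mult_summable[of "create_op E x \<xi>" \<eta>] by (simp add: coord_create[OF x])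
  have inj: "inj_on path_cons ?S" using inj_path_cons inj_on_subset by blast
  have "?f summable_on path_cons ` ?S" using sm summable_on_subset_banach by blast
  then have smS: "(\<lambda>(q, e). ?f (path_cons (q, e))) summable_on ?S"
    using summable_on_reindex[OF inj, of ?f] by (simp add: o_def case_prod_unfold)
  have "infsum ?f UNIV = infsum ?f (path_cons ` ?S)"
    by (rule infsum_cong_neutral) (use create_nonzero in fastforce)+
  also have "\<dots> = infsum (\<lambda>(q, e). ?f (path_cons (q, e))) ?S"
    using infsum_reindex[OF inj, of ?f] by (simp add: o_def case_prod_unfold)
  also have "\<dots> = infsum (\<lambda>q. infsum (\<lambda>e. ?f (path_cons (q, e))) (fibre E (tip E q))) UNIV"
    by (rule infsum_Sigma'_banach[symmetric, OF smS])
  also have "\<dots> = infsum (\<lambda>q. cnj (coord \<xi> q) * annihilate E x (coord \<eta>) q) UNIV"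
    by (rule infsum_cong)
      (simp add: finite_fibre create_path_cons annihilate_def sum_distrib_left mult_ac)
  finally show "inner (create_op E x \<xi>) \<eta> = inner \<xi> (annihilate_op E x \<eta>)"
    by (simp add: inner_ell2_def coord_create[OF x] coord_annihilate[OF x])
qed

lemma adjointable_create: "x \<in> CE \<Longrightarrow> adjointable (create_op E x)"
  unfolding adjointable_def complex_linear_op_def
  using is_adjoint_create
  by (auto intro!: ell2_eqI simp: coord_create coord_scal create_def split: list.split)

lemma adjoint_create: "x \<in> CE \<Longrightarrow> adjoint_op (create_op E x) = annihilate_op E x"
  by (intro adjoint_opI is_adjoint_create)

lemma bounded_vertex: "a \<in> CV \<Longrightarrow> bounded_fun (\<lambda>p. a (tip E p))"
  using cfun_bounded[OF verts_space(1)] unfolding bounded_fun_def by blast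

lemma coord_vertex: "a \<in> CV \<Longrightarrow> coord (vertex_op E a \<xi>) = (\<lambda>p. a (tip E p) * coord \<xi> p)"
  by (simp add: vertex_op_def coord_diag bounded_vertex)

lemma adjointable_vertex: "a \<in> CV \<Longrightarrow> adjointable (vertex_op E a)"
  by (simp add: vertex_op_def adjointable_diag bounded_vertex)

lemma adjoint_vertex:
  "a \<in> CV \<Longrightarrow> adjoint_op (vertex_op E a) = vertex_op E (\<lambda>v. cnj (a v))"
  unfolding vertex_op_def by (simp add: adjoint_op_diag bounded_vertex)

lemma cfun_lact:
  assumes "a \<in> CV" "x \<in> CE"
  shows "(\<lambda>e. a (rng E e) * x e) \<in> CE"
proof (rule cfunI)
  have "continuous_map (edges E) euclidean (\<lambda>e. a (rng E e))"
    using continuous_map_compose[OF continuous_rng cfunD(1)[OF assms(1)]] by (simp add: o_def)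
  then show "continuous_map (edges E) euclidean (\<lambda>e. a (rng E e) * x e)"
    using cfunD(1)[OF assms(2)] by (rule continuous_map_complex_mult)
qed (simp add: cfunD(2)[OF assms(2)])

lemma cfun_ract:
  assumes "a \<in> CV" "x \<in> CE"
  shows "(\<lambda>e. x e * a (src E e)) \<in> CE"
proof (rule cfunI)
  have "continuous_map (edges E) euclidean (\<lambda>e. a (src E e))"
    using continuous_map_compose[OF continuous_src cfunD(1)[OF assms(1)]] by (simp add: o_def)
  with cfunD(1)[OF assms(2)] show "continuous_map (edges E) euclidean (\<lambda>e. x e * a (src E e))"
    by (rule continuous_map_complex_mult)
qed (simp add: cfunD(2)[OF assms(2)])

lemma annihilate_create:
  assumes "x \<in> CE" "y \<in> CE"
  shows "annihilate_op E x (create_op E y \<xi>) = vertex_op E (\<lambda>v. \<Sum>e\<in>fibre E v. cnj (x e) * y e) \<xi>"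
proof (rule ell2_eqI)
  fix p
  have "coord (annihilate_op E x (create_op E y \<xi>)) p
      = (\<Sum>e\<in>fibre E (tip E p). cnj (x e) * create E y (coord \<xi>) (path_cons (p, e)))"
    using assms by (simp add: coord_annihilate coord_create annihilate_def)
  also have "\<dots> = (\<Sum>e\<in>fibre E (tip E p). cnj (x e) * y e) * coord \<xi> p"
    unfolding sum_distrib_right by (intro sum.cong refl) (simp add: create_path_cons)
  finally show "coord (annihilate_op E x (create_op E y \<xi>)) p
      = coord (vertex_op E (\<lambda>v. \<Sum>e\<in>fibre E v. cnj (x e) * y e) \<xi>) p"
    by (simp add: coord_vertex[OF inprod_cfun[OF assms]])
qed

lemma vertex_create:
  assumes "a \<in> CV" "x \<in> CE"
  shows "vertex_op E a (create_op E x \<xi>) = create_op E (\<lambda>e. a (rng E e) * x e) \<xi>"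
  using assms by (intro ell2_eqI)
    (simp add: coord_vertex coord_create cfun_lact create_def tip_def split: list.split)

text \<open>\<open>create\<close> only puts \<open>e\<close> in front of paths whose tip is the
  source of \<open>e\<close>, so the value of \<open>a\<close> at the tip may be moved to the
  edge.\<close>

lemma create_vertex:
  assumes "a \<in> CV" "x \<in> CE"
  shows "create_op E x (vertex_op E a \<xi>) = create_op E (\<lambda>e. x e * a (src E e)) \<xi>"
  using assms by (intro ell2_eqI)
    (auto simp: coord_vertex coord_create cfun_ract create_def fibre_def split: list.split)

lemma toeplitz_rep_fock:
  "toeplitz_rep (cfun_algebra (verts E)) (graph_correspondence E) op_algebra
     (\<lambda>x. create_op E x) (vertex_op E)"
  unfolding toeplitz_rep_def star_hom_def linear_map_def
proof (intro conjI ballI allI)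
  show "(\<lambda>x. create_op E x) \<in> carrier (graph_correspondence E) \<rightarrow> carrier op_algebra"
    by (simp add: adjointable_create)
  show "vertex_op E \<in> carrier (cfun_algebra (verts E)) \<rightarrow> carrier op_algebra"
    by (simp add: adjointable_vertex)
next
  fix x y c assume x: "x \<in> carrier (graph_correspondence E)"
  then have x': "x \<in> CE" by simp
  show "create_op E (c \<odot>\<^bsub>graph_correspondence E\<^esub> x) = c \<odot>\<^bsub>op_algebra\<^esub> create_op E x"
    using x' by (intro blinfun_eqI ell2_eqI)
      (simp add: coord_create cfun_scale coord_scal create_def mult_ac split: list.split)
  assume y: "y \<in> carrier (graph_correspondence E)"
  then have y': "y \<in> CE" by simp
  show "create_op E (x \<oplus>\<^bsub>graph_correspondence E\<^esub> y) = create_op E x \<oplus>\<^bsub>op_algebra\<^esub> create_op E y"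
    using x' y' by (intro blinfun_eqI ell2_eqI)
      (simp add: coord_create cfun_add blinfun.add_left coord_simps create_def algebra_simps
          split: list.split)
  show "adj op_algebra (create_op E x) \<otimes>\<^bsub>op_algebra\<^esub> create_op E y
      = vertex_op E (inprod (graph_correspondence E) x y)"
    using x' y' by (intro blinfun_eqI) (simp add: adjoint_create annihilate_create)
next
  fix a b c assume a: "a \<in> carrier (cfun_algebra (verts E))"
  then have a': "a \<in> CV" by simp
  show "vertex_op E (c \<odot>\<^bsub>cfun_algebra (verts E)\<^esub> a) = c \<odot>\<^bsub>op_algebra\<^esub> vertex_op E a"
    using a' by (intro blinfun_eqI ell2_eqI) (simp add: coord_vertex cfun_scale coord_scal)
  show "vertex_op E (adj (cfun_algebra (verts E)) a) = adj op_algebra (vertex_op E a)"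
    using a' by (simp add: adjoint_vertex)
  assume b: "b \<in> carrier (cfun_algebra (verts E))"
  then have b': "b \<in> CV" by simp
  show "vertex_op E (a \<oplus>\<^bsub>cfun_algebra (verts E)\<^esub> b) = vertex_op E a \<oplus>\<^bsub>op_algebra\<^esub> vertex_op E b"
    using a' b' by (intro blinfun_eqI ell2_eqI)
      (simp add: coord_vertex cfun_add blinfun.add_left coord_simps algebra_simps)
  show "vertex_op E (a \<otimes>\<^bsub>cfun_algebra (verts E)\<^esub> b) = vertex_op E a \<otimes>\<^bsub>op_algebra\<^esub> vertex_op E b"
    using a' b' by (intro blinfun_eqI ell2_eqI) (simp add: coord_vertex cfun_mult)
next
  fix a x assume "a \<in> carrier (cfun_algebra (verts E))" "x \<in> carrier (graph_correspondence E)"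
  then have "a \<in> CV" "x \<in> CE" by simp_all
  then show "create_op E (lact (graph_correspondence E) a x)
      = vertex_op E a \<otimes>\<^bsub>op_algebra\<^esub> create_op E x"
    "create_op E (ract (graph_correspondence E) x a) = create_op E x \<otimes>\<^bsub>op_algebra\<^esub> vertex_op E a"
    by (auto intro!: blinfun_eqI simp: vertex_create create_vertex)
qed

end

section \<open>Degree one elements of the Toeplitz algebra\<close>

lemma star_homD:
  assumes "star_hom A B h" and "x \<in> carrier A"
  shows "h x \<in> carrier B" "h (c \<odot>\<^bsub>A\<^esub> x) = c \<odot>\<^bsub>B\<^esub> h x" "h (adj A x) = adj B (h x)"
    "y \<in> carrier A \<Longrightarrow> h (x \<oplus>\<^bsub>A\<^esub> y) = h x \<oplus>\<^bsub>B\<^esub> h y"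
    "y \<in> carrier A \<Longrightarrow> h (x \<otimes>\<^bsub>A\<^esub> y) = h x \<otimes>\<^bsub>B\<^esub> h y"
  using assms by (auto simp: star_hom_def linear_map_def)

context c_star_algebra
begin

lemma star_hom_tendsto:
  fixes h :: "'a \<Rightarrow> 'p oper"
  assumes h: "star_hom A op_algebra h" and \<sigma>: "range \<sigma> \<subseteq> carrier A"
    and lim: "limitin (norm_topology A) \<sigma> l sequentially"
  shows "(\<lambda>n. h (\<sigma> n)) \<longlonglongrightarrow> h l"
proof -
  interpret Metric_space "carrier A" "cdist A" by (rule Metric_space_cdist)
  have l: "l \<in> carrier A" using lim limitin_mspace by blast
  have le: "dist (h x) (h y) \<le> cdist A x y" if "x \<in> carrier A" "y \<in> carrier A" for x y
  proof -
    have "h (x \<oplus> (-1) \<odot> y) = h x + (scal (-1) o\<^sub>L h y)"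
      using star_homD[OF h] that by (simp add: smult_carrier)
    also have "\<dots> = h x - h y"
      by (intro blinfun_eqI ell2_eqI) (simp add: coord_scal coord_simps blinfun.add_left
          blinfun.diff_left)
    finally have "h (x \<ominus> y) = h x - h y" using that by (simp add: minus_eq smult_minus_one)
    then show ?thesis
      using star_hom_contractive[OF h minus_closed_A[OF that]] that
      by (simp add: dist_norm cdist_def)
  qed
  show ?thesis
  proof (rule metric_LIMSEQ_I)
    fix e :: real assume e: "0 < e"
    have "\<forall>e>0. \<exists>N. \<forall>n\<ge>N. \<sigma> n \<in> carrier A \<and> cdist A (\<sigma> n) l < e"
      using lim unfolding limit_metric_sequentially by simp
    then obtain N where N: "\<forall>n\<ge>N. \<sigma> n \<in> carrier A \<and> cdist A (\<sigma> n) l < e" using e by blast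
    have "dist (h (\<sigma> n)) (h l) < e" if "n \<ge> N" for n
      using N that le[of "\<sigma> n" l] l by (simp add: le_less_trans)
    then show "\<exists>N. \<forall>n\<ge>N. dist (h (\<sigma> n)) (h l) < e" by blast
  qed
qed

text \<open>The elements satisfying \<open>P\<close> form a C*-subalgebra containing the generators;
  closedness may be tested on sequences because the topology is metric.\<close>

lemma generated_induct:
  assumes gen: "generated_c_star_subalgebra A G = carrier A" and G: "G \<subseteq> carrier A"
    and t: "t \<in> carrier A"
    and base: "\<And>g. g \<in> G \<Longrightarrow> P g"
    and P0: "P \<zero>"
    and add: "\<And>x y. \<lbrakk>x \<in> carrier A; y \<in> carrier A; P x; P y\<rbrakk> \<Longrightarrow> P (x \<oplus> y)"
    and mult: "\<And>x y. \<lbrakk>x \<in> carrier A; y \<in> carrier A; P x; P y\<rbrakk> \<Longrightarrow> P (x \<otimes> y)"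
    and smult: "\<And>c x. \<lbrakk>x \<in> carrier A; P x\<rbrakk> \<Longrightarrow> P (c \<odot> x)"
    and adj: "\<And>x. \<lbrakk>x \<in> carrier A; P x\<rbrakk> \<Longrightarrow> P (adj A x)"
    and lim: "\<And>\<sigma> l. \<lbrakk>range \<sigma> \<subseteq> carrier A; limitin (norm_topology A) \<sigma> l sequentially; \<And>n. P (\<sigma> n)\<rbrakk>
        \<Longrightarrow> P l"
  shows "P t"
proof -
  interpret Metric_space "carrier A" "cdist A" by (rule Metric_space_cdist)
  let ?S = "{t \<in> carrier A. P t}"
  have "closedin mtopology ?S"
    unfolding metric_closedin_iff_sequentially_closed
  proof (intro conjI allI impI)
    fix \<sigma> l assume *: "range \<sigma> \<subseteq> ?S \<and> limitin mtopology \<sigma> l sequentially"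
    then have 1: "range \<sigma> \<subseteq> carrier A" "limitin mtopology \<sigma> l sequentially" "\<And>n. P (\<sigma> n)"
      by blast+
    have "l \<in> carrier A" using 1(2) limitin_mspace by blast
    then show "l \<in> ?S" using lim[OF 1] by simp
  qed simp
  then have "c_star_subalgebra ?S A"
    unfolding c_star_subalgebra_def
    using P0 add mult smult adj mult_closed smult_carrier adj_closed by simp
  moreover have "G \<subseteq> ?S" using base G by auto
  ultimately have "generated_c_star_subalgebra A G \<subseteq> ?S"
    unfolding generated_c_star_subalgebra_def by blast
  then show ?thesis using gen t by blast
qed

text \<open>The value is the zero operator, written as \<open>scal 0\<close> so that the lemmas on
  diagonal operators apply to it.\<close>

lemma star_hom_zero:
  fixes h :: "'a \<Rightarrow> 'p oper"
  assumes "star_hom A op_algebra h"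
  shows "h \<zero> = scal 0"
proof -
  have "0 \<odot> \<zero> = \<zero>"
    using cnorm_smult[of \<zero> 0] cnorm_zero_iff[of "0 \<odot> \<zero>"] smult_carrier[of \<zero> 0] by simp
  then have "h \<zero> = scal 0 o\<^sub>L h \<zero>" using star_homD(2)[OF assms zero_closed, of 0] by simp
  also have "\<dots> = scal 0" by (intro blinfun_eqI ell2_eqI) (simp add: coord_scal)
  finally show ?thesis .
qed

lemma star_hom_eqI:
  fixes h k :: "'a \<Rightarrow> 'p oper"
  assumes gen: "generated_c_star_subalgebra A G = carrier A" and G: "G \<subseteq> carrier A"
    and h: "star_hom A op_algebra h" and k: "star_hom A op_algebra k"
    and eq: "\<And>g. g \<in> G \<Longrightarrow> h g = k g" and t: "t \<in> carrier A"
  shows "h t = k t"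
  using gen G t
proof (rule generated_induct)
  show "h g = k g" if "g \<in> G" for g using eq that .
  show "h \<zero> = k \<zero>" by (simp only: star_hom_zero[OF h] star_hom_zero[OF k])
  fix \<sigma> l assume \<sigma>: "range \<sigma> \<subseteq> carrier A" "limitin (norm_topology A) \<sigma> l sequentially"
    and "\<And>n. h (\<sigma> n) = k (\<sigma> n)"
  then have "(\<lambda>n. h (\<sigma> n)) \<longlonglongrightarrow> k l" using star_hom_tendsto[OF k \<sigma>] by simp
  with star_hom_tendsto[OF h \<sigma>] show "h l = k l" by (rule LIMSEQ_unique)
qed (simp_all add: star_homD[OF h] star_homD[OF k])

end

lemma star_hom_comp: "star_hom A B g \<Longrightarrow> star_hom B C h \<Longrightarrow> star_hom A C (h \<circ> g)"
  by (auto simp: star_hom_def linear_map_def Pi_iff)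

section \<open>The Fock representation of the Toeplitz algebra and its vacuum vectors\<close>

locale graph_toeplitz_algebra = compact_graph E
  for E :: "('v, 'e) topological_graph" +
  fixes T :: "'t star_algebra" and \<iota>X :: "('e \<Rightarrow> complex) \<Rightarrow> 't" and \<iota>A :: "('v \<Rightarrow> complex) \<Rightarrow> 't"
    and \<gamma> :: "complex \<Rightarrow> 't \<Rightarrow> 't"
  assumes toeplitz: "is_toeplitz_algebra E T \<iota>X \<iota>A" and gauge: "is_gauge_action E T \<iota>X \<iota>A \<gamma>"
begin

sublocale T: c_star_algebra T
  using toeplitz by (simp add: universal_toeplitz_rep_def)

lemma rep: "toeplitz_rep (cfun_algebra (verts E)) (graph_correspondence E) T \<iota>X \<iota>A"
  using toeplitz by (simp add: universal_toeplitz_rep_def)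

lemma \<iota>A_star_hom: "star_hom (cfun_algebra (verts E)) T \<iota>A"
  and \<iota>X_linear: "linear_map (graph_correspondence E) T \<iota>X"
  using rep by (simp_all add: toeplitz_rep_def)

lemma \<iota>A_carrier: "a \<in> CV \<Longrightarrow> \<iota>A a \<in> carrier T"
  using star_homD(1)[OF \<iota>A_star_hom] by simp

lemma \<iota>X_carrier: "x \<in> CE \<Longrightarrow> \<iota>X x \<in> carrier T"
  using \<iota>X_linear by (auto simp: linear_map_def)

lemma generated:
  "generated_c_star_subalgebra T (\<iota>X ` CE \<union> \<iota>A ` CV) = carrier T"
  using toeplitz by (simp add: universal_toeplitz_rep_def)

lemma generators_carrier: "\<iota>X ` CE \<union> \<iota>A ` CV \<subseteq> carrier T"
  using \<iota>A_carrier \<iota>X_carrier by auto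

definition fock :: "'t \<Rightarrow> ('v, 'e) path oper" where
  "fock = (SOME h. star_hom T op_algebra h \<and> (\<forall>x \<in> CE. h (\<iota>X x) = create_op E x) \<and>
     (\<forall>a \<in> CV. h (\<iota>A a) = vertex_op E a))"

lemma fock: "star_hom T op_algebra fock"
  and fock_\<iota>X: "x \<in> CE \<Longrightarrow> fock (\<iota>X x) = create_op E x"
  and fock_\<iota>A: "a \<in> CV \<Longrightarrow> fock (\<iota>A a) = vertex_op E a"
proof -
  have "\<exists>h. star_hom T op_algebra h \<and> (\<forall>x \<in> CE. h (\<iota>X x) = create_op E x) \<and>
     (\<forall>a \<in> CV. h (\<iota>A a) = vertex_op E a)"
    using universal_toeplitz_rep_extends[OF toeplitz c_star_algebra_op_algebra toeplitz_rep_fock]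
    by simp
  then have *: "star_hom T op_algebra fock \<and> (\<forall>x \<in> CE. fock (\<iota>X x) = create_op E x) \<and>
     (\<forall>a \<in> CV. fock (\<iota>A a) = vertex_op E a)"
    unfolding fock_def by (rule someI_ex)
  then show "star_hom T op_algebra fock" "x \<in> CE \<Longrightarrow> fock (\<iota>X x) = create_op E x"
    "a \<in> CV \<Longrightarrow> fock (\<iota>A a) = vertex_op E a" by blast+
qed

lemmas fock_simps = star_homD[OF fock, simplified]

abbreviation vacuum :: "'v \<Rightarrow> ('v, 'e) path ell2" where
  "vacuum v \<equiv> basis_vec (v, [])"

lemma coord_fock_\<iota>A_vacuum: "a \<in> CV \<Longrightarrow> coord (fock (\<iota>A a) (vacuum v)) (v, []) = a v"
  by (simp add: fock_\<iota>A coord_vertex coord_basis_vec tip_def)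

text \<open>The empty path at \<open>v\<close> has tip \<open>v\<close>, so the diagonal vacuum
  coordinate of \<open>fock (\<iota>A a)\<close> recovers the value of \<open>a\<close> at
  \<open>v\<close>.\<close>

lemma \<iota>A_inj: "inj_on \<iota>A CV"
proof (rule inj_onI)
  fix a b assume "a \<in> CV" "b \<in> CV" "\<iota>A a = \<iota>A b"
  then show "a = b" using coord_fock_\<iota>A_vacuum by (metis ext)
qed

section \<open>Unitary implementation of the gauge action\<close>

definition length_op :: "complex \<Rightarrow> ('v, 'e) path oper" where
  "length_op z = diag (\<lambda>p. z ^ length (snd p))"

lemma bounded_fun_length: "z \<in> sphere 0 1 \<Longrightarrow> bounded_fun (\<lambda>p. z ^ length (snd p))"
  unfolding bounded_fun_def by (intro exI[of _ 1]) (simp add: norm_power)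

lemma coord_length_op: "z \<in> sphere 0 1 \<Longrightarrow> coord (length_op z \<xi>)
    = (\<lambda>p. z ^ length (snd p) * coord \<xi> p)"
  by (simp add: length_op_def coord_diag bounded_fun_length)

lemma sphere_cnj: "z \<in> sphere 0 1 \<Longrightarrow> cnj z \<in> sphere 0 1" "z \<in> sphere 0 1 \<Longrightarrow> z * cnj z = 1"
  by (simp_all add: complex_norm_square[symmetric])

lemma length_op_cnj:
  assumes "z \<in> sphere 0 1"
  shows "length_op z (length_op (cnj z) \<xi>) = \<xi>" "length_op (cnj z) (length_op z \<xi>) = \<xi>"
proof -
  have "z ^ n * (cnj z ^ n * c) = c" "cnj z ^ n * (z ^ n * c) = c" for n c
    using sphere_cnj(2)[OF assms] by (simp_all add: mult.commute[of "cnj z"] flip: mult.assoc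
        power_mult_distrib)
  then show "length_op z (length_op (cnj z) \<xi>) = \<xi>" "length_op (cnj z) (length_op z \<xi>) = \<xi>"
    using assms sphere_cnj(1)[OF assms]
    by (auto intro!: ell2_eqI simp: coord_length_op)
qed

lemma adjoint_length_op: "z \<in> sphere 0 1 \<Longrightarrow> adjoint_op (length_op z) = length_op (cnj z)"
  by (simp add: length_op_def adjoint_op_diag bounded_fun_length)

lemma adjointable_length_op: "z \<in> sphere 0 1 \<Longrightarrow> adjointable (length_op z)"
  by (simp add: length_op_def adjointable_diag bounded_fun_length)

lemma gauge_star_hom: "z \<in> sphere 0 1 \<Longrightarrow> star_hom T T (\<gamma> z)"
  using gauge by (simp add: gauge_action_def star_iso_def)

abbreviation "gauge_conj z a \<equiv> length_op (cnj z) o\<^sub>L (a o\<^sub>L length_op z)"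

lemma star_hom_conjugate:
  assumes z: "z \<in> sphere 0 1" and h: "star_hom T op_algebra h"
  shows "star_hom T op_algebra (\<lambda>t. gauge_conj z (h t))"
  unfolding star_hom_def linear_map_def
proof (intro conjI ballI allI)
  note z' = sphere_cnj(1)[OF z]
  have adj: "adjointable (h x)" if "x \<in> carrier T" for x using star_homD(1)[OF h that] by simp
  show "(\<lambda>t. gauge_conj z (h t)) \<in> carrier T \<rightarrow> carrier op_algebra"
    using adj z z' by (simp add: adjointable_comp adjointable_length_op)
  fix x y c assume x: "x \<in> carrier T"
  show "gauge_conj z (h (c \<odot>\<^bsub>T\<^esub> x))
      = c \<odot>\<^bsub>op_algebra\<^esub> (gauge_conj z (h x))"
    using star_homD(2)[OF h x] adjointable_length_op[OF z']
    by (intro blinfun_eqI) (simp add: adjointableD)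
  show "gauge_conj z (h (adj T x))
      = adj op_algebra (gauge_conj z (h x))"
    using star_homD(3)[OF h x] adj[OF x] z z'
    by (simp add: adjoint_op_comp adjointable_comp adjointable_length_op adjoint_length_op
        comp_assoc_op)
  assume y: "y \<in> carrier T"
  show "gauge_conj z (h (x \<oplus>\<^bsub>T\<^esub> y))
      = (gauge_conj z (h x)) \<oplus>\<^bsub>op_algebra\<^esub> (gauge_conj z (h y))"
    using star_homD(4)[OF h x y] by (intro blinfun_eqI) (simp add: blinfun.add_left
        blinfun.add_right)
  show "gauge_conj z (h (x \<otimes>\<^bsub>T\<^esub> y))
      = (gauge_conj z (h x)) \<otimes>\<^bsub>op_algebra\<^esub> (gauge_conj z (h y))"
    using star_homD(5)[OF h x y] z by (intro blinfun_eqI) (simp add: length_op_cnj)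
qed

text \<open>Both sides are *-homomorphisms in \<open>t\<close>, so generators suffice. Creation
  raises the path length by one, and conjugation then yields the factor \<open>cnj z\<close>, which
  cancels the \<open>z\<close> from the gauge action; vertex operators preserve length.\<close>

lemma fock_gauge:
  assumes z: "z \<in> sphere 0 1" and t: "t \<in> carrier T"
  shows "gauge_conj z (fock (\<gamma> z t)) = fock t"
proof -
  note z' = sphere_cnj(1)[OF z]
  have sh: "star_hom T op_algebra (\<lambda>t. gauge_conj z ((fock \<circ> \<gamma> z) t))"
    by (rule star_hom_conjugate[OF z star_hom_comp[OF gauge_star_hom[OF z] fock]])
  have "gauge_conj z ((fock \<circ> \<gamma> z) t) = fock t"
  proof (rule T.star_hom_eqI[OF generated generators_carrier sh fock _ t])
    fix g assume "g \<in> \<iota>X ` CE \<union> \<iota>A ` CV"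
    then show "gauge_conj z ((fock \<circ> \<gamma> z) g) = fock g"
    proof
      assume "g \<in> \<iota>X ` CE"
      then obtain x where x: "x \<in> CE" "g = \<iota>X x" by blast
      have cz: "cnj z ^ n * (cnj z * (z * (z ^ n * c))) = c" for n c
        using sphere_cnj(2)[OF z]
        by (metis (no_types, lifting) mult.assoc mult.commute mult.left_neutral power_mult_distrib
            power_one)
      have "\<gamma> z g = z \<odot>\<^bsub>T\<^esub> \<iota>X x" using gauge z x by (simp add: gauge_action_def)
      then have "fock (\<gamma> z g) = scal z o\<^sub>L create_op E x"
        using x by (simp add: fock_simps fock_\<iota>X \<iota>X_carrier)
      then show ?thesis
        using x z z' cz
        by (intro blinfun_eqI ell2_eqI)
          (auto simp: coord_length_op coord_scal coord_create fock_\<iota>X create_def mult_ac split: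
              list.split)
    next
      assume "g \<in> \<iota>A ` CV"
      then obtain a where a: "a \<in> CV" "g = \<iota>A a" by blast
      have cz: "cnj z ^ n * (z ^ n * c) = c" for n c
        using sphere_cnj(2)[OF z]
        by (metis (no_types, lifting) mult.assoc mult.commute mult.left_neutral power_mult_distrib
            power_one)
      have "\<gamma> z g = \<iota>A a" using gauge z a by (simp add: gauge_action_def)
      then show ?thesis
        using a z z' cz
        by (intro blinfun_eqI ell2_eqI)
          (simp add: coord_length_op coord_vertex fock_\<iota>A mult_ac)
    qed
  qed
  then show ?thesis by simp
qed

definition degree_one :: "'t \<Rightarrow> bool" where
  "degree_one t \<longleftrightarrow> t \<in> carrier T \<and> (\<forall>z \<in> sphere 0 1. \<gamma> z t = z \<odot>\<^bsub>T\<^esub> t)"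

text \<open>Vacuum vectors are fixed by \<open>length_op z\<close>, so for \<open>t\<close> of
  degree one the vector \<open>fock t (vacuum w)\<close> is an eigenvector of
  \<open>length_op z\<close> with eigenvalue \<open>z\<close>. A nonzero coordinate at a path of
  length n thus forces z^n = z on the whole circle.\<close>

lemma degree_one_length:
  assumes t: "degree_one t" and nz: "coord (fock t (vacuum w)) p \<noteq> 0"
  shows "length (snd p) = 1"
proof (rule ccontr)
  assume n: "length (snd p) \<noteq> 1"
  have tc: "t \<in> carrier T" using t by (simp add: degree_one_def)
  have pow: "z ^ length (snd p) = z" if z: "z \<in> sphere 0 1" for z :: complex
  proof -
    have "\<gamma> z t = z \<odot>\<^bsub>T\<^esub> t" using t z by (simp add: degree_one_def)
    then have "fock (\<gamma> z t) = scal z o\<^sub>L fock t" using tc by (simp add: fock_simps)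
    moreover have "length_op z (vacuum w) = vacuum w"
      using z by (intro ell2_eqI) (simp add: coord_length_op coord_basis_vec)
    moreover have "(gauge_conj z (fock (\<gamma> z t))) (vacuum w) = fock t (vacuum w)"
      by (simp only: fock_gauge[OF z tc])
    ultimately have "length_op (cnj z) (scal z (fock t (vacuum w))) = fock t (vacuum w)"
      by simp
    then have "length_op z (fock t (vacuum w)) = scal z (fock t (vacuum w))"
      using length_op_cnj(1)[OF z] by metis
    then have "coord (length_op z (fock t (vacuum w))) p = coord (scal z (fock t (vacuum w))) p"
      by simp
    then show ?thesis using nz z by (simp add: coord_length_op coord_scal)
  qed
  show False
  proof (cases "length (snd p) = 0")
    case True
    then show ?thesis using pow[of "-1"] by simp
  next
    case False
    then obtain m where m: "length (snd p) = Suc m" "0 < m" using n by (cases "length (snd p)") auto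
    \<comment> \<open>The angle is chosen so that the m-th power is -1, whereas z^(m+1) = z forces
      it to be 1.\<close>
    have "(cis (pi / real m)) ^ Suc m = cis (pi / real m)" using pow[of "cis (pi / real m)"] m
      by simp
    then have c1: "cis (pi / real m) ^ m = 1" by simp
    have e: "real m * (pi / real m) = pi" using m by simp
    have "cis (pi / real m) ^ m = cis pi" unfolding Complex.DeMoivre e by (rule refl)
    then show False using c1 by simp
  qed
qed

text \<open>Sections of the Fock module, in which the value at \<open>w\<close> is supported on the paths with
  source \<open>w\<close>.\<close>

inductive fock_section :: "('v \<Rightarrow> ('v, 'e) path ell2) \<Rightarrow> bool" where
  vacuum: "a \<in> CV \<Longrightarrow> fock_section (\<lambda>w. scal (a w) (vacuum w))"
| create: "fock_section \<xi> \<Longrightarrow> x \<in> CE \<Longrightarrow> fock_section (\<lambda>w. create_op E x (\<xi> w))"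
| add: "fock_section \<xi> \<Longrightarrow> fock_section \<eta> \<Longrightarrow> fock_section (\<lambda>w. \<xi> w + \<eta> w)"

lemma fock_section_vertex:
  assumes "fock_section \<xi>" and a: "a \<in> CV"
  shows "fock_section (\<lambda>w. vertex_op E a (\<xi> w))"
  using assms(1)
proof induction
  case (vacuum b)
  have eq: "vertex_op E a (scal (b w) (basis_vec (w, [])))
      = scal (a w * b w) (basis_vec (w, []))" for w
    by (intro ell2_eqI) (simp add: coord_vertex[OF a] coord_scal coord_basis_vec tip_def)
  show ?case unfolding eq by (rule fock_section.vacuum[OF cfun_mult[OF a vacuum]])
next
  case (create \<xi> x)
  then show ?case using fock_section.create[OF create(1) cfun_lact[OF a create(2)]]
    by (simp add: vertex_create[OF a])
next
  case (add \<xi> \<eta>)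
  then show ?case by (simp add: blinfun.add_right fock_section.add)
qed

lemma fock_section_scal: "fock_section \<xi> \<Longrightarrow> fock_section (\<lambda>w. scal c (\<xi> w))"
proof (induction rule: fock_section.induct)
  case (vacuum b)
  have eq: "scal c (scal (b w) (basis_vec (w, []))) = scal (c * b w) (basis_vec (w, []))" for w
    by (simp add: scal_mult)
  show ?case unfolding eq by (rule fock_section.vacuum[OF cfun_scale[OF vacuum, of c]])
next
  case (create \<xi> x)
  then show ?case
    using fock_section.create[OF create(3,2)] adjointableD(1)[OF adjointable_create[OF create(2)],
        of c] by simp
next
  case (add \<xi> \<eta>)
  then show ?case by (simp add: blinfun.add_right fock_section.add)
qed

text \<open>Annihilation kills the vacuum and turns a created section into a vertex operator applied
  to the earlier section. This is why the inductive class needs no rule of its own for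
  adjoints.\<close>

lemma fock_section_annihilate:
  assumes "fock_section \<xi>" and x: "x \<in> CE"
  shows "fock_section (\<lambda>w. annihilate_op E x (\<xi> w))"
  using assms(1)
proof induction
  case (vacuum a)
  have "annihilate_op E x (scal (a w) (basis_vec (w, []))) = scal 0 (basis_vec (w, []))" for w
    by (intro ell2_eqI) (simp add: coord_annihilate[OF x] annihilate_def coord_scal
        coord_basis_vec path_cons_def)
  moreover have "(\<lambda>_. 0) \<in> CV" by (simp add: cfun_def)
  ultimately show ?case using fock_section.vacuum[of "\<lambda>_. 0"] by simp
next
  case (create \<xi> y)
  then show ?case using fock_section_vertex[OF create(1) inprod_cfun[OF x create(2)]]
    by (simp add: annihilate_create[OF x])
next
  case (add \<xi> \<eta>)
  then show ?case by (simp add: blinfun.add_right fock_section.add)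
qed

text \<open>The uniform closure over the vertex space. A general element of the Toeplitz algebra is
  only a norm limit of expressions in the generators, so its effect on sections is only a limit of
  this kind.\<close>

definition section_limit :: "('v \<Rightarrow> ('v, 'e) path ell2) \<Rightarrow> bool" where
  "section_limit \<xi> \<longleftrightarrow> (\<forall>\<epsilon>>0. \<exists>\<eta>. fock_section \<eta> \<and> (\<forall>w \<in> Vs. norm (\<eta> w - \<xi> w) \<le> \<epsilon>))"

lemma section_limit_op:
  assumes op: "\<And>\<eta>. fock_section \<eta> \<Longrightarrow> fock_section (\<lambda>w. blinfun_apply a (\<eta> w))"
      and \<xi>: "section_limit \<xi>"
  shows "section_limit (\<lambda>w. a (\<xi> w))"
  unfolding section_limit_def
proof (intro allI impI)
  fix \<epsilon> :: real assume \<epsilon>: "0 < \<epsilon>"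
  define K where "K = norm a + 1"
  have K: "0 < K" using norm_ge_zero[of a] unfolding K_def by linarith
  obtain \<eta> where \<eta>: "fock_section \<eta>" "\<And>w. w \<in> Vs \<Longrightarrow> norm (\<eta> w - \<xi> w) \<le> \<epsilon> / K"
    using \<xi> \<epsilon> K unfolding section_limit_def by (meson divide_pos_pos)
  have "norm (a (\<eta> w) - a (\<xi> w)) \<le> \<epsilon>" if w: "w \<in> Vs" for w
  proof -
    have "norm (a (\<eta> w) - a (\<xi> w)) \<le> norm a * norm (\<eta> w - \<xi> w)"
      using norm_blinfun[of a "\<eta> w - \<xi> w"] by (simp add: blinfun.diff_right)
    also have "\<dots> \<le> K * (\<epsilon> / K)" using \<eta>(2)[OF w] K by (intro mult_mono) (auto simp: K_def)
    finally show ?thesis using K by simp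
  qed
  then show "\<exists>\<eta>. fock_section \<eta> \<and> (\<forall>w\<in>Vs. norm (\<eta> w - a (\<xi> w)) \<le> \<epsilon>)"
    using op[OF \<eta>(1)] by (intro exI[of _ "\<lambda>w. a (\<eta> w)"]) blast
qed

lemma section_limit_add:
  assumes "section_limit \<xi>" "section_limit \<eta>"
  shows "section_limit (\<lambda>w. \<xi> w + \<eta> w)"
  unfolding section_limit_def
proof (intro allI impI)
  fix \<epsilon> :: real assume \<epsilon>: "0 < \<epsilon>"
  then have h: "0 < \<epsilon> / 2" by simp
  obtain \<xi>' where \<xi>': "fock_section \<xi>'" "\<And>w. w \<in> Vs \<Longrightarrow> norm (\<xi>' w - \<xi> w) \<le> \<epsilon> / 2"
    using assms(1) h unfolding section_limit_def by blast
  obtain \<eta>' where \<eta>': "fock_section \<eta>'" "\<And>w. w \<in> Vs \<Longrightarrow> norm (\<eta>' w - \<eta> w) \<le> \<epsilon> / 2"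
    using assms(2) h unfolding section_limit_def by blast
  have "norm (\<xi>' w + \<eta>' w - (\<xi> w + \<eta> w)) \<le> \<epsilon>" if w: "w \<in> Vs" for w
    using norm_triangle_ineq[of "\<xi>' w - \<xi> w" "\<eta>' w - \<eta> w"] \<xi>'(2)[OF w] \<eta>'(2)[OF w]
    by (simp add: algebra_simps)
  then show "\<exists>\<zeta>. fock_section \<zeta> \<and> (\<forall>w\<in>Vs. norm (\<zeta> w - (\<xi> w + \<eta> w)) \<le> \<epsilon>)"
    using fock_section.add[OF \<xi>'(1) \<eta>'(1)] by (intro exI[of _ "\<lambda>w. \<xi>' w + \<eta>' w"]) blast
qed

lemma section_limit_lim:
  assumes \<sigma>: "\<And>n. section_limit (\<lambda>w. blinfun_apply (a n) (\<xi> w))" and lim: "a \<longlonglongrightarrow> b"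
      and \<xi>: "section_limit \<xi>"
  shows "section_limit (\<lambda>w. b (\<xi> w))"
  unfolding section_limit_def
proof (intro allI impI)
  fix \<epsilon> :: real assume \<epsilon>: "0 < \<epsilon>"
  \<comment> \<open>Norm convergence of \<open>a\<close> gives uniform convergence in
    \<open>w\<close> once \<open>\<xi>\<close> is bounded. A section within distance 1 supplies the
    bound, being built from bounded functions by bounded operators.\<close>
  obtain \<eta> where \<eta>: "fock_section \<eta>" "\<And>w. w \<in> Vs \<Longrightarrow> norm (\<eta> w - \<xi> w) \<le> 1"
    using \<xi> unfolding section_limit_def by (meson zero_less_one)
  have "\<exists>K. \<forall>w \<in> Vs. norm (\<eta> w) \<le> K" using \<eta>(1)
  proof induction
    case (vacuum a)
    obtain C where "\<And>v. cmod (a v) \<le> C" using cfun_bounded[OF verts_space(1) vacuum]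
      by (auto simp: bounded_fun_def)
    then show ?case by (intro exI[of _ C]) (simp add: norm_scal norm_basis_vec)
  next
    case (create \<xi> x)
    then obtain K where K: "\<And>w. w \<in> Vs \<Longrightarrow> norm (\<xi> w) \<le> K" by blast
    have "norm (create_op E x (\<xi> w)) \<le> norm (create_op E x) * K" if "w \<in> Vs" for w
      by (rule order_trans[OF norm_blinfun mult_left_mono[OF K[OF that]]]) simp
    then show ?case by blast
  next
    case (add \<xi> \<eta>)
    then show ?case by (meson add_mono norm_triangle_le)
  qed
  then obtain K where K: "\<And>w. w \<in> Vs \<Longrightarrow> norm (\<eta> w) \<le> K" by blast
  define K' where "K' = \<bar>K\<bar> + 1"
  have K': "0 < K'" by (simp add: K'_def)
  have bd: "norm (\<xi> w) \<le> K'" if w: "w \<in> Vs" for w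
    using norm_triangle_ineq4[of "\<eta> w" "\<eta> w - \<xi> w"] K[OF w] \<eta>(2)[OF w] by (simp add: K'_def)
  have "0 < \<epsilon> / 2 / K'" using \<epsilon> K' by simp
  then obtain n where n: "norm (a n - b) < \<epsilon> / 2 / K'"
    using lim unfolding lim_sequentially dist_norm by blast
  obtain \<zeta> where \<zeta>: "fock_section \<zeta>" "\<And>w. w \<in> Vs \<Longrightarrow> norm (\<zeta> w - a n (\<xi> w)) \<le> \<epsilon> / 2"
    using \<sigma>[of n] \<epsilon> unfolding section_limit_def by (meson half_gt_zero)
  have "norm (\<zeta> w - b (\<xi> w)) \<le> \<epsilon>" if w: "w \<in> Vs" for w
  proof -
    have "norm ((a n - b) (\<xi> w)) \<le> norm (a n - b) * norm (\<xi> w)" by (rule norm_blinfun)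
    also have "\<dots> \<le> \<epsilon> / 2 / K' * K'" using n bd[OF w] K' \<epsilon> by (intro mult_mono) auto
    finally have "norm (a n (\<xi> w) - b (\<xi> w)) \<le> \<epsilon> / 2" using K' by (simp add: blinfun.diff_left)
    then show ?thesis
      using norm_triangle_ineq[of "\<zeta> w - a n (\<xi> w)" "a n (\<xi> w) - b (\<xi> w)"] \<zeta>(2)[OF w] by simp
  qed
  then show "\<exists>\<eta>. fock_section \<eta> \<and> (\<forall>w\<in>Vs. norm (\<eta> w - b (\<xi> w)) \<le> \<epsilon>)"
    using \<zeta>(1) by blast
qed

text \<open>Induction over the generated algebra. The predicate speaks of \<open>fock t\<close> and
  of its adjoint, since the step for \<open>adj\<close> exchanges the two, and of all
  \<open>\<xi>\<close>, since a product applies one factor to the output of the other.\<close>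

lemma fock_section_limit:
  assumes t: "t \<in> carrier T" and \<xi>: "section_limit \<xi>"
  shows "section_limit (\<lambda>w. fock t (\<xi> w))"
proof -
  let ?P = "\<lambda>t. \<forall>\<xi>. section_limit \<xi> \<longrightarrow>
    section_limit (\<lambda>w. fock t (\<xi> w)) \<and> section_limit (\<lambda>w. adjoint_op (fock t) (\<xi> w))"
  have "?P t"
    using generated generators_carrier t
  proof (rule T.generated_induct)
    fix g assume "g \<in> \<iota>X ` CE \<union> \<iota>A ` CV"
    then consider x where "x \<in> CE" "g = \<iota>X x" | a where "a \<in> CV" "g = \<iota>A a" by blast
    then show "?P g"
    proof cases
      case 1
      then show ?thesis
        using section_limit_op fock_section.create fock_section_annihilate
        by (simp add: fock_\<iota>X adjoint_create)
    next
      case 2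
      then show ?thesis
        using section_limit_op fock_section_vertex by (simp add: fock_\<iota>A adjoint_vertex cfun_cnj)
    qed
  next
    show "?P \<zero>\<^bsub>T\<^esub>"
      using section_limit_op[of "scal 0"] fock_section_scal
      by (simp add: T.star_hom_zero[OF fock] adjoint_op_diag)
  next
    fix x y assume "x \<in> carrier T" "y \<in> carrier T" "?P x" "?P y"
    then show "?P (x \<oplus>\<^bsub>T\<^esub> y)" "?P (x \<otimes>\<^bsub>T\<^esub> y)"
      by (simp_all add: fock_simps adjoint_op_add adjoint_op_comp blinfun.add_left
          section_limit_add)
  next
    fix c x assume "x \<in> carrier T" "?P x"
    then show "?P (c \<odot>\<^bsub>T\<^esub> x)" "?P (adj T x)"
      using section_limit_op[OF fock_section_scal]
      by (simp_all add: fock_simps adjoint_op_comp adjoint_op_diag adjointable_diag adjointableD)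
  next
    fix \<sigma> l assume r: "range \<sigma> \<subseteq> carrier T"
      and lim: "limitin (norm_topology T) \<sigma> l sequentially" and P: "\<And>n. ?P (\<sigma> n)"
    interpret M: Metric_space "carrier T" "cdist T" by (rule T.Metric_space_cdist)
    have l: "l \<in> carrier T" using lim M.limitin_mspace by blast
    have L: "(\<lambda>n. fock (\<sigma> n)) \<longlonglongrightarrow> fock l" by (rule T.star_hom_tendsto[OF fock r lim])
    have "\<sigma> n \<in> carrier T" for n using r by auto
    then have "dist (adjoint_op (fock (\<sigma> n))) (adjoint_op (fock l))
        = dist (fock (\<sigma> n)) (fock l)" for n
      using l fock_simps(1)
      by (simp add: dist_norm adjointableD(5) adjointable_diff flip: adjoint_op_diff)
    then have L': "(\<lambda>n. adjoint_op (fock (\<sigma> n))) \<longlonglongrightarrow> adjoint_op (fock l)"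
      using L by (simp add: lim_sequentially)
    show "?P l" using section_limit_lim[OF _ L] section_limit_lim[OF _ L'] P by blast
  qed
  then show ?thesis using \<xi> by blast
qed

end

section \<open>Continuity and support of the components on single edges\<close>

context graph_toeplitz_algebra
begin

lemma fock_section_vertex_continuous:
  "fock_section \<xi> \<Longrightarrow> continuous_map (verts E) euclidean (\<lambda>w. coord (\<xi> w) (w, []))"
proof (induction rule: fock_section.induct)
  case (vacuum a)
  then show ?case by (simp add: coord_scal coord_basis_vec cfunD(1))
next
  case (create \<xi> x)
  then show ?case by (simp add: coord_create create_def)
next
  case (add \<xi> \<eta>)
  then show ?case by (simp add: coord_simps continuous_map_add)
qed

text \<open>Creation reduces the component at \<open>[e]\<close> to the vacuum component at the
  source of \<open>e\<close>, so continuity there, pulled back along the source map, is what is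
  used.\<close>

lemma fock_section_edge_continuous:
  "fock_section \<xi> \<Longrightarrow> continuous_map (edges E) euclidean (\<lambda>e. coord (\<xi> (src E e)) (src E e, [e]))"
proof (induction rule: fock_section.induct)
  case (vacuum a)
  then show ?case by (simp add: coord_scal coord_basis_vec)
next
  case (create \<xi> x)
  have "continuous_map (edges E) euclidean (\<lambda>e. coord (\<xi> (src E e)) (src E e, []))"
    using continuous_map_compose[OF continuous_src fock_section_vertex_continuous[OF create(1)]]
    by (simp add: o_def)
  from continuous_map_complex_mult[OF cfunD(1)[OF create(2)] this]
  show ?case
    by (rule continuous_map_eq) (simp add: coord_create[OF create(2)] create_def fibre_def tip_def)
next
  case (add \<xi> \<eta>)
  then show ?case by (simp add: coord_simps continuous_map_add)
qed

text \<open>For a path with a single edge, the case singled out by \<open>degree_one_length\<close>,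
  this puts the edge into \<open>fibre E w\<close>.\<close>

lemma fock_section_support:
  "fock_section \<xi> \<Longrightarrow> coord (\<xi> w) (v, es) \<noteq> 0 \<Longrightarrow>
    v = w \<and> (\<forall>e es'. es = e # es' \<longrightarrow> e \<in> fibre E (tip E (v, es')))"
proof (induction arbitrary: v es rule: fock_section.induct)
  case (vacuum a)
  then show ?case by (auto simp: coord_scal coord_basis_vec split: if_splits)
next
  case (create \<xi> x)
  have nz: "create E x (coord (\<xi> w)) (v, es) \<noteq> 0" using create by (simp add: coord_create)
  then obtain e es' where es: "es = e # es'" by (cases es) (auto simp: create_def)
  then have "e \<in> fibre E (tip E (v, es'))" "coord (\<xi> w) (v, es') \<noteq> 0"
    using nz by (auto simp: create_def split: if_splits)
  then show ?case using create.IH es by blast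
next
  case (add \<xi> \<eta>)
  then have "coord (\<xi> w) (v, es) \<noteq> 0 \<or> coord (\<eta> w) (v, es) \<noteq> 0" by (auto simp: coord_simps)
  then show ?case using add.IH by blast
qed

lemma section_limit_support:
  assumes \<xi>: "section_limit \<xi>" and w: "w \<in> Vs" and nz: "coord (\<xi> w) (v, es) \<noteq> 0"
  shows "v = w \<and> (\<forall>e es'. es = e # es' \<longrightarrow> e \<in> fibre E (tip E (v, es')))"
proof (rule ccontr)
  assume no: "\<not> ?thesis"
  define \<epsilon> where "\<epsilon> = cmod (coord (\<xi> w) (v, es)) / 2"
  have "0 < \<epsilon>" using nz by (simp add: \<epsilon>_def)
  then obtain \<eta> where \<eta>: "fock_section \<eta>" "norm (\<eta> w - \<xi> w) \<le> \<epsilon>"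
    using \<xi> w unfolding section_limit_def by blast
  have "coord (\<eta> w) (v, es) = 0" using fock_section_support[OF \<eta>(1)] no by blast
  then have "cmod (coord (\<xi> w) (v, es)) \<le> \<epsilon>"
    using coord_le_norm[of "\<eta> w - \<xi> w" "(v, es)"] \<eta>(2) by (simp add: coord_simps)
  then show False using \<open>0 < \<epsilon>\<close> by (simp add: \<epsilon>_def)
qed

text \<open>Coordinates are dominated by the norm, so the approximation is uniform over the edges
  and continuity passes to the limit.\<close>

lemma section_limit_edge_continuous:
  assumes \<xi>: "section_limit \<xi>"
  shows "continuous_map (edges E) euclidean (\<lambda>e. coord (\<xi> (src E e)) (src E e, [e]))"
proof -
  have "\<forall>n. \<exists>\<eta>. fock_section \<eta> \<and> (\<forall>w\<in>Vs. norm (\<eta> w - \<xi> w) \<le> inverse (real (Suc n)))"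
    using \<xi> unfolding section_limit_def by simp
  then obtain \<sigma> where \<sigma>: "\<And>n. fock_section (\<sigma> n)"
      "\<And>n w. w \<in> Vs \<Longrightarrow> norm (\<sigma> n w - \<xi> w) \<le> inverse (real (Suc n))"
    by metis
  have "continuous_map (edges E) Met_TC.mtopology (\<lambda>e. coord (\<xi> (src E e)) (src E e, [e]))"
  proof (rule Met_TC.continuous_map_uniform_limit[where F = sequentially
      and f = "\<lambda>n e. coord (\<sigma> n (src E e)) (src E e, [e])"])
    show "\<forall>\<^sub>F n in sequentially. continuous_map (edges E) Met_TC.mtopology (\<lambda>e. coord (\<sigma> n (src E
        e)) (src E e, [e]))"
      using fock_section_edge_continuous[OF \<sigma>(1)] by (simp add: mtopology_is_euclidean)
    fix \<epsilon> :: real assume "0 < \<epsilon>"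
    then obtain N where N: "inverse (real (Suc N)) < \<epsilon>" using reals_Archimedean by blast
    have "dist (coord (\<sigma> n (src E e)) (src E e, [e])) (coord (\<xi> (src E e)) (src E e, [e])) < \<epsilon>"
      if "n \<ge> N" "e \<in> Es" for n e
    proof -
      have "cmod (coord (\<sigma> n (src E e) - \<xi> (src E e)) (src E e, [e])) \<le> inverse (real (Suc n))"
        using coord_le_norm \<sigma>(2)[OF src_in_verts[OF that(2)]] by (rule order_trans)
      also have "\<dots> \<le> inverse (real (Suc N))" using that(1) by (simp add: field_simps)
      also note N
      finally show ?thesis by (simp add: dist_norm coord_simps)
    qed
    then show "\<forall>\<^sub>F n in sequentially. \<forall>e\<in>Es. coord (\<xi> (src E e)) (src E e, [e]) \<in> UNIV \<and>
        dist (coord (\<sigma> n (src E e)) (src E e, [e])) (coord (\<xi> (src E e)) (src E e, [e])) < \<epsilon>"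
      unfolding eventually_sequentially by blast
  qed simp
  then show ?thesis by (simp add: mtopology_is_euclidean)
qed

lemma section_limit_fock_vacuum:
  assumes t: "t \<in> carrier T"
  shows "section_limit (\<lambda>w. fock t (vacuum w))"
proof -
  \<comment> \<open>The unit of the vertex algebra. It exhibits the vacuum vectors, over the vertex
    space, as a section.\<close>
  define i where "i w = (if w \<in> Vs then 1 else 0 :: complex)" for w
  have "continuous_map (verts E) euclidean i"
    by (rule continuous_map_eq[of _ _ "\<lambda>_. 1"]) (simp_all add: i_def)
  then have "i \<in> CV" by (rule cfunI) (simp add: i_def)
  then have "fock_section (\<lambda>w. scal (i w) (vacuum w))" by (rule fock_section.vacuum)
  then have "section_limit vacuum"
    unfolding section_limit_def
    by (intro allI impI exI[of _ "\<lambda>w. scal (i w) (vacuum w)"]) (simp add: i_def scal_one)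
  then show ?thesis by (rule fock_section_limit[OF t])
qed

text \<open>The first-level component of an element of the Toeplitz algebra; for \<open>t = \<iota>X x\<close> it is \<open>x\<close>.\<close>

definition coeff :: "'t \<Rightarrow> 'e \<Rightarrow> complex" where
  "coeff t e = (if e \<in> Es then coord (fock t (vacuum (src E e))) (src E e, [e]) else 0)"

lemma coeff_cfun:
  assumes t: "t \<in> carrier T" shows "coeff t \<in> CE"
proof (rule cfunI)
  show "continuous_map (edges E) euclidean (coeff t)"
    by (rule continuous_map_eq[OF section_limit_edge_continuous[OF section_limit_fock_vacuum[OF
        t]]])
      (simp add: coeff_def)
qed (simp add: coeff_def)

lemma coeff_add: "s \<in> carrier T \<Longrightarrow> t \<in> carrier T \<Longrightarrow> coeff (s \<oplus>\<^bsub>T\<^esub> t) e = coeff s e + coeff t e"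
  by (simp add: coeff_def fock_simps blinfun.add_left coord_simps)

lemma coeff_smult: "t \<in> carrier T \<Longrightarrow> coeff (c \<odot>\<^bsub>T\<^esub> t) e = c * coeff t e"
  by (simp add: coeff_def fock_simps coord_scal)

lemma coeff_\<iota>A_mult:
  "a \<in> CV \<Longrightarrow> t \<in> carrier T \<Longrightarrow> coeff (\<iota>A a \<otimes>\<^bsub>T\<^esub> t) e = a (rng E e) * coeff t e"
  by (simp add: coeff_def fock_simps \<iota>A_carrier fock_\<iota>A coord_vertex tip_def)

text \<open>By degree and support, \<open>fock t (vacuum w)\<close> lives on the single edges in
  \<open>fibre E w\<close>, so the left side is its full square norm. Moving \<open>t\<close> to the
  other side as an adjoint gives the vacuum expectation of \<open>\<iota>A b\<close>, which is the
  value of \<open>b\<close> at \<open>w\<close>.\<close>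

lemma coeff_norm:
  assumes t: "degree_one t" and b: "b \<in> CV" "adj T t \<otimes>\<^bsub>T\<^esub> t = \<iota>A b"
    and w: "w \<in> Vs"
  shows "(\<Sum>e\<in>fibre E w. (cmod (coeff t e))\<^sup>2) = Re (b w)"
proof -
  have tc: "t \<in> carrier T" using t by (simp add: degree_one_def)
  let ?\<xi> = "fock t (vacuum w)"
  have "coord ?\<xi> p = 0" if p: "p \<notin> (\<lambda>e. (w, [e])) ` fibre E w" for p
  proof (rule ccontr)
    assume nz: "coord ?\<xi> p \<noteq> 0"
    then obtain v e where p': "p = (v, [e])"
      using degree_one_length[OF t nz] by (metis One_nat_def length_0_conv length_Suc_conv
          prod.collapse)
    have "v = w \<and> (\<forall>e' es'. [e] = e' # es' \<longrightarrow> e' \<in> fibre E (tip E (v, es')))"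
      by (rule section_limit_support[OF section_limit_fock_vacuum[OF tc] w]) (use nz p' in simp)
    then show False using p p' by (auto simp: tip_def)
  qed
  then have "(norm ?\<xi>)\<^sup>2 = infsum (\<lambda>p. (cmod (coord ?\<xi> p))\<^sup>2) ((\<lambda>e. (w, [e])) ` fibre E w)"
    unfolding norm_ell2_sq by (intro infsum_cong_neutral) auto
  also have "\<dots> = (\<Sum>p\<in>(\<lambda>e. (w, [e])) ` fibre E w. (cmod (coord ?\<xi> p))\<^sup>2)"
    by (rule infsum_finite) (simp add: finite_fibre)
  also have "\<dots> = (\<Sum>e\<in>fibre E w. (cmod (coord ?\<xi> (w, [e])))\<^sup>2)"
    by (subst sum.reindex) (auto simp: inj_on_def)
  also have "\<dots> = (\<Sum>e\<in>fibre E w. (cmod (coeff t e))\<^sup>2)"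
    by (rule sum.cong) (auto simp: coeff_def fibre_def)
  finally have "(\<Sum>e\<in>fibre E w. (cmod (coeff t e))\<^sup>2) = (norm ?\<xi>)\<^sup>2" by simp
  also have "\<dots> = inner (vacuum w) (adjoint_op (fock t) ?\<xi>)"
    using adjointableD(2)[OF fock_simps(1)[OF tc]]
    by (simp add: is_adjoint_def power2_norm_eq_inner)
  also have "adjoint_op (fock t) ?\<xi> = fock (adj T t \<otimes>\<^bsub>T\<^esub> t) (vacuum w)"
    using tc by (simp add: fock_simps T.adj_closed)
  also have "inner (vacuum w) (fock (adj T t \<otimes>\<^bsub>T\<^esub> t) (vacuum w)) = Re (b w)"
    unfolding b(2) using coord_fock_\<iota>A_vacuum[OF b(1)] by (simp add: inner_basis_vec)
  finally show ?thesis .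
qed

end

section \<open>Characters of commutative algebras\<close>

lemma cfun_one: "(\<lambda>v. if v \<in> topspace X then 1 else 0 :: complex) \<in> cfun X"
proof (rule cfunI)
  show "continuous_map X euclidean (\<lambda>v. if v \<in> topspace X then 1 else 0 :: complex)"
    by (rule continuous_map_eq[of _ _ "\<lambda>_. 1"]) simp_all
qed simp

lemma openin_nonzero: "f \<in> cfun X \<Longrightarrow> openin X {v \<in> topspace X. f v \<noteq> 0}"
proof -
  assume f: "f \<in> cfun X"
  have "openin X {v \<in> topspace X. f v \<in> - {0}}"
    by (rule openin_continuous_map_preimage[OF cfunD(1)[OF f]]) auto
  then show ?thesis by simp
qed

text \<open>If every point \<open>v\<close> carried an element of the kernel of the character that does not vanish
  at \<open>v\<close>, then a finite sum of squares of such elements would be an invertible element of the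
  kernel.\<close>

lemma character_is_evaluation:
  fixes ch :: "('v \<Rightarrow> complex) \<Rightarrow> complex"
  assumes X: "compact_space X"
    and add: "\<And>a b. a \<in> cfun X \<Longrightarrow> b \<in> cfun X \<Longrightarrow> ch (\<lambda>v. a v + b v) = ch a + ch b"
    and mult: "\<And>a b. a \<in> cfun X \<Longrightarrow> b \<in> cfun X \<Longrightarrow> ch (\<lambda>v. a v * b v) = ch a * ch b"
    and scale: "\<And>c a. a \<in> cfun X \<Longrightarrow> ch (\<lambda>v. c * a v) = c * ch a"
    and one: "ch (\<lambda>v. if v \<in> topspace X then 1 else 0) = 1"
  shows "\<exists>v \<in> topspace X. \<forall>a \<in> cfun X. ch a = a v"
proof (rule ccontr)
  assume "\<not> ?thesis"
  then have "\<forall>v \<in> topspace X. \<exists>a \<in> cfun X. ch a \<noteq> a v" by blast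
  then obtain a where a: "\<And>v. v \<in> topspace X \<Longrightarrow> a v \<in> cfun X \<and> ch (a v) \<noteq> a v v" by metis
  define i :: "'v \<Rightarrow> complex" where "i v = (if v \<in> topspace X then 1 else 0)" for v
  have i: "i \<in> cfun X" "ch i = 1" using cfun_one[of X] one unfolding i_def by blast+
  define b where "b v u = a v u + (- ch (a v)) * i u" for v u
  have b: "b v \<in> cfun X" "ch (b v) = 0" "b v v \<noteq> 0" if v: "v \<in> topspace X" for v
  proof -
    note av = conjunct1[OF a[OF v]]
    have s: "(\<lambda>u. (- ch (a v)) * i u) \<in> cfun X" by (rule cfun_scale) (rule i)
    show "b v \<in> cfun X" unfolding b_def by (rule cfun_add[OF av s])
    show "ch (b v) = 0" unfolding b_def add[OF av s] scale[OF i(1)] using i(2) by simp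
    show "b v v \<noteq> 0" using conjunct2[OF a[OF v]] v by (auto simp: b_def i_def)
  qed
  define \<U> where "\<U> = (\<lambda>v. {u \<in> topspace X. b v u \<noteq> 0}) ` topspace X"
  have "compactin X (topspace X)" using X by (simp add: compact_space_def)
  moreover have "openin X U" if "U \<in> \<U>" for U
    using that openin_nonzero b(1) by (auto simp: \<U>_def)
  moreover have "topspace X \<subseteq> \<Union>\<U>" using b(3) by (auto simp: \<U>_def)
  ultimately obtain \<F> where F: "finite \<F>" "\<F> \<subseteq> \<U>" "topspace X \<subseteq> \<Union>\<F>"
    using compactinD by metis
  then obtain V where V: "finite V" "V \<subseteq> topspace X" "\<F> = (\<lambda>v. {u \<in> topspace X. b v u \<noteq> 0}) ` V"
    unfolding \<U>_def by (meson finite_subset_image)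
  have g: "(\<lambda>u. \<Sum>v\<in>V. cnj (b v u) * b v u) \<in> cfun X \<and> ch (\<lambda>u. \<Sum>v\<in>V. cnj (b v u) * b v u) = 0"
    using V(1,2)
  proof (induction V rule: finite_induct)
    case empty
    have "ch (\<lambda>u. 0 * i u) = 0" using scale[OF i(1), of 0] by simp
    then show ?case by (simp add: cfun_def)
  next
    case (insert v V)
    have v: "v \<in> topspace X" using insert by simp
    note bc = cfun_cnj[OF b(1)[OF v]]
    have m: "(\<lambda>u. cnj (b v u) * b v u) \<in> cfun X" "ch (\<lambda>u. cnj (b v u) * b v u) = 0"
      using cfun_mult[OF bc b(1)[OF v]] mult[OF bc b(1)[OF v]] b(2)[OF v] by simp_all
    have IH: "(\<lambda>u. \<Sum>v\<in>V. cnj (b v u) * b v u) \<in> cfun X" "ch (\<lambda>u. \<Sum>v\<in>V. cnj (b v u) * b v u) = 0"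
      using insert by auto
    show ?case
      using cfun_add[OF m(1) IH(1)] add[OF m(1) IH(1)] m(2) IH(2) insert(1,2) by simp
  qed
  define g where "g u = (\<Sum>v\<in>V. cnj (b v u) * b v u)" for u
  have g: "g \<in> cfun X" "ch g = 0" using g unfolding g_def by blast+
  have nz: "g u \<noteq> 0" if u: "u \<in> topspace X" for u
  proof -
    obtain v where v: "v \<in> V" "b v u \<noteq> 0" using F(3) u V(3) by blast
    have "g u = complex_of_real (\<Sum>v\<in>V. (cmod (b v u))\<^sup>2)"
      unfolding g_def of_real_sum by (rule sum.cong) (simp_all only: complex_norm_square
          mult.commute)
    moreover have "0 < (\<Sum>v\<in>V. (cmod (b v u))\<^sup>2)"
      using V(1) v by (intro sum_pos2[of V v]) auto
    ultimately show ?thesis by (metis less_irrefl of_real_eq_0_iff)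
  qed
  \<comment> \<open>Outside the space \<open>g\<close> is 0 and \<open>inverse 0 = 0\<close>, so the
    inverse again obeys the convention of vanishing there.\<close>
  have "(\<lambda>u. inverse (g u)) \<in> cfun X"
  proof (rule cfunI)
    show "continuous_map X euclidean (\<lambda>u. inverse (g u))"
      using cfunD(1)[OF g(1)] nz by (simp add: continuous_map_atin tendsto_inverse)
  qed (simp add: cfunD(2)[OF g(1)])
  then have "ch (\<lambda>u. g u * inverse (g u)) = 0" using mult[OF g(1)] g(2) by simp
  moreover have "(\<lambda>u. g u * inverse (g u)) = i"
    using nz cfunD(2)[OF g(1)] by (auto simp: i_def)
  ultimately show False using i(2) by simp
qed

text \<open>Gelfand duality: evaluation of \<open>\<Theta>\<close> at \<open>w\<close> is a
  character, hence evaluation at a point, which is taken as \<open>\<phi> w\<close>. Bump functions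
  reduce continuity of \<open>\<phi>\<close> to openness of the sets where \<open>\<Theta> a\<close>
  does not vanish.\<close>

lemma algebra_iso_point_map:
  fixes \<Theta> :: "('v \<Rightarrow> complex) \<Rightarrow> 'w \<Rightarrow> complex"
  assumes X: "compact_space X" "Hausdorff_space X"
    and bij: "bij_betw \<Theta> (cfun X) (cfun Y)"
    and add: "\<And>a b. a \<in> cfun X \<Longrightarrow> b \<in> cfun X \<Longrightarrow> \<Theta> (\<lambda>v. a v + b v) = (\<lambda>w. \<Theta> a w + \<Theta> b w)"
    and mult: "\<And>a b. a \<in> cfun X \<Longrightarrow> b \<in> cfun X \<Longrightarrow> \<Theta> (\<lambda>v. a v * b v) = (\<lambda>w. \<Theta> a w * \<Theta> b w)"
    and scale: "\<And>c a. a \<in> cfun X \<Longrightarrow> \<Theta> (\<lambda>v. c * a v) = (\<lambda>w. c * \<Theta> a w)"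
  obtains \<phi> where "continuous_map Y X \<phi>" "\<And>a w. a \<in> cfun X \<Longrightarrow> w \<in> topspace Y \<Longrightarrow> \<Theta> a w = a (\<phi> w)"
proof -
  let ?i = "\<lambda>v. if v \<in> topspace X then 1 else 0 :: complex"
  have \<Theta>c: "\<Theta> a \<in> cfun Y" if "a \<in> cfun X" for a using bij that by (auto simp: bij_betw_def)
  have one: "\<Theta> ?i w = 1" if w: "w \<in> topspace Y" for w
  proof -
    \<comment> \<open>Unitality is not assumed; it comes from surjectivity, by multiplying the unit
      with a preimage of the unit of the target.\<close>
    obtain a where a: "a \<in> cfun X" "\<Theta> a = (\<lambda>w. if w \<in> topspace Y then 1 else 0)"
      using bij cfun_one[of Y] unfolding bij_betw_def by (metis imageE)
    have "(\<lambda>v. ?i v * a v) = a" using cfunD(2)[OF a(1)] by auto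
    then have "\<Theta> a w = \<Theta> ?i w * \<Theta> a w" using mult[OF cfun_one a(1)] by metis
    then show ?thesis using a(2) w by simp
  qed
  have "\<exists>v \<in> topspace X. \<forall>a \<in> cfun X. \<Theta> a w = a v" if w: "w \<in> topspace Y" for w
    by (rule character_is_evaluation[OF X(1), of "\<lambda>a. \<Theta> a w"]) (simp_all add: add mult scale
        one[OF w])
  then obtain \<phi> where \<phi>: "\<And>w. w \<in> topspace Y \<Longrightarrow> \<phi> w \<in> topspace X"
      "\<And>w a. w \<in> topspace Y \<Longrightarrow> a \<in> cfun X \<Longrightarrow> \<Theta> a w = a (\<phi> w)"
    by metis
  have "continuous_map Y X \<phi>"
    unfolding continuous_map
  proof (intro conjI allI impI)
    show "\<phi> ` topspace Y \<subseteq> topspace X" using \<phi>(1) by auto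
    fix U assume U: "openin X U"
    show "openin Y {w \<in> topspace Y. \<phi> w \<in> U}"
    proof (subst openin_subopen, intro ballI)
      fix w assume w: "w \<in> {w \<in> topspace Y. \<phi> w \<in> U}"
      then obtain a where a: "a \<in> cfun X" "a (\<phi> w) = 1" "\<And>q. q \<notin> U \<Longrightarrow> a q = 0"
        using cfun_bump[OF X U, of "\<phi> w"] by blast
      have "{w \<in> topspace Y. \<Theta> a w \<noteq> 0} \<subseteq> {w \<in> topspace Y. \<phi> w \<in> U}"
        using \<phi>(2)[OF _ a(1)] a(3) by force
      moreover have "w \<in> {w \<in> topspace Y. \<Theta> a w \<noteq> 0}" using w \<phi>(2)[OF _ a(1)] a(2) by simp
      ultimately show "\<exists>T. openin Y T \<and> w \<in> T \<and> T \<subseteq> {w \<in> topspace Y. \<phi> w \<in> U}"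
        using openin_nonzero[OF \<Theta>c[OF a(1)]] by blast
    qed
  qed
  then show thesis using that \<phi>(2) by blast
qed

section \<open>Matching germs of edges\<close>

text \<open>The key of an edge \<open>e\<close> encodes the germ at \<open>s e\<close> of the map \<open>r \<circ> s\<^sup>-\<^sup>1\<close>, where \<open>s\<^sup>-\<^sup>1\<close> is
  the local inverse of \<open>s\<close> through \<open>e\<close>.\<close>

definition germ_key :: "'e topology \<Rightarrow> ('e \<Rightarrow> 'v) \<Rightarrow> ('e \<Rightarrow> 'v) \<Rightarrow> 'e \<Rightarrow> ('v \<Rightarrow> 'v) set" where
  "germ_key X s r e = {h. \<exists>Z. openin X Z \<and> e \<in> Z \<and> (\<forall>e' \<in> Z. h (s e') = r e')}"

text \<open>One common representative \<open>h\<close> makes two keys equal: \<open>h'\<close>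
  agrees with \<open>h\<close> on the sources of a neighbourhood of \<open>e\<close>, this set is
  open, and its preimage under \<open>s'\<close> is a neighbourhood of \<open>f\<close>. Total
  functions as representatives make edges of different graphs comparable.\<close>

lemma germ_key_subset:
  assumes "h \<in> germ_key X s r e" "h \<in> germ_key Y s' r' f" "h' \<in> germ_key X s r e" "s e = s' f"
    and op: "\<And>Z. openin X Z \<Longrightarrow> openin V (s ` Z)" and s': "continuous_map Y V s'"
  shows "h' \<in> germ_key Y s' r' f"
proof -
  obtain Z where Z: "openin X Z" "e \<in> Z" "\<And>e'. e' \<in> Z \<Longrightarrow> h (s e') = r e'"
    using assms(1) by (auto simp: germ_key_def)
  obtain Z' where Z': "openin X Z'" "e \<in> Z'" "\<And>e'. e' \<in> Z' \<Longrightarrow> h' (s e') = r e'"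
    using assms(3) by (auto simp: germ_key_def)
  obtain Y1 where Y1: "openin Y Y1" "f \<in> Y1" "\<And>f'. f' \<in> Y1 \<Longrightarrow> h (s' f') = r' f'"
    using assms(2) by (auto simp: germ_key_def)
  let ?W = "s ` (Z \<inter> Z')"
  have "openin Y (Y1 \<inter> {f' \<in> topspace Y. s' f' \<in> ?W})"
    using Y1(1) openin_continuous_map_preimage[OF s' op[OF openin_Int[OF Z(1) Z'(1)]]] by blast
  moreover have "f \<in> Y1 \<inter> {f' \<in> topspace Y. s' f' \<in> ?W}"
    using Y1(1,2) openin_subset[OF Y1(1)] Z(2) Z'(2) assms(4) by force
  moreover have "h' (s' f') = r' f'" if f': "f' \<in> Y1 \<inter> {f' \<in> topspace Y. s' f' \<in> ?W}" for f'
  proof -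
    obtain e' where e': "e' \<in> Z" "e' \<in> Z'" "s' f' = s e'" using f' by blast
    then show ?thesis using Z(3)[OF e'(1)] Z'(3)[OF e'(2)] Y1(3)[of f'] f' by simp
  qed
  ultimately show ?thesis unfolding germ_key_def by blast
qed

abbreviation (in compact_graph) "key \<equiv> germ_key (edges E) (src E) (rng E)"

text \<open>Provides a representative: keys of edges are nonempty, so equality of keys really
  compares germs.\<close>

lemma (in compact_graph) germ_key_chart:
  assumes e: "e \<in> Es"
  obtains Z h where "openin (edges E) Z" "e \<in> Z" "inj_on (src E) Z"
      "\<And>e'. e' \<in> Z \<Longrightarrow> h (src E e') = rng E e'"
    "h \<in> key e"
proof -
  obtain U g where U: "openin (edges E) U" "e \<in> U"
    "homeomorphic_maps (subtopology (edges E) U) (subtopology (verts E) (src E ` U)) (src E) g"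
    using src_chart[OF e] by metis
  have g: "g (src E e') = e'" if "e' \<in> U" for e'
    using U(3) that openin_subset[OF U(1)] by (auto simp: homeomorphic_maps_def)
  have "inj_on (src E) U" by (rule inj_on_inverseI[of _ g]) (rule g)
  moreover have h: "(rng E \<circ> g) (src E e') = rng E e'" if "e' \<in> U" for e' using g[OF that] by simp
  moreover have "rng E \<circ> g \<in> key e"
    unfolding germ_key_def using U(1,2) h by blast
  ultimately show thesis using that[of U "rng E \<circ> g"] U(1,2) by blast
qed

text \<open>Injections chosen class by class combine, because images of different classes are told
  apart by \<open>q\<close>.\<close>

lemma ex_inj_on_fibres:
  assumes fin: "finite A" "finite B"
    and le: "\<And>k. card {x \<in> A. p x = k} \<le> card {y \<in> B. q y = k}"
  shows "\<exists>\<sigma>. inj_on \<sigma> A \<and> \<sigma> ` A \<subseteq> B \<and> (\<forall>x \<in> A. q (\<sigma> x) = p x)"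
proof -
  have "\<forall>k. \<exists>\<sigma>. \<sigma> ` {x \<in> A. p x = k} \<subseteq> {y \<in> B. q y = k} \<and> inj_on \<sigma> {x \<in> A. p x = k}"
    using card_le_inj[OF _ _ le] fin by simp
  from choice[OF this] obtain \<sigma> where \<sigma>: "\<And>k. \<sigma> k ` {x \<in> A. p x = k} \<subseteq> {y \<in> B. q y = k}"
      "\<And>k. inj_on (\<sigma> k) {x \<in> A. p x = k}"
    by blast
  define \<tau> where "\<tau> x = \<sigma> (p x) x" for x
  have \<tau>: "\<tau> x \<in> B" "q (\<tau> x) = p x" if "x \<in> A" for x
    using \<sigma>(1)[of "p x"] that by (auto simp: \<tau>_def)
  have "inj_on \<tau> A"
  proof (rule inj_onI)
    fix x y assume xy: "x \<in> A" "y \<in> A" "\<tau> x = \<tau> y"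
    then have "p x = p y" using \<tau>(2) by metis
    then show "x = y" using \<sigma>(2)[of "p x"] xy by (auto simp: \<tau>_def inj_on_def)
  qed
  then show ?thesis using \<tau> by (intro exI[of _ \<tau>]) auto
qed

text \<open>What the counting of edges needs from an isomorphism of triples, in one direction, so
  that it can be used for the isomorphism and for its inverse. The vertex map runs from
  \<open>F\<close> to \<open>E\<close> because functions on the vertices of \<open>E\<close> are
  pulled back along it.\<close>

locale transported_rep = E: compact_graph E + F: graph_toeplitz_algebra F T \<iota>X \<iota>A \<gamma>
  for E :: "('v, 'e) topological_graph" and F :: "('w, 'f) topological_graph"
    and T :: "'t star_algebra" and \<iota>X \<iota>A \<gamma> +
  fixes \<psi> :: "('e \<Rightarrow> complex) \<Rightarrow> 't" and \<pi> :: "('v \<Rightarrow> complex) \<Rightarrow> 't" and \<phi> :: "'w \<Rightarrow> 'v"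
  assumes rep: "toeplitz_rep (cfun_algebra (verts E)) (graph_correspondence E) T \<psi> \<pi>"
    and degree: "x \<in> E.CE \<Longrightarrow> F.degree_one (\<psi> x)"
    and \<phi>: "homeomorphic_map (verts F) (verts E) \<phi>"
    and \<pi>: "a \<in> E.CV \<Longrightarrow> \<exists>b \<in> F.CV. \<pi> a = \<iota>A b \<and> (\<forall>w \<in> F.Vs. b w = a (\<phi> w))"
begin

definition u :: "('e \<Rightarrow> complex) \<Rightarrow> 'f \<Rightarrow> complex" where
  "u x = F.coeff (\<psi> x)"

lemma \<psi>_carrier: "x \<in> E.CE \<Longrightarrow> \<psi> x \<in> carrier T"
  using degree by (simp add: F.degree_one_def)

lemma \<phi>_verts: "w \<in> F.Vs \<Longrightarrow> \<phi> w \<in> E.Vs"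
  using \<phi> homeomorphic_imp_surjective_map by blast

lemma u_cfun: "x \<in> E.CE \<Longrightarrow> u x \<in> F.CE"
  unfolding u_def by (rule F.coeff_cfun[OF \<psi>_carrier])

lemma u_add: "x \<in> E.CE \<Longrightarrow> y \<in> E.CE \<Longrightarrow> u (\<lambda>e. x e + y e) f = u x f + u y f"
  using rep by (simp add: u_def toeplitz_rep_def linear_map_def F.coeff_add \<psi>_carrier)

lemma u_scale: "x \<in> E.CE \<Longrightarrow> u (\<lambda>e. c * x e) f = c * u x f"
  using rep by (simp add: u_def toeplitz_rep_def linear_map_def F.coeff_smult \<psi>_carrier)

lemma u_sum:
  assumes "finite I" and x: "\<And>i. i \<in> I \<Longrightarrow> x i \<in> E.CE"
  shows "(\<lambda>e. \<Sum>i\<in>I. c i * x i e) \<in> E.CE"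
    "u (\<lambda>e. \<Sum>i\<in>I. c i * x i e) f = (\<Sum>i\<in>I. c i * u (x i) f)"
proof -
  have "(\<lambda>e. \<Sum>i\<in>I. c i * x i e) \<in> E.CE \<and>
    u (\<lambda>e. \<Sum>i\<in>I. c i * x i e) f = (\<Sum>i\<in>I. c i * u (x i) f)"
    using assms
  proof (induction I rule: finite_induct)
    case empty
    have "(\<lambda>_. 0) \<in> E.CE" by (simp add: cfun_def)
    then show ?case using u_scale[of "\<lambda>_. 0" 0 f] by simp
  next
    case (insert j I)
    then have "(\<lambda>e. c j * x j e) \<in> E.CE" by (simp add: cfun_scale)
    then show ?case using insert by (simp add: cfun_add u_add u_scale)
  qed
  then show "(\<lambda>e. \<Sum>i\<in>I. c i * x i e) \<in> E.CE"
    "u (\<lambda>e. \<Sum>i\<in>I. c i * x i e) f = (\<Sum>i\<in>I. c i * u (x i) f)" by blast+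
qed

lemma u_norm:
  assumes x: "x \<in> E.CE" and w: "w \<in> F.Vs"
  shows "(\<Sum>f\<in>fibre F w. (cmod (u x f))\<^sup>2) = (\<Sum>e\<in>fibre E (\<phi> w). (cmod (x e))\<^sup>2)"
proof -
  let ?p = "\<lambda>v. \<Sum>e\<in>fibre E v. cnj (x e) * x e"
  obtain b where b: "b \<in> F.CV" "\<pi> ?p = \<iota>A b" "b w = ?p (\<phi> w)"
    using \<pi>[OF E.inprod_cfun[OF x x]] w by blast
  have "adj T (\<psi> x) \<otimes>\<^bsub>T\<^esub> \<psi> x = \<iota>A b"
    using rep x b(2) by (simp add: toeplitz_rep_def)
  then have "(\<Sum>f\<in>fibre F w. (cmod (u x f))\<^sup>2) = Re (?p (\<phi> w))"
    unfolding u_def using F.coeff_norm[OF degree[OF x] b(1) _ w] b(3) by simp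
  also have "\<dots> = (\<Sum>e\<in>fibre E (\<phi> w). (cmod (x e))\<^sup>2)"
    unfolding Re_sum cmod_power2 by (simp add: power2_eq_square)
  finally show ?thesis .
qed

lemma u_lact:
  assumes a: "a \<in> E.CV" and x: "x \<in> E.CE" and f: "f \<in> F.Es"
  shows "u (\<lambda>e. a (rng E e) * x e) f = a (\<phi> (rng F f)) * u x f"
proof -
  obtain b where b: "b \<in> F.CV" "\<pi> a = \<iota>A b" "\<forall>w \<in> F.Vs. b w = a (\<phi> w)"
    using \<pi>[OF a] by blast
  have "\<psi> (\<lambda>e. a (rng E e) * x e) = \<iota>A b \<otimes>\<^bsub>T\<^esub> \<psi> x"
    using rep a x b(2) by (simp add: toeplitz_rep_def)
  then show ?thesis
    unfolding u_def using F.coeff_\<iota>A_mult[OF b(1) \<psi>_carrier[OF x]] b(3) F.rng_in_verts[OF f] by simp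
qed

text \<open>Otherwise a function \<open>a\<close> that is 1 at \<open>\<phi> (rng F f)\<close> and 0
  at the finitely many ranges of edges in the fibre with \<open>x e\<close> nonzero makes the left
  multiple of \<open>x\<close> by \<open>a\<close> vanish on that fibre. By \<open>u_norm\<close>
  its image vanishes at \<open>f\<close>, but by \<open>u_lact\<close> the value there is
  \<open>u x f\<close>.\<close>

lemma rng_match:
  assumes x: "x \<in> E.CE" and f: "f \<in> F.Es" and nz: "u x f \<noteq> 0"
  shows "\<exists>e \<in> fibre E (\<phi> (src F f)). x e \<noteq> 0 \<and> rng E e = \<phi> (rng F f)"
proof (rule ccontr)
  assume no: "\<not> ?thesis"
  let ?R = "rng E ` {e \<in> fibre E (\<phi> (src F f)). x e \<noteq> 0}"
  have s: "src F f \<in> F.Vs" using f F.src_in_verts by blast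
  have "finite ?R" using E.finite_fibre by simp
  moreover have "?R \<subseteq> E.Vs"
    using E.rng_in_verts by (auto simp: fibre_def)
  ultimately have "closedin (verts E) ?R"
    using E.verts_space(2) Hausdorff_imp_t1_space t1_space_closedin_finite by blast
  then have U: "openin (verts E) (E.Vs - ?R)" by blast
  have p: "\<phi> (rng F f) \<in> E.Vs - ?R"
    using no \<phi>_verts[OF F.rng_in_verts[OF f]] by force
  obtain a where a: "a \<in> E.CV" "a (\<phi> (rng F f)) = 1"
      "\<And>q. q \<notin> E.Vs - ?R \<Longrightarrow> a q = 0"
    using cfun_bump[OF E.verts_space U p] by blast
  let ?y = "\<lambda>e. a (rng E e) * x e"
  have y: "?y \<in> E.CE" by (rule E.cfun_lact[OF a(1) x])
  have "?y e = 0" if "e \<in> fibre E (\<phi> (src F f))" for e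
    using a(3)[of "rng E e"] that by (cases "x e = 0") auto
  then have "(\<Sum>g\<in>fibre F (src F f). (cmod (u ?y g))\<^sup>2) = 0"
    unfolding u_norm[OF y s] by (intro sum.neutral ballI) simp
  moreover have "f \<in> fibre F (src F f)" using f by (simp add: fibre_def)
  ultimately have "u ?y f = 0"
    using F.finite_fibre by (simp add: sum_nonneg_eq_0_iff)
  then show False using u_lact[OF a(1) x f] a(2) nz by simp
qed

abbreviation "keyF \<equiv> germ_key (edges F) (\<phi> \<circ> src F) (\<phi> \<circ> rng F)"

text \<open>\<open>u x\<close> is nonzero on a neighbourhood of \<open>f\<close>, and there
  \<open>rng_match\<close> finds at each edge a partner in the support of \<open>x\<close>, hence in
  \<open>Z\<close>, where the range is \<open>h\<close> of the source. So \<open>h\<close>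
  represents the germ at \<open>f\<close> as well as at \<open>e\<close>.\<close>

lemma key_match:
  assumes e: "e \<in> fibre E (\<phi> w)" and f: "f \<in> fibre F w"
    and Z: "openin (edges E) Z" "e \<in> Z" "\<And>e'. e' \<in> Z \<Longrightarrow> h (src E e') = rng E e'"
    and x: "x \<in> E.CE" "\<And>e'. e' \<notin> Z \<Longrightarrow> x e' = 0" and nz: "u x f \<noteq> 0"
  shows "keyF f = E.key e"
proof -
  have he: "h \<in> E.key e" unfolding germ_key_def using Z by blast
  have ftop: "f \<in> F.Es" and eq: "src E e = (\<phi> \<circ> src F) f" using e f by (auto simp: fibre_def)
  have hf: "h \<in> keyF f"
  proof -
    let ?Y = "{f' \<in> F.Es. u x f' \<noteq> 0}"
    have "openin (edges F) ?Y" by (rule openin_nonzero[OF u_cfun[OF x(1)]])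
    moreover have "f \<in> ?Y" using ftop nz by simp
    moreover have "h ((\<phi> \<circ> src F) f') = (\<phi> \<circ> rng F) f'" if f': "f' \<in> ?Y" for f'
    proof -
      obtain e' where e': "e' \<in> fibre E (\<phi> (src F f'))" "x e' \<noteq> 0" "rng E e' = \<phi> (rng F f')"
        using rng_match[OF x(1), of f'] f' by blast
      then have "e' \<in> Z" using x(2) by blast
      moreover have "src E e' = \<phi> (src F f')" using e'(1) by (simp add: fibre_def)
      ultimately show ?thesis using Z(3)[of e'] e'(3) by simp
    qed
    ultimately show ?thesis unfolding germ_key_def by blast
  qed
  have cont: "continuous_map (edges F) (verts E) (\<phi> \<circ> src F)"
    using F.continuous_src \<phi> homeomorphic_imp_continuous_map continuous_map_compose by blast
  have op: "openin (verts E) ((\<phi> \<circ> src F) ` Y)" if "openin (edges F) Y" for Y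
    using homeomorphic_imp_open_map[OF \<phi>] F.openin_src_image[OF that]
    unfolding open_map_def image_comp[symmetric] by blast
  show ?thesis
  proof
    show "E.key e \<subseteq> keyF f"
      using germ_key_subset[OF he hf _ eq E.openin_src_image cont] by blast
    show "keyF f \<subseteq> E.key e"
      using germ_key_subset[OF hf he _ eq[symmetric] op E.continuous_src] by blast
  qed
qed

text \<open>The vectors \<open>u (x e)\<close> are orthonormal on the fibre of \<open>F\<close> and those for edges \<open>e\<close> with key
  \<open>k\<close> are supported on the edges of \<open>F\<close> with key \<open>k\<close>; Bessel's inequality then bounds their
  number.\<close>

lemma card_key_le:
  assumes w: "w \<in> F.Vs"
  shows "card {e \<in> fibre E (\<phi> w). E.key e = k} \<le> card {f \<in> fibre F w. keyF f = k}"
proof -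
  define I where "I = {e \<in> fibre E (\<phi> w). E.key e = k}"
  define J where "J = {f \<in> fibre F w. keyF f = k}"
  have fin: "finite I" "finite J" using E.finite_fibre F.finite_fibre by (auto simp: I_def J_def)
  have Isub: "I \<subseteq> fibre E (\<phi> w)" by (auto simp: I_def)
  have "\<forall>e \<in> I. \<exists>x. x \<in> E.CE \<and> (\<forall>e' \<in> fibre E (\<phi> w). x e' = (if e' = e then 1 else 0)) \<and>
      (\<forall>f \<in> fibre F w. u x f \<noteq> 0 \<longrightarrow> keyF f = k)"
  proof
    fix e assume e: "e \<in> I"
    then have et: "e \<in> E.Es" "e \<in> fibre E (\<phi> w)" by (auto simp: I_def fibre_def)
    obtain Z h where Z: "openin (edges E) Z" "e \<in> Z" "inj_on (src E) Z"
        "\<And>e'. e' \<in> Z \<Longrightarrow> h (src E e') = rng E e'" "h \<in> E.key e"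
      using E.germ_key_chart[OF et(1)] by blast
    \<comment> \<open>As the source map is injective on \<open>Z\<close>, a bump supported there
      vanishes at the other edges of the fibre: on the fibre it is the unit vector at
      \<open>e\<close>.\<close>
    obtain x where x: "x \<in> E.CE" "x e = 1" "\<And>e'. e' \<notin> Z \<Longrightarrow> x e' = 0"
      using cfun_bump[OF E.edges_space Z(1,2)] by blast
    have "x e' = (if e' = e then 1 else 0)" if e': "e' \<in> fibre E (\<phi> w)" for e'
    proof (cases "e' \<in> Z")
      case True
      then have "e' = e" using Z(2,3) e' et(2) by (auto simp: fibre_def inj_on_def)
      then show ?thesis using x(2) by simp
    next
      case False
      then show ?thesis using x(3) Z(2) by auto
    qed
    moreover have "keyF f = k" if "f \<in> fibre F w" "u x f \<noteq> 0" for f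
      using key_match[OF et(2) that(1) Z(1,2,4) x(1,3) that(2)] e by (simp add: I_def)
    ultimately show "\<exists>x. x \<in> E.CE \<and> (\<forall>e' \<in> fibre E (\<phi> w). x e' = (if e' = e then 1 else 0)) \<and>
      (\<forall>f \<in> fibre F w. u x f \<noteq> 0 \<longrightarrow> keyF f = k)"
      using x(1) by blast
  qed
  then obtain x where x: "\<And>e. e \<in> I \<Longrightarrow> x e \<in> E.CE"
    "\<And>e e'. e \<in> I \<Longrightarrow> e' \<in> fibre E (\<phi> w) \<Longrightarrow> x e e' = (if e' = e then 1 else 0)"
    "\<And>e f. e \<in> I \<Longrightarrow> f \<in> fibre F w \<Longrightarrow> u (x e) f \<noteq> 0 \<Longrightarrow> keyF f = k"
    by metis
  have unit: "(\<Sum>f\<in>J. (cmod (u (x e) f))\<^sup>2) = 1" if e: "e \<in> I" for e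
  proof -
    have "(\<Sum>f\<in>J. (cmod (u (x e) f))\<^sup>2) = (\<Sum>f\<in>fibre F w. (cmod (u (x e) f))\<^sup>2)"
      using x(3)[OF e] F.finite_fibre by (intro sum.mono_neutral_left) (auto simp: J_def)
    also have "\<dots> = (\<Sum>e'\<in>fibre E (\<phi> w). (cmod (x e e'))\<^sup>2)" by (rule u_norm[OF x(1)[OF e] w])
    also have "\<dots> = (\<Sum>e'\<in>fibre E (\<phi> w). if e' = e then 1 else 0)"
      using x(2)[OF e] by (intro sum.cong) auto
    also have "\<dots> = 1" using e Isub E.finite_fibre by auto
    finally show ?thesis .
  qed
  have bessel: "(\<Sum>e\<in>I. (cmod (u (x e) f))\<^sup>2) \<le> 1" if f: "f \<in> J" for f
  proof -
    define B where "B = (\<Sum>e\<in>I. (cmod (u (x e) f))\<^sup>2)"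
    \<comment> \<open>The test vector of Bessel's inequality: \<open>u y f\<close> is
      \<open>B\<close>, while the square norm of \<open>y\<close> on the fibre is also
      \<open>B\<close>, so B * B \<le> B.\<close>
    define y where "y = (\<lambda>e'. \<Sum>e\<in>I. cnj (u (x e) f) * x e e')"
    have y: "y \<in> E.CE" unfolding y_def by (rule u_sum(1)[OF fin(1) x(1)])
    have "u y f = (\<Sum>e\<in>I. cnj (u (x e) f) * u (x e) f)"
      unfolding y_def by (rule u_sum(2)[OF fin(1) x(1)])
    also have "\<dots> = complex_of_real B"
      unfolding B_def of_real_sum by (rule sum.cong) (simp_all only: complex_norm_square
          mult.commute)
    finally have uy: "u y f = complex_of_real B" .
    have B0: "0 \<le> B" by (simp add: B_def sum_nonneg)
    have ye: "y e' = (if e' \<in> I then cnj (u (x e') f) else 0)" if e': "e' \<in> fibre E (\<phi> w)" for e'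
    proof -
      have "y e' = (\<Sum>e\<in>I. if e = e' then cnj (u (x e) f) else 0)"
        unfolding y_def using x(2)[OF _ e'] by (intro sum.cong) auto
      then show ?thesis using fin(1) by simp
    qed
    have "B\<^sup>2 = (cmod (u y f))\<^sup>2" using uy by simp
    also have "\<dots> \<le> (\<Sum>g\<in>fibre F w. (cmod (u y g))\<^sup>2)"
      using f F.finite_fibre by (intro member_le_sum) (auto simp: J_def)
    also have "\<dots> = (\<Sum>e'\<in>fibre E (\<phi> w). (cmod (y e'))\<^sup>2)" by (rule u_norm[OF y w])
    also have "\<dots> = (\<Sum>e'\<in>I. (cmod (y e'))\<^sup>2)"
      using Isub E.finite_fibre ye by (intro sum.mono_neutral_right) auto
    also have "\<dots> = B" unfolding B_def using Isub ye by (intro sum.cong) auto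
    finally have "B * B \<le> 1 * B" by (simp add: power2_eq_square)
    then have "B \<le> 1" using B0 by (cases "B = 0") auto
    then show ?thesis by (simp add: B_def)
  qed
  \<comment> \<open>Double counting of the matrix of squares: each row over \<open>J\<close> sums to
    1 by \<open>unit\<close>, each column over \<open>I\<close> to at most 1 by
    \<open>bessel\<close>.\<close>
  have "real (card I) = (\<Sum>e\<in>I. \<Sum>f\<in>J. (cmod (u (x e) f))\<^sup>2)" using unit by simp
  also have "\<dots> = (\<Sum>f\<in>J. \<Sum>e\<in>I. (cmod (u (x e) f))\<^sup>2)" by (rule sum.swap)
  also have "\<dots> \<le> (\<Sum>f\<in>J. 1)" by (rule sum_mono) (rule bessel)
  finally show ?thesis by (simp add: I_def J_def)
qed

lemma fibre_injection:
  assumes "w \<in> F.Vs"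
  shows "\<exists>\<sigma>. inj_on \<sigma> (fibre E (\<phi> w)) \<and> \<sigma> ` fibre E (\<phi> w) \<subseteq> fibre F w \<and>
    (\<forall>e \<in> fibre E (\<phi> w). keyF (\<sigma> e) = E.key e)"
  by (rule ex_inj_on_fibres[OF E.finite_fibre F.finite_fibre card_key_le[OF assms]])

end

section \<open>Gluing local isomorphisms\<close>

text \<open>In a compact Hausdorff space, two closed sets that no connected set meets simultaneously
  are separated by a clopen set. Here these are the point and the complement of \<open>V\<close>,
  and connected sets have at most one point.\<close>

lemma ex_clopen_neighbourhood:
  assumes X: "compact_space X" "Hausdorff_space X" and td: "totally_disconnected_space X"
    and V: "openin X V" "v \<in> V"
  obtains U where "openin X U" "closedin X U" "v \<in> U" "U \<subseteq> V"
proof -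
  have v: "v \<in> topspace X" using V openin_subset by blast
  have "separated_between X {v} (topspace X - V)"
  proof (rule cut_wire_fence_theorem[OF X])
    show "closedin X {v}" using closedin_Hausdorff_singleton X(2) v by metis
    show "closedin X (topspace X - V)" using V by blast
    fix C assume "connectedin X C"
    then obtain a where "C \<subseteq> {a}" using td unfolding totally_disconnected_space_def by blast
    then show "disjnt C {v} \<or> disjnt C (topspace X - V)"
      using V by (cases "a = v") (auto simp: disjnt_iff)
  qed
  then obtain U W where U: "openin X U" "openin X W" "U \<union> W = topspace X" "disjnt U W" "{v} \<subseteq> U"
      "topspace X - V \<subseteq> W"
    unfolding separated_between_def by metis
  have "U = topspace X - W" using U(3,4) by (auto simp: disjnt_iff)
  then have "closedin X U" using U(2) by blast
  moreover have "U \<subseteq> V" using U(4,6) openin_subset[OF U(1)] by (auto simp: disjnt_iff)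
  ultimately show thesis using that U(1,5) by blast
qed

text \<open>The matching is given at each vertex separately, with no continuity in the vertex; all
  continuity has to come from the germs.\<close>

locale graph_gluing = E: compact_graph E + F: compact_graph F
  for E :: "('v, 'e) topological_graph" and F :: "('w, 'f) topological_graph" +
  fixes \<phi> :: "'w \<Rightarrow> 'v" and \<kappa> :: "'v \<Rightarrow> 'w"
  assumes homeo: "homeomorphic_maps (verts E) (verts F) \<kappa> \<phi>"
    and disconnected: "totally_disconnected_space (verts E)"
    and matching: "v \<in> E.Vs \<Longrightarrow> \<exists>\<sigma>. bij_betw \<sigma> (fibre E v) (fibre F (\<kappa> v)) \<and>
      (\<forall>e \<in> fibre E v. germ_key (edges F) (\<phi> \<circ> src F) (\<phi> \<circ> rng F) (\<sigma> e)
        = E.key e)"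
begin

definition over :: "'v set \<Rightarrow> 'e set" where
  "over V = {e \<in> E.Es. src E e \<in> V}"

text \<open>Compatibility with the source maps is contained in the bijections between
  fibres.\<close>

definition partial_iso :: "'v set \<Rightarrow> ('e \<Rightarrow> 'f) \<Rightarrow> bool" where
  "partial_iso V g \<longleftrightarrow> continuous_map (subtopology (edges E) (over V)) (edges F) g \<and>
     (\<forall>v \<in> V. bij_betw g (fibre E v) (fibre F (\<kappa> v))) \<and>
     (\<forall>e \<in> over V. rng F (g e) = \<kappa> (rng E e))"

lemma openin_over: "openin (verts E) V \<Longrightarrow> openin (edges E) (over V)"
  unfolding over_def by (rule openin_continuous_map_preimage[OF E.continuous_src])

lemma partial_iso_mono:
  assumes "partial_iso V g" "V' \<subseteq> V" shows "partial_iso V' g"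
proof -
  have "over V' \<subseteq> over V" using assms(2) by (auto simp: over_def)
  then show ?thesis
    using assms continuous_map_from_subtopology_mono unfolding partial_iso_def by blast
qed

lemma partial_iso_Un:
  assumes g1: "partial_iso V1 g1" and g2: "partial_iso V2 g2" and disj: "V1 \<inter> V2 = {}"
    and op: "openin (verts E) V1" "openin (verts E) V2"
  shows "partial_iso (V1 \<union> V2) (\<lambda>e. if src E e \<in> V1 then g1 e else g2 e)"
proof -
  let ?g = "\<lambda>e. if src E e \<in> V1 then g1 e else g2 e"
  let ?X = "subtopology (edges E) (over (V1 \<union> V2))"
  have over: "over (V1 \<union> V2) = over V1 \<union> over V2" by (auto simp: over_def)
  have sub: "subtopology ?X (over V1) = subtopology (edges E) (over V1)"
    "subtopology ?X (over V2) = subtopology (edges E) (over V2)"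
    by (simp_all add: subtopology_subtopology over Int_absorb1)
  have g1c: "continuous_map (subtopology (edges E) (over V1)) (edges F) g1"
    and g2c: "continuous_map (subtopology (edges E) (over V2)) (edges F) g2"
    using g1 g2 by (simp_all add: partial_iso_def)
  have c1: "continuous_map (subtopology (edges E) (over V1)) (edges F) ?g"
    by (rule continuous_map_eq[OF g1c]) (simp add: over_def)
  have c2: "continuous_map (subtopology (edges E) (over V2)) (edges F) ?g"
    by (rule continuous_map_eq[OF g2c]) (use disj in \<open>auto simp: over_def\<close>)
  have "continuous_map ?X (edges F) ?g"
  proof (rule continuous_map_locally)
    fix e assume e: "e \<in> topspace ?X"
    have "openin ?X (over V1)" "openin ?X (over V2)"
      using openin_over[OF op(1)] openin_over[OF op(2)]
      by (simp_all add: over openin_open_subtopology[OF openin_Un])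
    moreover have "e \<in> over V1 \<or> e \<in> over V2" using e over by auto
    ultimately show "\<exists>U. openin ?X U \<and> e \<in> U \<and> continuous_map (subtopology ?X U) (edges F) ?g"
      using c1 c2 sub by metis
  qed
  moreover have "bij_betw ?g (fibre E v) (fibre F (\<kappa> v))" if v: "v \<in> V1 \<union> V2" for v
  proof (cases "v \<in> V1")
    case True
    then have "bij_betw g1 (fibre E v) (fibre F (\<kappa> v))" using g1 by (simp add: partial_iso_def)
    then show ?thesis using True by (subst bij_betw_cong[of _ _ g1]) (auto simp: fibre_def)
  next
    case False
    then have "bij_betw g2 (fibre E v) (fibre F (\<kappa> v))" using g2 v by (simp add: partial_iso_def)
    then show ?thesis using False by (subst bij_betw_cong[of _ _ g2]) (auto simp: fibre_def)
  qed
  moreover have "rng F (?g e) = \<kappa> (rng E e)" if "e \<in> over (V1 \<union> V2)" for e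
    using that g1 g2 unfolding over partial_iso_def by (auto simp: over_def)
  ultimately show ?thesis unfolding partial_iso_def by blast
qed

text \<open>The matching at \<open>v0\<close> alone is chosen and propagated along local sections:
  \<open>tE e v\<close> is sent to \<open>tF (\<sigma> e) (\<kappa> v)\<close>. Equality of keys at
  \<open>v0\<close> makes the ranges agree on a neighbourhood, and the finitely many neighbourhoods
  are intersected.\<close>

lemma local_partial_iso:
  assumes v0: "v0 \<in> E.Vs"
  obtains V g where "openin (verts E) V" "v0 \<in> V" "partial_iso V g"
proof -
  let ?I = "fibre E v0"
  have \<kappa>: "continuous_map (verts E) (verts F) \<kappa>" "\<And>v. v \<in> E.Vs \<Longrightarrow> \<phi> (\<kappa> v) = v"
    "\<And>w. w \<in> F.Vs \<Longrightarrow> \<kappa> (\<phi> w) = w"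
    using homeo by (auto simp: homeomorphic_maps_def)
  have w0: "\<kappa> v0 \<in> F.Vs" using \<kappa>(1) v0 continuous_map_image_subset_topspace by fastforce
  obtain VE tE where tE: "local_sections E v0 VE tE" by (rule E.ex_local_sections[OF v0])
  obtain VF tF where tF: "local_sections F (\<kappa> v0) VF tF" by (rule F.ex_local_sections[OF w0])
  obtain \<sigma> where \<sigma>: "bij_betw \<sigma> ?I (fibre F (\<kappa> v0))"
    "\<And>e. e \<in> ?I \<Longrightarrow> germ_key (edges F) (\<phi> \<circ> src F) (\<phi> \<circ> rng F) (\<sigma> e) = E.key e"
    using matching[OF v0] by blast
  have \<sigma>I: "\<sigma> e \<in> fibre F (\<kappa> v0)" if "e \<in> ?I" for e using \<sigma>(1) that bij_betwE by blast
  have VE: "openin (verts E) VE" "v0 \<in> VE" and VF: "openin (verts F) VF" "\<kappa> v0 \<in> VF"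
    using tE tF by (auto simp: local_sections_def)
  have tEc: "continuous_map (subtopology (verts E) VE) (edges E) (tE e)"
      "tE e v0 = e" if "e \<in> ?I" for e
    using tE that by (auto simp: local_sections_def)
  have tFc: "continuous_map (subtopology (verts F) VF) (edges F) (tF (\<sigma> e))"
      "tF (\<sigma> e) (\<kappa> v0) = \<sigma> e" if "e \<in> ?I" for e
    using tF \<sigma>I[OF that] by (auto simp: local_sections_def)
  have bE: "bij_betw (\<lambda>e. tE e v) ?I (fibre E v)" if "v \<in> VE" for v
    using tE that by (auto simp: local_sections_def)
  have bF: "bij_betw (\<lambda>f. tF f w) (fibre F (\<kappa> v0)) (fibre F w)" if "w \<in> VF" for w
    using tF that by (auto simp: local_sections_def)
  define V0 where "V0 = VE \<inter> {v \<in> E.Vs. \<kappa> v \<in> VF}"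
  let ?VT = "subtopology (verts E) V0"
  have V0: "openin (verts E) V0"
    unfolding V0_def using VE(1) openin_continuous_map_preimage[OF \<kappa>(1) VF(1)] by blast
  have cE: "continuous_map ?VT (edges E) (tE e)" if "e \<in> ?I" for e
    by (rule continuous_map_from_subtopology_mono[OF tEc(1)[OF that]]) (auto simp: V0_def)
  have cF: "continuous_map ?VT (edges F) (\<lambda>v. tF (\<sigma> e) (\<kappa> v))" if "e \<in> ?I" for e
  proof -
    have "continuous_map ?VT (subtopology (verts F) VF) \<kappa>"
      using continuous_map_from_subtopology[OF \<kappa>(1)]
      by (auto simp: continuous_map_in_subtopology V0_def)
    from continuous_map_compose[OF this tFc(1)[OF that]] show ?thesis by (simp add: o_def)
  qed
  have "\<exists>W. openin (verts E) W \<and> v0 \<in> W \<and>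
      (\<forall>v \<in> W. v \<in> V0 \<longrightarrow> rng F (tF (\<sigma> e) (\<kappa> v)) = \<kappa> (rng E (tE e v)))" if e: "e \<in> ?I" for e
  proof -
    have "e \<in> E.Es" using e by (simp add: fibre_def)
    then obtain h where "h \<in> E.key e" using E.germ_key_chart by metis
    moreover have "h \<in> germ_key (edges F) (\<phi> \<circ> src F) (\<phi> \<circ> rng F) (\<sigma> e)"
      using calculation \<sigma>(2)[OF e] by simp
    ultimately obtain Z Y where Z: "openin (edges E) Z" "e \<in> Z" "\<And>x. x \<in> Z \<Longrightarrow> h (src E x) = rng E x"
      and Y: "openin (edges F) Y" "\<sigma> e \<in> Y" "\<And>f. f \<in> Y \<Longrightarrow> h (\<phi> (src F f)) = \<phi> (rng F f)"
      unfolding germ_key_def by auto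
    \<comment> \<open>The vertices at which both sections through the matched edges stay where the
      common representative \<open>h\<close> computes the ranges.\<close>
    define W where "W = {v \<in> topspace ?VT. tE e v \<in> Z} \<inter>
      {v \<in> topspace ?VT. tF (\<sigma> e) (\<kappa> v) \<in> Y}"
    have "openin ?VT W"
      unfolding W_def
      by (intro openin_Int openin_continuous_map_preimage[OF cE[OF e] Z(1)]
          openin_continuous_map_preimage[OF cF[OF e] Y(1)])
    then have "openin (verts E) W" using V0 openin_trans_full by blast
    moreover have "v0 \<in> W"
      using v0 VE(2) VF(2) Z(2) Y(2) tEc(2)[OF e] tFc(2)[OF e] by (simp add: W_def V0_def)
    moreover have "rng F (tF (\<sigma> e) (\<kappa> v)) = \<kappa> (rng E (tE e v))" if "v \<in> W" "v \<in> V0" for v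
    proof -
      have v: "v \<in> VE" "\<kappa> v \<in> VF" "v \<in> E.Vs" using that(2) by (auto simp: V0_def)
      let ?f = "tF (\<sigma> e) (\<kappa> v)"
      have f: "?f \<in> fibre F (\<kappa> v)" using bF[OF v(2)] \<sigma>I[OF e] bij_betwE by blast
      have x: "tE e v \<in> fibre E v" using bE[OF v(1)] e bij_betwE by blast
      have "\<phi> (rng F ?f) = h (\<phi> (src F ?f))" using Y(3) that(1) by (simp add: W_def)
      also have "\<dots> = h v" using f \<kappa>(2)[OF v(3)] by (simp add: fibre_def)
      also have "\<dots> = rng E (tE e v)" using Z(3)[of "tE e v"] that(1) x
        by (simp add: W_def fibre_def)
      finally have "\<kappa> (\<phi> (rng F ?f)) = \<kappa> (rng E (tE e v))" by simp
      moreover have "rng F ?f \<in> F.Vs" using f F.rng_in_verts by (simp add: fibre_def)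
      ultimately show ?thesis using \<kappa>(3) by simp
    qed
    ultimately show ?thesis by blast
  qed
  then have "\<forall>e \<in> ?I. \<exists>W. openin (verts E) W \<and> v0 \<in> W \<and>
      (\<forall>v \<in> W. v \<in> V0 \<longrightarrow> rng F (tF (\<sigma> e) (\<kappa> v)) = \<kappa> (rng E (tE e v)))" by blast
  from bchoice[OF this] obtain W where W: "\<And>e. e \<in> ?I \<Longrightarrow> openin (verts E) (W e)"
      "\<And>e. e \<in> ?I \<Longrightarrow> v0 \<in> W e"
    "\<And>e v. e \<in> ?I \<Longrightarrow> v \<in> W e \<Longrightarrow> v \<in> V0 \<Longrightarrow> rng F (tF (\<sigma> e) (\<kappa> v)) = \<kappa> (rng E (tE e v))"
    by blast
  define V where "V = V0 \<inter> ((\<Inter>e\<in>?I. W e) \<inter> E.Vs)"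
  have Vo: "openin (verts E) V"
    unfolding V_def by (intro openin_Int V0 openin_INT E.finite_fibre W(1))
  have v0V: "v0 \<in> V" using v0 VE(2) VF(2) W(2) by (simp add: V_def V0_def)
  have VV0: "v \<in> VE" "\<kappa> v \<in> VF" "v \<in> V0" if "v \<in> V" for v using that by (auto simp: V_def V0_def)
  \<comment> \<open>The edge over \<open>v0\<close> whose local section passes through
    \<open>x\<close>.\<close>
  define idx where "idx x = inv_into ?I (\<lambda>e. tE e (src E x)) x" for x
  have idx: "idx (tE e v) = e" if e: "e \<in> ?I" and v: "v \<in> V" for e v
  proof -
    have "tE e v \<in> fibre E v" using bE[OF VV0(1)[OF v]] e bij_betwE by blast
    then have "src E (tE e v) = v" by (simp add: fibre_def)
    then show ?thesis
      using inv_into_f_f[of "\<lambda>e. tE e v" ?I e] bE[OF VV0(1)[OF v]] e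
      by (simp add: idx_def bij_betw_def)
  qed
  define g where "g x = tF (\<sigma> (idx x)) (\<kappa> (src E x))" for x
  have g: "g (tE e v) = tF (\<sigma> e) (\<kappa> v)" if e: "e \<in> ?I" and v: "v \<in> V" for e v
  proof -
    have "tE e v \<in> fibre E v" using bE[OF VV0(1)[OF v]] e bij_betwE by blast
    then show ?thesis using idx[OF e v] by (simp add: g_def fibre_def)
  qed
  have ex: "\<exists>e \<in> ?I. x = tE e (src E x)" if x: "x \<in> over V" for x
  proof -
    have "x \<in> fibre E (src E x)" "src E x \<in> V" using x by (auto simp: over_def fibre_def)
    then show ?thesis using bE[OF VV0(1)] unfolding bij_betw_def by (metis imageE)
  qed
  let ?X = "subtopology (edges E) (over V)"
  have srcX: "continuous_map ?X ?VT (src E)"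
    using continuous_map_from_subtopology[OF E.continuous_src] VV0(3)
    by (auto simp: continuous_map_in_subtopology over_def)
  have "continuous_map ?X (edges F) g"
  \<comment> \<open>The sheets of the sections are the sets where \<open>tE e (src E x)\<close>
    equals \<open>x\<close>: closed because the edge space is Hausdorff, finitely many, and pairwise
    disjoint by \<open>idx\<close>. On each sheet \<open>g\<close> is a composite of continuous
    maps.\<close>
  proof (rule pasting_lemma_closed[where I = ?I
      and T = "\<lambda>e. {x \<in> topspace ?X. tE e (src E x) = id x}"
        and f = "\<lambda>e x. tF (\<sigma> e) (\<kappa> (src E x))"])
    show "finite ?I" by (rule E.finite_fibre)
    show "closedin ?X {x \<in> topspace ?X. tE e (src E x) = id x}" if e: "e \<in> ?I" for e
    proof (rule closedin_continuous_maps_eq[OF E.edges_space(2)])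
      show "continuous_map ?X (edges E) (\<lambda>x. tE e (src E x))"
        using continuous_map_compose[OF srcX cE[OF e]] by (simp add: o_def)
      show "continuous_map ?X (edges E) id"
        by (rule continuous_map_from_subtopology) simp
    qed
    show "continuous_map (subtopology ?X {x \<in> topspace ?X. tE e (src E x)
        = id x}) (edges F) (\<lambda>x. tF (\<sigma> e) (\<kappa> (src E x)))"
      if e: "e \<in> ?I" for e
      by (rule continuous_map_from_subtopology)
        (use continuous_map_compose[OF srcX cF[OF e]] in \<open>simp add: o_def\<close>)
    show "\<exists>e. e \<in> ?I \<and> x \<in> {x \<in> topspace ?X. tE e (src E x) = id x} \<and> g x = tF (\<sigma> e) (\<kappa> (src E x))"
      if x: "x \<in> topspace ?X" for x
    proof -
      have xo: "x \<in> over V" using x by simp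
      then obtain e where e: "e \<in> ?I" "x = tE e (src E x)" using ex by blast
      have "src E x \<in> V" using xo by (simp add: over_def)
      then have "g x = tF (\<sigma> e) (\<kappa> (src E x))" using g[OF e(1)] e(2) by metis
      then show ?thesis using e x by auto
    qed
    show "tF (\<sigma> e) (\<kappa> (src E x)) = tF (\<sigma> e') (\<kappa> (src E x))"
      if e: "e \<in> ?I" "e' \<in> ?I" and x: "x \<in> topspace ?X \<inter> {x \<in> topspace ?X. tE e (src E x) = id x} \<inter>
        {x \<in> topspace ?X. tE e' (src E x) = id x}" for e e' x
    proof -
      have "src E x \<in> V" using x by (simp add: over_def)
      then have "idx (tE e (src E x)) = e" "idx (tE e' (src E x)) = e'" using idx e by simp_all
      then have "e = e'" using x by simp
      then show ?thesis by simp
    qed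
  qed
  moreover have "bij_betw g (fibre E v) (fibre F (\<kappa> v))" if v: "v \<in> V" for v
  proof -
    have 1: "bij_betw ((\<lambda>f. tF f (\<kappa> v)) \<circ> \<sigma>) ?I (fibre F (\<kappa> v))"
      by (rule bij_betw_trans[OF \<sigma>(1) bF[OF VV0(2)[OF v]]])
    have "bij_betw (g \<circ> (\<lambda>e. tE e v)) ?I (fibre F (\<kappa> v))"
      using 1 by (subst bij_betw_cong[of _ _ "(\<lambda>f. tF f (\<kappa> v)) \<circ> \<sigma>"]) (simp_all add: g[OF _ v])
    then show ?thesis using bij_betw_comp_iff[OF bE[OF VV0(1)[OF v]]] by blast
  qed
  moreover have "rng F (g x) = \<kappa> (rng E x)" if x: "x \<in> over V" for x
  proof -
    obtain e where e: "e \<in> ?I" "x = tE e (src E x)" using ex[OF x] by blast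
    have v: "src E x \<in> V" using x by (simp add: over_def)
    have "rng F (tF (\<sigma> e) (\<kappa> (src E x))) = \<kappa> (rng E (tE e (src E x)))"
      by (rule W(3)[OF e(1) _ VV0(3)[OF v]]) (use v e(1) in \<open>auto simp: V_def\<close>)
    then show ?thesis using g[OF e(1) v] e(2) by simp
  qed
  ultimately have "partial_iso V g" unfolding partial_iso_def by blast
  then show thesis using that Vo v0V by blast
qed

lemma global_iso: "\<exists>g. partial_iso E.Vs g"
proof -
  define \<U> where "\<U> = {U. openin (verts E) U \<and> closedin (verts E) U \<and> (\<exists>g. partial_iso U g)}"
  have "\<exists>U \<in> \<U>. v \<in> U" if v: "v \<in> E.Vs" for v
  proof -
    obtain V g where V: "openin (verts E) V" "v \<in> V"
        "partial_iso V g" by (rule local_partial_iso[OF v])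
    obtain U where U: "openin (verts E) U" "closedin (verts E) U" "v \<in> U" "U \<subseteq> V"
      by (rule ex_clopen_neighbourhood[OF E.verts_space disconnected V(1,2)])
    then show ?thesis using partial_iso_mono[OF V(3)] by (auto simp: \<U>_def)
  qed
  then have "E.Vs \<subseteq> \<Union>\<U>" by blast
  moreover have "compactin (verts E) E.Vs" using E.verts_space by (simp add: compact_space_def)
  moreover have "\<And>U. U \<in> \<U> \<Longrightarrow> openin (verts E) U" by (simp add: \<U>_def)
  ultimately obtain \<F> where F: "finite \<F>" "\<F> \<subseteq> \<U>" "E.Vs \<subseteq> \<Union>\<F>"
    using compactinD by metis
  from F(1,2) have "openin (verts E) (\<Union>\<F>) \<and> closedin (verts E) (\<Union>\<F>) \<and> (\<exists>g. partial_iso (\<Union>\<F>) g)"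
  proof (induction \<F> rule: finite_induct)
    case empty
    have "partial_iso {} g" for g
      unfolding partial_iso_def by (auto simp: over_def continuous_map_def)
    then show ?case by auto
  next
    case (insert U \<F>)
    then obtain g where g: "openin (verts E) (\<Union>\<F>)" "closedin (verts E) (\<Union>\<F>)"
        "partial_iso (\<Union>\<F>) g" by blast
    obtain g' where g': "openin (verts E) U" "closedin (verts E) U" "partial_iso U g'"
      using insert by (auto simp: \<U>_def)
    \<comment> \<open>Only the new part of \<open>U\<close> is added, so no agreement on overlaps is
      asked for. It is open because the union so far is closed, which is why the induction carries
      both properties.\<close>
    have "openin (verts E) (U - \<Union>\<F>)" using g'(1) g(2) by (rule openin_diff)
    then have "\<exists>k. partial_iso (\<Union>\<F> \<union> (U - \<Union>\<F>)) k"
      using partial_iso_Un[OF g(3) partial_iso_mono[OF g'(3), of "U - \<Union>\<F>"] _ g(1)] by blast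
    moreover have "\<Union>\<F> \<union> (U - \<Union>\<F>) = \<Union>(insert U \<F>)" by auto
    moreover have "openin (verts E) (U \<union> \<Union>\<F>)" "closedin (verts E) (U \<union> \<Union>\<F>)"
      using g(1,2) g'(1,2) by (auto intro: closedin_Un)
    ultimately show ?case by simp
  qed
  then show ?thesis using partial_iso_mono F(3) by blast
qed

lemma isomorphic: "graph_isomorphic E F"
proof -
  obtain g where g: "partial_iso E.Vs g" using global_iso by blast
  have ov: "over E.Vs = E.Es" using E.src_in_verts by (auto simp: over_def)
  have cont: "continuous_map (edges E) (edges F) g"
    using g unfolding partial_iso_def ov by simp
  have bij: "bij_betw g (fibre E v) (fibre F (\<kappa> v))" if "v \<in> E.Vs" for v
    using g that by (simp add: partial_iso_def)
  have src: "src F (g e) = \<kappa> (src E e)" if e: "e \<in> E.Es" for e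
    using bij_betwE[OF bij[OF E.src_in_verts[OF e]]] e by (auto simp: fibre_def)
  have \<kappa>: "\<And>v. v \<in> E.Vs \<Longrightarrow> \<phi> (\<kappa> v) = v" "\<And>w. w \<in> F.Vs \<Longrightarrow> \<kappa> (\<phi> w) = w"
    "\<And>w. w \<in> F.Vs \<Longrightarrow> \<phi> w \<in> E.Vs"
    using homeo continuous_map_image_subset_topspace by (fastforce simp: homeomorphic_maps_def)+
  have "inj_on g E.Es"
  proof (rule inj_onI)
    fix x y assume xy: "x \<in> E.Es" "y \<in> E.Es" "g x = g y"
    then have "\<kappa> (src E x) = \<kappa> (src E y)" using src by metis
    then have "src E x = src E y" using \<kappa>(1) E.src_in_verts xy by metis
    then show "x = y"
      using bij[OF E.src_in_verts[OF xy(1)]] xy by (auto simp: bij_betw_def inj_on_def fibre_def)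
  qed
  moreover have "g ` E.Es = F.Es"
  proof
    show "g ` E.Es \<subseteq> F.Es" using cont continuous_map_image_subset_topspace by blast
    show "F.Es \<subseteq> g ` E.Es"
    proof
      fix f assume f: "f \<in> F.Es"
      let ?v = "\<phi> (src F f)"
      have "f \<in> fibre F (\<kappa> ?v)" using f \<kappa>(2) F.src_in_verts by (simp add: fibre_def)
      then have "f \<in> g ` fibre E ?v" using bij[OF \<kappa>(3)[OF F.src_in_verts[OF f]]]
        by (simp add: bij_betw_def)
      then show "f \<in> g ` E.Es" by (auto simp: fibre_def)
    qed
  qed
  \<comment> \<open>A continuous bijection from a compact space to a Hausdorff space has a
    continuous inverse.\<close>
  ultimately have "homeomorphic_map (edges E) (edges F) g"
    using continuous_imp_homeomorphic_map[OF cont E.edges_space(1) F.edges_space(2)] by blast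
  moreover have "homeomorphic_map (verts E) (verts F) \<kappa>" using homeo homeomorphic_maps_imp_map
    by blast
  moreover have "rng F (g e) = \<kappa> (rng E e)" if "e \<in> E.Es" for e
    using g that unfolding partial_iso_def ov by simp
  ultimately show ?thesis unfolding graph_isomorphic_def using src by blast
qed

end

section \<open>Transport along an isomorphism of triples\<close>

lemma toeplitz_rep_star_hom:
  assumes B: "c_star_algebra B" and rep: "toeplitz_rep A X B \<psi> \<pi>" and h: "star_hom B C h"
  shows "toeplitz_rep A X C (h \<circ> \<psi>) (h \<circ> \<pi>)"
proof -
  have \<psi>: "linear_map X B \<psi>" and \<pi>: "star_hom A B \<pi>" and hl: "linear_map B C h"
    using rep h by (simp_all add: toeplitz_rep_def star_hom_def)
  have c: "x \<in> carrier X \<Longrightarrow> \<psi> x \<in> carrier B" "a \<in> carrier A \<Longrightarrow> \<pi> a \<in> carrier B" for x a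
    using \<psi> \<pi> by (auto simp: star_hom_def linear_map_def)
  have "linear_map X C (h \<circ> \<psi>)" using \<psi> hl by (auto simp: linear_map_def Pi_iff)
  moreover have "star_hom A C (h \<circ> \<pi>)" by (rule star_hom_comp[OF \<pi> h])
  moreover have "adj C (h (\<psi> x)) \<otimes>\<^bsub>C\<^esub> h (\<psi> y) = h (\<pi> (inprod X x y))" if "x \<in> carrier X"
      "y \<in> carrier X" for x y
  proof -
    have "h (adj B (\<psi> x) \<otimes>\<^bsub>B\<^esub> \<psi> y) = h (adj B (\<psi> x)) \<otimes>\<^bsub>C\<^esub> h (\<psi> y)"
      using that c B by (intro star_homD(5)[OF h]) (simp_all add: c_star_algebra.adj_closed)
    then show ?thesis using rep that star_homD(3)[OF h c(1)[OF that(1)]]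
      by (simp add: toeplitz_rep_def)
  qed
  ultimately show ?thesis
    using rep star_homD(5)[OF h] c by (simp add: toeplitz_rep_def)
qed

lemma star_iso_inv:
  assumes A: "c_star_algebra A" and h: "star_iso A B h"
  shows "star_iso B A (inv_into (carrier A) h)"
proof -
  interpret A: c_star_algebra A by fact
  let ?k = "inv_into (carrier A) h"
  have hom: "star_hom A B h" and bij: "bij_betw h (carrier A) (carrier B)"
    using h by (simp_all add: star_iso_def)
  have k: "?k y \<in> carrier A" "h (?k y) = y" if "y \<in> carrier B" for y
    using bij that by (auto simp: bij_betw_def f_inv_into_f inv_into_into)
  have kh: "?k (h x) = x" if "x \<in> carrier A" for x
    using bij that by (simp add: bij_betw_def)
  have "star_hom B A ?k"
    unfolding star_hom_def linear_map_def
  proof (intro conjI ballI allI)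
    show "?k \<in> carrier B \<rightarrow> carrier A" using k by simp
    fix x y c assume x: "x \<in> carrier B"
    note kx = k[OF x]
    show "?k (c \<odot>\<^bsub>B\<^esub> x) = c \<odot>\<^bsub>A\<^esub> ?k x"
      using kh[OF A.smult_carrier[OF kx(1), of c]] star_homD(2)[OF hom kx(1), of c] kx(2) by simp
    show "?k (adj B x) = adj A (?k x)"
      using kh[OF A.adj_closed[OF kx(1)]] star_homD(3)[OF hom kx(1)] kx(2) by simp
    assume y: "y \<in> carrier B"
    note ky = k[OF y]
    show "?k (x \<oplus>\<^bsub>B\<^esub> y) = ?k x \<oplus>\<^bsub>A\<^esub> ?k y"
      using kh[OF A.a_closed[OF kx(1) ky(1)]] star_homD(4)[OF hom kx(1) ky(1)] kx(2) ky(2) by simp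
    show "?k (x \<otimes>\<^bsub>B\<^esub> y) = ?k x \<otimes>\<^bsub>A\<^esub> ?k y"
      using kh[OF A.mult_closed[OF kx(1) ky(1)]] star_homD(5)[OF hom kx(1) ky(1)] kx(2) ky(2)
      by simp
  qed
  then show ?thesis using bij bij_betw_inv_into by (auto simp: star_iso_def)
qed

locale triple_iso = E: graph_toeplitz_algebra E TE \<iota>XE \<iota>AE \<gamma>E + F: graph_toeplitz_algebra F TF \<iota>XF
    \<iota>AF \<gamma>F
  for E :: "('v, 'e) topological_graph" and F :: "('w, 'f) topological_graph"
    and TE :: "'s star_algebra" and TF :: "'t star_algebra" and \<iota>XE \<iota>AE \<gamma>E \<iota>XF \<iota>AF \<gamma>F +
  fixes \<theta> :: "'s \<Rightarrow> 't"
  assumes iso: "star_iso TE TF \<theta>"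
    and equivariant: "z \<in> sphere 0 1 \<Longrightarrow> s \<in> carrier TE \<Longrightarrow> \<theta> (\<gamma>E z s) = \<gamma>F z (\<theta> s)"
    and image: "\<theta> ` \<iota>AE ` E.CV = \<iota>AF ` F.CV"
begin

lemma hom: "star_hom TE TF \<theta>" and bij: "bij_betw \<theta> (carrier TE) (carrier TF)"
  using iso by (simp_all add: star_iso_def)

text \<open>The restriction of \<open>\<theta>\<close> to the vertex subalgebras, read as a map of
  function algebras; it is well defined by \<open>image\<close> and the injectivity of
  \<open>\<iota>AF\<close>.\<close>

definition \<Theta> :: "('v \<Rightarrow> complex) \<Rightarrow> 'w \<Rightarrow> complex" where
  "\<Theta> a = inv_into F.CV \<iota>AF (\<theta> (\<iota>AE a))"

lemma \<Theta>: "a \<in> E.CV \<Longrightarrow> \<Theta> a \<in> F.CV"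
  "a \<in> E.CV \<Longrightarrow> \<iota>AF (\<Theta> a) = \<theta> (\<iota>AE a)"
  using image unfolding \<Theta>_def by (metis imageI inv_into_into, metis imageI f_inv_into_f)

lemma \<Theta>_eqI: "a \<in> E.CV \<Longrightarrow> b \<in> F.CV \<Longrightarrow> \<iota>AF b = \<theta> (\<iota>AE a) \<Longrightarrow> \<Theta> a = b"
  using \<Theta> F.\<iota>A_inj by (metis inj_onD)

lemma \<Theta>_bij: "bij_betw \<Theta> E.CV F.CV"
  unfolding bij_betw_def
proof
  show "inj_on \<Theta> E.CV"
  proof (rule inj_onI)
    fix a b assume ab: "a \<in> E.CV" "b \<in> E.CV" "\<Theta> a = \<Theta> b"
    then have "\<theta> (\<iota>AE a) = \<theta> (\<iota>AE b)" using \<Theta>(2) by metis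
    then have "\<iota>AE a = \<iota>AE b"
      using bij E.\<iota>A_carrier[OF ab(1)] E.\<iota>A_carrier[OF ab(2)] by (simp add: bij_betw_def inj_on_def)
    then show "a = b" using E.\<iota>A_inj ab by (simp add: inj_on_def)
  qed
  show "\<Theta> ` E.CV = F.CV"
  proof
    show "\<Theta> ` E.CV \<subseteq> F.CV" using \<Theta>(1) by blast
    show "F.CV \<subseteq> \<Theta> ` E.CV"
    proof
      fix b assume b: "b \<in> F.CV"
      then have "\<iota>AF b \<in> \<theta> ` \<iota>AE ` E.CV" using image by blast
      then obtain a where a: "a \<in> E.CV" "\<iota>AF b = \<theta> (\<iota>AE a)" by blast
      then show "b \<in> \<Theta> ` E.CV" using \<Theta>_eqI[OF a(1) b a(2)] by blast
    qed
  qed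
qed

lemma \<Theta>_add: "a \<in> E.CV \<Longrightarrow> b \<in> E.CV \<Longrightarrow> \<Theta> (\<lambda>v. a v + b v) = (\<lambda>w. \<Theta> a w + \<Theta> b w)"
  using star_homD(4)[OF E.\<iota>A_star_hom, of a b] star_homD(4)[OF F.\<iota>A_star_hom, of "\<Theta> a" "\<Theta> b"]
    star_homD(4)[OF hom E.\<iota>A_carrier E.\<iota>A_carrier, of a b]
  by (intro \<Theta>_eqI) (simp_all add: cfun_add \<Theta>)

lemma \<Theta>_mult: "a \<in> E.CV \<Longrightarrow> b \<in> E.CV \<Longrightarrow> \<Theta> (\<lambda>v. a v * b v) = (\<lambda>w. \<Theta> a w * \<Theta> b w)"
  using star_homD(5)[OF E.\<iota>A_star_hom, of a b] star_homD(5)[OF F.\<iota>A_star_hom, of "\<Theta> a" "\<Theta> b"]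
    star_homD(5)[OF hom E.\<iota>A_carrier E.\<iota>A_carrier, of a b]
  by (intro \<Theta>_eqI) (simp_all add: cfun_mult \<Theta>)

lemma \<Theta>_scale: "a \<in> E.CV \<Longrightarrow> \<Theta> (\<lambda>v. c * a v) = (\<lambda>w. c * \<Theta> a w)"
  using star_homD(2)[OF E.\<iota>A_star_hom, of a c] star_homD(2)[OF F.\<iota>A_star_hom, of "\<Theta> a" c]
    star_homD(2)[OF hom E.\<iota>A_carrier, of a c]
  by (intro \<Theta>_eqI) (simp_all add: cfun_scale \<Theta>)

lemma ex_vertex_map:
  "\<exists>\<phi>. continuous_map (verts F) (verts E) \<phi> \<and>
     (\<forall>a \<in> E.CV. \<forall>w \<in> F.Vs. \<Theta> a w = a (\<phi> w))"
  using algebra_iso_point_map[OF E.verts_space \<Theta>_bij \<Theta>_add \<Theta>_mult \<Theta>_scale] by metis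

lemma transported:
  assumes \<phi>: "homeomorphic_map (verts F) (verts E) \<phi>"
    and \<Theta>\<phi>: "\<forall>a \<in> E.CV. \<forall>w \<in> F.Vs. \<Theta> a w = a (\<phi> w)"
  shows "transported_rep E F TF \<iota>XF \<iota>AF \<gamma>F (\<theta> \<circ> \<iota>XE) (\<theta> \<circ> \<iota>AE) \<phi>"
proof
  show "toeplitz_rep (cfun_algebra (verts E)) (graph_correspondence E) TF (\<theta> \<circ> \<iota>XE) (\<theta> \<circ> \<iota>AE)"
    by (rule toeplitz_rep_star_hom[OF E.T.c_star_algebra_axioms E.rep hom])
  show "homeomorphic_map (verts F) (verts E) \<phi>" by fact
  show "F.degree_one ((\<theta> \<circ> \<iota>XE) x)" if x: "x \<in> E.CE" for x
    unfolding F.degree_one_def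
  proof (intro conjI ballI)
    show "(\<theta> \<circ> \<iota>XE) x \<in> carrier TF" using star_homD(1)[OF hom E.\<iota>X_carrier[OF x]] by simp
    fix z :: complex assume z: "z \<in> sphere 0 1"
    have "\<gamma>E z (\<iota>XE x) = z \<odot>\<^bsub>TE\<^esub> \<iota>XE x" using E.gauge z x by (simp add: gauge_action_def)
    then show "\<gamma>F z ((\<theta> \<circ> \<iota>XE) x) = z \<odot>\<^bsub>TF\<^esub> (\<theta> \<circ> \<iota>XE) x"
      using equivariant[OF z E.\<iota>X_carrier[OF x]] star_homD(2)[OF hom E.\<iota>X_carrier[OF x], of z]
      by simp
  qed
  show "\<exists>b\<in>F.CV. (\<theta> \<circ> \<iota>AE) a = \<iota>AF b \<and> (\<forall>w\<in>F.Vs. b w = a (\<phi> w))"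
    if a: "a \<in> E.CV" for a
    using \<Theta>[OF a] \<Theta>\<phi> a by (intro bexI[of _ "\<Theta> a"]) auto
qed

text \<open>Makes all one-sided results available with the roles of \<open>E\<close> and
  \<open>F\<close> exchanged.\<close>

lemma inverse: "triple_iso F E TF TE \<iota>XF \<iota>AF \<gamma>F \<iota>XE \<iota>AE \<gamma>E (inv_into (carrier TE) \<theta>)"
proof
  let ?k = "inv_into (carrier TE) \<theta>"
  show "star_iso TF TE ?k" by (rule star_iso_inv[OF E.T.c_star_algebra_axioms iso])
  have k\<theta>: "?k (\<theta> s) = s" if "s \<in> carrier TE" for s using bij that by (simp add: bij_betw_def)
  have k: "?k t \<in> carrier TE" "\<theta> (?k t) = t" if "t \<in> carrier TF" for t
    using bij that by (auto simp: bij_betw_def f_inv_into_f inv_into_into)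
  show "?k (\<gamma>F z t) = \<gamma>E z (?k t)" if z: "z \<in> sphere 0 1" and t: "t \<in> carrier TF" for z t
  proof -
    have "\<gamma>E z (?k t) \<in> carrier TE" by (rule star_homD(1)[OF E.gauge_star_hom[OF z] k(1)[OF t]])
    then show ?thesis using equivariant[OF z k(1)[OF t]] k(2)[OF t] k\<theta> by metis
  qed
  have "?k ` \<theta> ` \<iota>AE ` E.CV = \<iota>AE ` E.CV"
    using k\<theta> E.\<iota>A_carrier by (force simp: image_image)
  then show "?k ` \<iota>AF ` F.CV = \<iota>AE ` E.CV" by (simp only: image)
qed

lemma graphs_isomorphic:
  assumes td: "totally_disconnected_space (verts E)"
  shows "graph_isomorphic E F"
proof -
  let ?k = "inv_into (carrier TE) \<theta>"
  interpret inv: triple_iso F E TF TE \<iota>XF \<iota>AF \<gamma>F \<iota>XE \<iota>AE \<gamma>E ?k by (rule inverse)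
  obtain \<phi> where \<phi>: "continuous_map (verts F) (verts E) \<phi>"
    "\<forall>a \<in> E.CV. \<forall>w \<in> F.Vs. \<Theta> a w = a (\<phi> w)"
    using ex_vertex_map by blast
  obtain \<kappa> where \<kappa>: "continuous_map (verts E) (verts F) \<kappa>"
    "\<forall>b \<in> F.CV. \<forall>v \<in> E.Vs. inv.\<Theta> b v = b (\<kappa> v)"
    using inv.ex_vertex_map by blast
  have \<phi>v: "\<phi> w \<in> E.Vs" if "w \<in> F.Vs" for w
    using \<phi>(1) that continuous_map_image_subset_topspace by fastforce
  have \<kappa>v: "\<kappa> v \<in> F.Vs" if "v \<in> E.Vs" for v
    using \<kappa>(1) that continuous_map_image_subset_topspace by fastforce
  have inv1: "inv.\<Theta> (\<Theta> a) = a" if a: "a \<in> E.CV" for a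
    using bij E.\<iota>A_carrier[OF a]
    by (intro inv.\<Theta>_eqI) (simp_all add: \<Theta>[OF a] a bij_betw_def)
  have inv2: "\<Theta> (inv.\<Theta> b) = b" if b: "b \<in> F.CV" for b
    using inv1 \<Theta>_bij inv.\<Theta>(1) b unfolding bij_betw_def by (metis imageE)
  \<comment> \<open>Continuous functions separate points, so identities between
    \<open>\<Theta>\<close> and \<open>inv.\<Theta>\<close> become identities between the point
    maps.\<close>
  have sep: "p = q" if X: "compact_space X"
      "Hausdorff_space X" and p: "p \<in> topspace X" and q: "q \<in> topspace X"
    and eq: "\<And>a. a \<in> cfun X \<Longrightarrow> a p = a q" for X :: "'x topology" and p q
  proof (rule ccontr)
    assume "p \<noteq> q"
    then obtain U V where UV: "openin X U" "openin X V" "p \<in> U" "q \<in> V" "disjnt U V"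
      using X(2) p q unfolding Hausdorff_space_def by metis
    obtain a where "a \<in> cfun X" "a p = 1" "\<And>q. q \<notin> U \<Longrightarrow> a q = 0"
      using cfun_bump[OF X UV(1,3)] by blast
    then show False using eq UV(4,5) by (metis disjnt_iff zero_neq_one)
  qed
  have \<phi>\<kappa>: "\<phi> (\<kappa> v) = v" if v: "v \<in> E.Vs" for v
  proof (rule sep[OF E.verts_space \<phi>v[OF \<kappa>v[OF v]] v])
    fix a assume a: "a \<in> E.CV"
    then have "a (\<phi> (\<kappa> v)) = \<Theta> a (\<kappa> v)" using \<phi>(2) \<kappa>v[OF v] by simp
    also have "\<dots> = inv.\<Theta> (\<Theta> a) v" using \<kappa>(2) \<Theta>(1)[OF a] v by simp
    finally show "a (\<phi> (\<kappa> v)) = a v" using inv1[OF a] by simp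
  qed
  have \<kappa>\<phi>: "\<kappa> (\<phi> w) = w" if w: "w \<in> F.Vs" for w
  proof (rule sep[OF F.verts_space \<kappa>v[OF \<phi>v[OF w]] w])
    fix b assume b: "b \<in> F.CV"
    then have "b (\<kappa> (\<phi> w)) = inv.\<Theta> b (\<phi> w)" using \<kappa>(2) \<phi>v[OF w] by simp
    also have "\<dots> = \<Theta> (inv.\<Theta> b) w" using \<phi>(2) inv.\<Theta>(1)[OF b] w by simp
    finally show "b (\<kappa> (\<phi> w)) = b w" using inv2[OF b] by simp
  qed
  have homeo: "homeomorphic_maps (verts E) (verts F) \<kappa> \<phi>"
    using \<phi>(1) \<kappa>(1) \<phi>\<kappa> \<kappa>\<phi> by (simp add: homeomorphic_maps_def)
  then have hm: "homeomorphic_map (verts F) (verts E) \<phi>" "homeomorphic_map (verts E) (verts F) \<kappa>"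
    by (simp_all add: homeomorphic_maps_map)
  interpret A: transported_rep E F TF \<iota>XF \<iota>AF \<gamma>F "\<theta> \<circ> \<iota>XE" "\<theta> \<circ> \<iota>AE" \<phi>
    by (rule transported[OF hm(1) \<phi>(2)])
  interpret B: transported_rep F E TE \<iota>XE \<iota>AE \<gamma>E "?k \<circ> \<iota>XF" "?k \<circ> \<iota>AF" \<kappa>
    by (rule inv.transported[OF hm(2) \<kappa>(2)])
  have "graph_gluing E F \<phi> \<kappa>"
  proof
    show "homeomorphic_maps (verts E) (verts F) \<kappa> \<phi>" by (rule homeo)
    show "totally_disconnected_space (verts E)" by (rule td)
    fix v assume v: "v \<in> E.Vs"
    obtain \<sigma> where \<sigma>: "inj_on \<sigma> (fibre E v)" "\<sigma> ` fibre E v \<subseteq> fibre F (\<kappa> v)"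
      "\<forall>e \<in> fibre E v. germ_key (edges F) (\<phi> \<circ> src F) (\<phi> \<circ> rng F) (\<sigma> e) = E.key e"
      using A.fibre_injection[OF \<kappa>v[OF v]] unfolding \<phi>\<kappa>[OF v] by blast
    \<comment> \<open>\<open>\<tau>\<close> only contributes the reverse inequality of
      cardinalities, which makes the key-preserving injection \<open>\<sigma>\<close>
      surjective.\<close>
    obtain \<tau> where "inj_on \<tau> (fibre F (\<kappa> v))" "\<tau> ` fibre F (\<kappa> v) \<subseteq> fibre E v"
      using B.fibre_injection[OF v] by blast
    then have "card (fibre F (\<kappa> v)) \<le> card (fibre E v)"
      using card_inj_on_le E.finite_fibre by blast
    then have "\<sigma> ` fibre E v = fibre F (\<kappa> v)"
      using \<sigma>(1,2) F.finite_fibre card_image card_seteq by metis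
    then show "\<exists>\<sigma>. bij_betw \<sigma> (fibre E v) (fibre F (\<kappa> v)) \<and>
      (\<forall>e \<in> fibre E v. germ_key (edges F) (\<phi> \<circ> src F) (\<phi> \<circ> rng F) (\<sigma> e)
        = E.key e)"
      using \<sigma>(1,3) unfolding bij_betw_def by blast
  qed
  then show ?thesis by (rule graph_gluing.isomorphic)
qed

end

theorem corollary4p7:
  fixes E :: "('v, 'e) topological_graph" and F :: "('w, 'f) topological_graph"
    and TE :: "'s star_algebra" and TF :: "'t star_algebra"
  assumes "compact_topological_graph E" and "compact_topological_graph F"
    and "totally_disconnected_space (verts E)"
    and "is_toeplitz_algebra E TE \<iota>XE \<iota>AE" and "is_toeplitz_algebra F TF \<iota>XF \<iota>AF"
    and "is_gauge_action E TE \<iota>XE \<iota>AE \<gamma>E" and "is_gauge_action F TF \<iota>XF \<iota>AF \<gamma>F"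
    and "triple_isomorphic
           (TE, \<gamma>E, \<iota>AE ` carrier (cfun_algebra (verts E)))
           (TF, \<gamma>F, \<iota>AF ` carrier (cfun_algebra (verts F)))"
  shows "graph_isomorphic E F"
proof -
  obtain \<theta> where \<theta>: "star_iso TE TF \<theta>"
    "\<forall>z \<in> sphere 0 1. \<forall>s \<in> carrier TE. \<theta> (\<gamma>E z s) = \<gamma>F z (\<theta> s)"
    "\<theta> ` \<iota>AE ` cfun (verts E) = \<iota>AF ` cfun (verts F)"
    using assms(8) unfolding triple_isomorphic_def by auto
  interpret triple_iso E F TE TF \<iota>XE \<iota>AE \<gamma>E \<iota>XF \<iota>AF \<gamma>F \<theta>
    by unfold_locales (use assms \<theta> in auto)
  show ?thesis by (rule graphs_isomorphic[OF assms(3)])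
qed

end
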